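(* Let $X$ be a separable operator space with the $\lambda$-CSEP. If $\lambda<2$, then $X$ is reflexive (and hence is $\lambda$-injective).
   Context: Operator spaces are closed linear subspaces of $\mathcal L(H)$, $H$ a Hilbert space, with inherited matrix norms. An operator space $Z$ has the $\lambda$-CSEP ($\lambda$-Complete Separable Extension Property) if for all separable operator spaces $Y$, all closed linear subspaces $X\subset Y$, and all completely bounded operators $T:X\to Z$, there exists a completely bounded $\tilde T:Y\to Z$ extending $T$ with $\|\tilde T\|_{cb}\le\lambda\|T\|_{cb}$. An operator space $Z$ is $\lambda$-injective if the same extension property holds for arbitrary (not necessarily separable) operator spaces $X\subset Y$. Reflexive means reflexive as a Banach space. *)

theory Defs
  imports "HOL-Analysis.Analysis"
begin

section \<open>Complex Hilbert spaces\<close>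

class scaleC = scaleR +
  fixes scaleC :: "complex \<Rightarrow> 'a \<Rightarrow> 'a"  (infixr \<open>*\<^sub>C\<close> 75)

class complex_normed_vector = scaleC + real_normed_vector +
  assumes scaleC_add_right: "a *\<^sub>C (x + y) = a *\<^sub>C x + a *\<^sub>C y"
    and scaleC_add_left: "(a + b) *\<^sub>C x = a *\<^sub>C x + b *\<^sub>C x"
    and scaleC_scaleC: "a *\<^sub>C (b *\<^sub>C x) = (a * b) *\<^sub>C x"
    and scaleC_of_real: "complex_of_real r *\<^sub>C x = r *\<^sub>R x"
    and norm_scaleC: "norm (a *\<^sub>C x) = cmod a * norm x"

text \<open>The inner product is conjugate-linear in its first argument.\<close>

class complex_hilbert_space = complex_normed_vector + complete_space +
  fixes cinner :: "'a \<Rightarrow> 'a \<Rightarrow> complex"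
  assumes cinner_commute: "cinner x y = cnj (cinner y x)"
    and cinner_add_right: "cinner x (y + z) = cinner x y + cinner x z"
    and cinner_scaleC_right: "cinner x (a *\<^sub>C y) = a * cinner x y"
    and cinner_self: "cinner x x = complex_of_real ((norm x)\<^sup>2)"

definition csubspace :: "'v::complex_normed_vector set \<Rightarrow> bool" where
  "csubspace V \<longleftrightarrow>
     0 \<in> V \<and> (\<forall>x\<in>V. \<forall>y\<in>V. x + y \<in> V) \<and> (\<forall>c. \<forall>x\<in>V. c *\<^sub>C x \<in> V)"

definition clinear_on ::
  "'v::complex_normed_vector set \<Rightarrow> ('v \<Rightarrow> 'w::complex_normed_vector) \<Rightarrow> bool" where
  "clinear_on V T \<longleftrightarrow>
     (\<forall>x\<in>V. \<forall>y\<in>V. T (x + y) = T x + T y) \<and> (\<forall>c. \<forall>x\<in>V. T (c *\<^sub>C x) = c *\<^sub>C T x)"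

text \<open>
  The library type of bounded (real-linear) operators carries the operator norm; with values in a
  complex normed space it is itself a complex normed space under pointwise scalar multiplication.
\<close>

instantiation blinfun :: (real_normed_vector, complex_normed_vector) complex_normed_vector
begin

lift_definition scaleC_blinfun :: "complex \<Rightarrow> 'a \<Rightarrow>\<^sub>L 'b \<Rightarrow> 'a \<Rightarrow>\<^sub>L 'b"
  is "\<lambda>c f x. c *\<^sub>C f x"
proof -
  fix c and f :: "'a \<Rightarrow> 'b"
  assume "bounded_linear f"
  then interpret f: bounded_linear f .
  obtain K where K: "\<And>x. norm (f x) \<le> norm x * K"
    using f.bounded by blast
  show "bounded_linear (\<lambda>x. c *\<^sub>C f x)"
  proof (rule bounded_linear_intro)
    show "c *\<^sub>C f (x + y) = c *\<^sub>C f x + c *\<^sub>C f y" for x y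
      by (simp add: f.add scaleC_add_right)
    show "c *\<^sub>C f (r *\<^sub>R x) = r *\<^sub>R (c *\<^sub>C f x)" for r x
      by (simp add: f.scaleR scaleC_scaleC mult.commute flip: scaleC_of_real)
    show "norm (c *\<^sub>C f x) \<le> norm x * (cmod c * K)" for x
      using mult_left_mono[OF K[of x], of "cmod c"] by (simp add: norm_scaleC ac_simps)
  qed
qed

instance
proof
  fix a b :: complex and r :: real and x y :: "'a \<Rightarrow>\<^sub>L 'b"
  show "a *\<^sub>C (x + y) = a *\<^sub>C x + a *\<^sub>C y"
    by (rule blinfun_eqI) (simp add: scaleC_blinfun.rep_eq blinfun.bilinear_simps scaleC_add_right)
  show "(a + b) *\<^sub>C x = a *\<^sub>C x + b *\<^sub>C x"
    by (rule blinfun_eqI) (simp add: scaleC_blinfun.rep_eq blinfun.bilinear_simps scaleC_add_left)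
  show "a *\<^sub>C (b *\<^sub>C x) = (a * b) *\<^sub>C x"
    by (rule blinfun_eqI) (simp add: scaleC_blinfun.rep_eq scaleC_scaleC)
  show "complex_of_real r *\<^sub>C x = r *\<^sub>R x"
    by (rule blinfun_eqI) (simp add: scaleC_blinfun.rep_eq blinfun.bilinear_simps scaleC_of_real)
  have le: "norm (c *\<^sub>C z) \<le> cmod c * norm z" for c and z :: "'a \<Rightarrow>\<^sub>L 'b"
  proof (rule norm_blinfun_bound)
    show "norm (blinfun_apply (c *\<^sub>C z) v) \<le> cmod c * norm z * norm v" for v
      using mult_left_mono[OF norm_blinfun[of z v], of "cmod c"]
      by (simp add: scaleC_blinfun.rep_eq norm_scaleC ac_simps)
  qed simp
  show "norm (a *\<^sub>C x) = cmod a * norm x"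
  proof (cases "a = 0")
    case True
    then show ?thesis using le[of a x] by simp
  next
    case False
    have "inverse a *\<^sub>C (a *\<^sub>C x) = x"
      using False
      by (intro blinfun_eqI)
        (simp add: scaleC_blinfun.rep_eq scaleC_scaleC scaleC_of_real[of 1, simplified])
    then have "norm x \<le> norm (a *\<^sub>C x) / cmod a"
      using le[of "inverse a" "a *\<^sub>C x"] by (simp add: norm_divide norm_inverse divide_inverse mult.commute)
    then show ?thesis
      using False le[of a x] by (intro antisym) (simp_all add: field_simps)
  qed
qed

end

section \<open>The Hilbert space of square-summable sequences\<close>

typedef ell2 = "{x :: nat \<Rightarrow> complex. summable (\<lambda>n. (cmod (x n))\<^sup>2)}"
  morphisms ell2_nth Abs_ell2
  by (rule exI[of _ "\<lambda>_. 0"]) simp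

setup_lifting type_definition_ell2

lemma ell2_L2_set_le:
  assumes "summable (\<lambda>n. (cmod (x n))\<^sup>2)"
  shows "L2_set (\<lambda>i. cmod (x i)) {..<n} \<le> sqrt (\<Sum>n. (cmod (x n))\<^sup>2)"
  unfolding L2_set_def by (intro real_sqrt_le_mono sum_le_suminf assms) auto

lemma ell2_boundI:
  assumes "\<And>n. L2_set (\<lambda>i. cmod (x i)) {..<n} \<le> K"
  shows "summable (\<lambda>n. (cmod (x n))\<^sup>2)" "sqrt (\<Sum>n. (cmod (x n))\<^sup>2) \<le> K"
proof -
  have K: "0 \<le> K" using assms[of 0] by simp
  have *: "(\<Sum>i<n. (cmod (x i))\<^sup>2) \<le> K\<^sup>2" for n
    using assms[of n] unfolding L2_set_def by (rule sqrt_le_D)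
  show s: "summable (\<lambda>n. (cmod (x n))\<^sup>2)"
    by (rule summableI_nonneg_bounded[OF _ *]) simp
  show "sqrt (\<Sum>n. (cmod (x n))\<^sup>2) \<le> K"
    by (rule real_le_lsqrt[OF K suminf_le_const[OF s *]])
qed

lemma ell2_add:
  assumes "summable (\<lambda>n. (cmod (x n))\<^sup>2)" "summable (\<lambda>n. (cmod (y n))\<^sup>2)"
  shows "summable (\<lambda>n. (cmod (x n + y n))\<^sup>2)"
    "sqrt (\<Sum>n. (cmod (x n + y n))\<^sup>2) \<le>
       sqrt (\<Sum>n. (cmod (x n))\<^sup>2) + sqrt (\<Sum>n. (cmod (y n))\<^sup>2)"
proof -
  have "L2_set (\<lambda>i. cmod (x i + y i)) {..<n} \<le>
      sqrt (\<Sum>n. (cmod (x n))\<^sup>2) + sqrt (\<Sum>n. (cmod (y n))\<^sup>2)" for n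
  proof -
    have "L2_set (\<lambda>i. cmod (x i + y i)) {..<n} \<le> L2_set (\<lambda>i. cmod (x i) + cmod (y i)) {..<n}"
      by (rule L2_set_mono) (auto intro: norm_triangle_ineq)
    also have "\<dots> \<le> L2_set (\<lambda>i. cmod (x i)) {..<n} + L2_set (\<lambda>i. cmod (y i)) {..<n}"
      by (rule L2_set_triangle_ineq)
    also have "\<dots> \<le> sqrt (\<Sum>n. (cmod (x n))\<^sup>2) + sqrt (\<Sum>n. (cmod (y n))\<^sup>2)"
      by (intro add_mono ell2_L2_set_le assms)
    finally show ?thesis .
  qed
  from ell2_boundI[OF this]
  show "summable (\<lambda>n. (cmod (x n + y n))\<^sup>2)"
    "sqrt (\<Sum>n. (cmod (x n + y n))\<^sup>2) \<le>
       sqrt (\<Sum>n. (cmod (x n))\<^sup>2) + sqrt (\<Sum>n. (cmod (y n))\<^sup>2)" .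
qed

lemma ell2_scale:
  "summable (\<lambda>n. (cmod (x n))\<^sup>2) \<Longrightarrow> summable (\<lambda>n. (cmod (c * x n))\<^sup>2)"
  by (simp add: norm_mult power_mult_distrib summable_mult)

lemma ell2_inner_summable:
  assumes "summable (\<lambda>n. (cmod (x n))\<^sup>2)" "summable (\<lambda>n. (cmod (y n))\<^sup>2)"
  shows "summable (\<lambda>n. cnj (x n) * y n)"
proof (rule summable_comparison_test)
  show "summable (\<lambda>n. (cmod (x n))\<^sup>2 + (cmod (y n))\<^sup>2)"
    by (intro summable_add assms)
  have "a * b \<le> a\<^sup>2 + b\<^sup>2" if "0 \<le> a" "0 \<le> b" for a b :: real
    using sum_squares_bound[of a b] mult_nonneg_nonneg[OF that] by linarith
  then show "\<exists>N. \<forall>n\<ge>N. norm (cnj (x n) * y n) \<le> (cmod (x n))\<^sup>2 + (cmod (y n))\<^sup>2"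
    by (simp add: norm_mult)
qed

instantiation ell2 :: complex_normed_vector
begin

lift_definition zero_ell2 :: ell2 is "\<lambda>_. 0" by simp
lift_definition plus_ell2 :: "ell2 \<Rightarrow> ell2 \<Rightarrow> ell2" is "\<lambda>x y n. x n + y n"
  by (rule ell2_add)
lift_definition uminus_ell2 :: "ell2 \<Rightarrow> ell2" is "\<lambda>x n. - x n" by simp
lift_definition minus_ell2 :: "ell2 \<Rightarrow> ell2 \<Rightarrow> ell2" is "\<lambda>x y n. x n - y n"
  using ell2_add(1)[of _ "\<lambda>n. - _ n"] by simp
lift_definition scaleR_ell2 :: "real \<Rightarrow> ell2 \<Rightarrow> ell2" is "\<lambda>r x n. complex_of_real r * x n"
  by (rule ell2_scale)
lift_definition scaleC_ell2 :: "complex \<Rightarrow> ell2 \<Rightarrow> ell2" is "\<lambda>c x n. c * x n"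
  by (rule ell2_scale)
lift_definition norm_ell2 :: "ell2 \<Rightarrow> real" is "\<lambda>x. sqrt (\<Sum>n. (cmod (x n))\<^sup>2)" .

definition "sgn (x :: ell2) = scaleR (inverse (norm x)) x"
definition "dist (x :: ell2) y = norm (x - y)"
definition "(uniformity :: (ell2 \<times> ell2) filter) = (INF e\<in>{0<..}. principal {(x, y). dist x y < e})"
definition "open (U :: ell2 set) = (\<forall>x\<in>U. eventually (\<lambda>(x', y). x' = x \<longrightarrow> y \<in> U) uniformity)"

instance
proof
  fix a b :: complex and r s :: real and x y z :: ell2
  show "x + y + z = x + (y + z)" by transfer (simp add: ac_simps)
  show "x + y = y + x" by transfer (simp add: ac_simps)
  show "0 + x = x" by transfer simp
  show "- x + x = 0" by transfer simp
  show "x - y = x + - y" by transfer simp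
  show "r *\<^sub>R (x + y) = r *\<^sub>R x + r *\<^sub>R y" by transfer (simp add: algebra_simps)
  show "(r + s) *\<^sub>R x = r *\<^sub>R x + s *\<^sub>R x" by transfer (simp add: algebra_simps)
  show "r *\<^sub>R s *\<^sub>R x = (r * s) *\<^sub>R x" by transfer (simp add: algebra_simps)
  show "1 *\<^sub>R x = x" by transfer simp
  show "a *\<^sub>C (x + y) = a *\<^sub>C x + a *\<^sub>C y" by transfer (simp add: algebra_simps)
  show "(a + b) *\<^sub>C x = a *\<^sub>C x + b *\<^sub>C x" by transfer (simp add: algebra_simps)
  show "a *\<^sub>C (b *\<^sub>C x) = (a * b) *\<^sub>C x" by transfer (simp add: algebra_simps)
  show "complex_of_real r *\<^sub>C x = r *\<^sub>R x" by transfer simp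
  show *: "norm (a *\<^sub>C x) = cmod a * norm x" for a
    by transfer (simp add: norm_mult power_mult_distrib suminf_mult real_sqrt_mult)
  show "norm (r *\<^sub>R x) = \<bar>r\<bar> * norm x"
    using *[of "complex_of_real r"] by (simp add: scaleC_ell2_def scaleR_ell2_def)
  show "norm (x + y) \<le> norm x + norm y" by transfer (rule ell2_add)
  show "norm x = 0 \<longleftrightarrow> x = 0"
    by transfer (auto simp: suminf_eq_zero_iff)
  show "sgn x = scaleR (inverse (norm x)) x" "dist x y = norm (x - y)"
    by (simp_all add: sgn_ell2_def dist_ell2_def)
qed (simp_all add: uniformity_ell2_def open_ell2_def)

end

lemma ell2_nth_le_norm: "cmod (ell2_nth x i) \<le> norm x"
proof transfer
  fix x :: "nat \<Rightarrow> complex" and i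
  assume s: "summable (\<lambda>n. (cmod (x n))\<^sup>2)"
  have "cmod (x i) \<le> L2_set (\<lambda>i. cmod (x i)) {..<Suc i}"
    by (rule member_le_L2_set) auto
  also note ell2_L2_set_le[OF s]
  finally show "cmod (x i) \<le> sqrt (\<Sum>n. (cmod (x n))\<^sup>2)" .
qed

instantiation ell2 :: complex_hilbert_space
begin

lift_definition cinner_ell2 :: "ell2 \<Rightarrow> ell2 \<Rightarrow> complex" is "\<lambda>x y. \<Sum>n. cnj (x n) * y n" .

instance
proof
  fix a :: complex and x y z :: ell2
  show "cinner x y = cnj (cinner y x)"
  proof transfer
    fix x y :: "nat \<Rightarrow> complex"
    assume "summable (\<lambda>n. (cmod (x n))\<^sup>2)" "summable (\<lambda>n. (cmod (y n))\<^sup>2)"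
    then have "(\<lambda>n. cnj (y n) * x n) sums (\<Sum>n. cnj (y n) * x n)"
      by (intro summable_sums ell2_inner_summable)
    then have "(\<lambda>n. cnj (cnj (y n) * x n)) sums cnj (\<Sum>n. cnj (y n) * x n)"
      by (simp only: sums_cnj)
    then show "(\<Sum>n. cnj (x n) * y n) = cnj (\<Sum>n. cnj (y n) * x n)"
      by (simp add: sums_iff mult.commute)
  qed
  show "cinner x (y + z) = cinner x y + cinner x z"
    by transfer (simp add: distrib_left suminf_add ell2_inner_summable)
  show "cinner x (a *\<^sub>C y) = a * cinner x y"
  proof transfer
    fix x y :: "nat \<Rightarrow> complex" and a
    assume "summable (\<lambda>n. (cmod (x n))\<^sup>2)" "summable (\<lambda>n. (cmod (y n))\<^sup>2)"
    from suminf_mult[OF ell2_inner_summable[OF this], of a]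
    show "(\<Sum>n. cnj (x n) * (a * y n)) = a * (\<Sum>n. cnj (x n) * y n)"
      by (simp add: ac_simps)
  qed
  show "cinner x x = complex_of_real ((norm x)\<^sup>2)"
  proof transfer
    fix x :: "nat \<Rightarrow> complex"
    assume s: "summable (\<lambda>n. (cmod (x n))\<^sup>2)"
    have "cnj (x n) * x n = complex_of_real ((cmod (x n))\<^sup>2)" for n
      by (simp only: complex_norm_square mult.commute)
    then show "(\<Sum>n. cnj (x n) * x n) = complex_of_real ((sqrt (\<Sum>n. (cmod (x n))\<^sup>2))\<^sup>2)"
      using s by (simp add: suminf_of_real suminf_nonneg del: of_real_power)
  qed
next
  fix X :: "nat \<Rightarrow> ell2"
  assume X: "Cauchy X"
  define y where "y i = lim (\<lambda>k. ell2_nth (X k) i)" for i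
  have "Cauchy (\<lambda>k. ell2_nth (X k) i)" for i
    unfolding Cauchy_def
  proof (intro allI impI)
    fix e :: real assume "0 < e"
    then obtain M where M: "\<And>m n. m \<ge> M \<Longrightarrow> n \<ge> M \<Longrightarrow> dist (X m) (X n) < e"
      using X unfolding Cauchy_def by blast
    have "dist (ell2_nth (X m) i) (ell2_nth (X n) i) \<le> dist (X m) (X n)" for m n
      using ell2_nth_le_norm[of "X m - X n" i] by (simp add: dist_norm minus_ell2.rep_eq)
    with M show "\<exists>M. \<forall>m\<ge>M. \<forall>n\<ge>M. dist (ell2_nth (X m) i) (ell2_nth (X n) i) < e"
      by (meson le_less_trans)
  qed
  then have y: "(\<lambda>k. ell2_nth (X k) i) \<longlonglongrightarrow> y i" for i
    unfolding y_def by (simp add: Cauchy_convergent_iff convergent_LIMSEQ_iff)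
  have tail: "\<exists>M. \<forall>m\<ge>M. \<forall>n. L2_set (\<lambda>i. cmod (ell2_nth (X m) i - y i)) {..<n} \<le> e"
    if "0 < e" for e
  proof -
    obtain M where M: "\<And>m n. m \<ge> M \<Longrightarrow> n \<ge> M \<Longrightarrow> dist (X m) (X n) < e"
      using X \<open>0 < e\<close> unfolding Cauchy_def by blast
    have "L2_set (\<lambda>i. cmod (ell2_nth (X m) i - y i)) {..<n} \<le> e" if "m \<ge> M" for m n
    proof (rule LIMSEQ_le_const2)
      show "(\<lambda>k. L2_set (\<lambda>i. cmod (ell2_nth (X m) i - ell2_nth (X k) i)) {..<n})
          \<longlonglongrightarrow> L2_set (\<lambda>i. cmod (ell2_nth (X m) i - y i)) {..<n}"
        unfolding L2_set_def by (intro tendsto_intros y)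
      have "L2_set (\<lambda>i. cmod (ell2_nth (X m) i - ell2_nth (X k) i)) {..<n} \<le> dist (X m) (X k)" for k
        using ell2_L2_set_le[OF ell2_nth[of "X m - X k", simplified], of n]
        by (simp add: dist_norm norm_ell2.rep_eq minus_ell2.rep_eq)
      with M[OF that] show "\<exists>N. \<forall>k\<ge>N.
          L2_set (\<lambda>i. cmod (ell2_nth (X m) i - ell2_nth (X k) i)) {..<n} \<le> e"
        by (meson le_less_trans less_imp_le)
    qed
    then show ?thesis by blast
  qed
  obtain m where m: "\<And>n. L2_set (\<lambda>i. cmod (ell2_nth (X m) i - y i)) {..<n} \<le> 1"
    using tail[of 1] by auto
  have "summable (\<lambda>n. (cmod (- (ell2_nth (X m) n - y n)))\<^sup>2)"
    using ell2_boundI(1)[OF m] by (simp add: norm_minus_commute)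
  from ell2_add(1)[OF ell2_nth[of "X m", simplified] this]
  have "summable (\<lambda>n. (cmod (y n))\<^sup>2)" by simp
  then obtain Y where Y: "ell2_nth Y = y"
    by (metis (mono_tags) Abs_ell2_inverse mem_Collect_eq)
  have "X \<longlonglongrightarrow> Y"
    unfolding LIMSEQ_def
  proof (intro allI impI)
    fix e :: real assume "0 < e"
    then obtain M where M: "\<And>m n. m \<ge> M \<Longrightarrow> L2_set (\<lambda>i. cmod (ell2_nth (X m) i - y i)) {..<n} \<le> e / 2"
      using tail[of "e / 2"] by auto
    have "dist (X m) Y \<le> e / 2" if "m \<ge> M" for m
      using ell2_boundI(2)[OF M[OF that]]
      by (simp add: dist_norm norm_ell2.rep_eq minus_ell2.rep_eq Y)
    then show "\<exists>M. \<forall>m\<ge>M. dist (X m) Y < e"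
      using \<open>0 < e\<close> by (intro exI[of _ M]) force
  qed
  then show "convergent X" by (rule convergentI)
qed

end

section \<open>Operator spaces and completely bounded maps\<close>

definition operator_space :: "('h::complex_hilbert_space \<Rightarrow>\<^sub>L 'h) set \<Rightarrow> bool" where
  "operator_space X \<longleftrightarrow>
     (\<forall>A\<in>X. clinear_on UNIV (blinfun_apply A)) \<and> csubspace X \<and> closed X"

text \<open>
  The norm of the \<open>n \<times> n\<close> operator matrix \<open>(A i j)\<close>, \<open>i, j < n\<close>, acting on the \<open>n\<close>-fold Hilbert
  sum of \<open>'h\<close>. Entries of \<open>A\<close> and of the vectors \<open>v\<close> with index \<open>\<ge> n\<close> are ignored.
\<close>

definition matrix_norm :: "nat \<Rightarrow> (nat \<Rightarrow> nat \<Rightarrow> 'h::complex_hilbert_space \<Rightarrow>\<^sub>L 'h) \<Rightarrow> real" where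
  "matrix_norm n A =
     (SUP v\<in>{v. L2_set (\<lambda>j. norm (v j)) {..<n} \<le> 1}.
        L2_set (\<lambda>i. norm (\<Sum>j<n. blinfun_apply (A i j) (v j))) {..<n})"

definition matrix_unit_ball ::
  "('h::complex_hilbert_space \<Rightarrow>\<^sub>L 'h) set \<Rightarrow> nat \<Rightarrow> (nat \<Rightarrow> nat \<Rightarrow> 'h \<Rightarrow>\<^sub>L 'h) set" where
  "matrix_unit_ball X n = {A. (\<forall>i<n. \<forall>j<n. A i j \<in> X) \<and> matrix_norm n A \<le> 1}"

text \<open>
  The set of all norms of \<open>(T (A i j))\<close>, where \<open>(A i j)\<close> ranges over the unit balls of the
  \<open>n \<times> n\<close> matrices over \<open>X\<close> and \<open>n\<close> over all sizes: the supremum is \<open>\<parallel>T\<parallel>\<^sub>c\<^sub>b\<close>. Maps on an operator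
  space are total functions of which only the values on that space matter.
\<close>

definition cb_values ::
  "('h::complex_hilbert_space \<Rightarrow>\<^sub>L 'h) set \<Rightarrow> (('h \<Rightarrow>\<^sub>L 'h) \<Rightarrow> ('k::complex_hilbert_space \<Rightarrow>\<^sub>L 'k)) \<Rightarrow> real set"
  where
  "cb_values X T = (\<Union>n. (\<lambda>A. matrix_norm n (\<lambda>i j. T (A i j))) ` matrix_unit_ball X n)"

definition cb_norm ::
  "('h::complex_hilbert_space \<Rightarrow>\<^sub>L 'h) set \<Rightarrow> (('h \<Rightarrow>\<^sub>L 'h) \<Rightarrow> ('k::complex_hilbert_space \<Rightarrow>\<^sub>L 'k)) \<Rightarrow> real"
  where
  "cb_norm X T = Sup (cb_values X T)"

definition completely_bounded ::
  "('h::complex_hilbert_space \<Rightarrow>\<^sub>L 'h) set \<Rightarrow> ('k::complex_hilbert_space \<Rightarrow>\<^sub>L 'k) set \<Rightarrow>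
   (('h \<Rightarrow>\<^sub>L 'h) \<Rightarrow> ('k \<Rightarrow>\<^sub>L 'k)) \<Rightarrow> bool"
  where
  "completely_bounded X Z T \<longleftrightarrow>
     clinear_on X T \<and> (\<forall>A\<in>X. T A \<in> Z) \<and> bdd_above (cb_values X T)"

definition cb_extension_property ::
  "real \<Rightarrow> ('h::complex_hilbert_space \<Rightarrow>\<^sub>L 'h) set \<Rightarrow> ('h \<Rightarrow>\<^sub>L 'h) set \<Rightarrow>
   ('k::complex_hilbert_space \<Rightarrow>\<^sub>L 'k) set \<Rightarrow> bool"
  where
  "cb_extension_property lam X Y Z \<longleftrightarrow>
     (\<forall>T. completely_bounded X Z T \<longrightarrow>
        (\<exists>T'. completely_bounded Y Z T' \<and> (\<forall>A\<in>X. T' A = T A) \<and>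
              cb_norm Y T' \<le> lam * cb_norm X T))"

text \<open>
  HOL cannot quantify over all Hilbert spaces inside a formula, so the Hilbert space on which the
  test spaces \<open>X \<subseteq> Y\<close> act is a type argument of the next two notions. For the CSEP nothing is lost
  by taking it to be \<^typ>\<open>ell2\<close>, as every separable operator space is completely isometric to one
  acting on \<^typ>\<open>ell2\<close>. Injectivity in the full sense is obtained by leaving \<open>'h\<close> arbitrary.
\<close>

definition CSEP ::
  "'h::complex_hilbert_space itself \<Rightarrow> real \<Rightarrow> ('k::complex_hilbert_space \<Rightarrow>\<^sub>L 'k) set \<Rightarrow> bool" where
  "CSEP _ lam Z \<longleftrightarrow>
     (\<forall>(X :: ('h \<Rightarrow>\<^sub>L 'h) set) Y.
        operator_space Y \<and> separable_space (top_of_set Y) \<and> operator_space X \<and> X \<subseteq> Y \<longrightarrow>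
        cb_extension_property lam X Y Z)"

definition injective ::
  "'h::complex_hilbert_space itself \<Rightarrow> real \<Rightarrow> ('k::complex_hilbert_space \<Rightarrow>\<^sub>L 'k) set \<Rightarrow> bool" where
  "injective _ lam Z \<longleftrightarrow>
     (\<forall>(X :: ('h \<Rightarrow>\<^sub>L 'h) set) Y.
        operator_space Y \<and> operator_space X \<and> X \<subseteq> Y \<longrightarrow> cb_extension_property lam X Y Z)"

section \<open>Reflexivity\<close>

text \<open>
  The dual of a subspace \<open>V\<close>. Functionals are made to vanish off \<open>V\<close> so that each is represented by
  exactly one function and pointwise operations give the vector space structure of the dual.
\<close>

definition dual :: "'v::complex_normed_vector set \<Rightarrow> ('v \<Rightarrow> complex) set" where
  "dual V = {f. (\<forall>x. x \<notin> V \<longrightarrow> f x = 0) \<and>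
     (\<forall>x\<in>V. \<forall>y\<in>V. f (x + y) = f x + f y) \<and> (\<forall>c. \<forall>x\<in>V. f (c *\<^sub>C x) = c * f x) \<and>
     (\<exists>K. \<forall>x\<in>V. cmod (f x) \<le> K * norm x)}"

definition dual_norm :: "'v::complex_normed_vector set \<Rightarrow> ('v \<Rightarrow> complex) \<Rightarrow> real" where
  "dual_norm V f = (SUP x\<in>{x\<in>V. norm x \<le> 1}. cmod (f x))"

definition bidual :: "'v::complex_normed_vector set \<Rightarrow> (('v \<Rightarrow> complex) \<Rightarrow> complex) set" where
  "bidual V = {\<Phi>.
     (\<forall>f\<in>dual V. \<forall>g\<in>dual V. \<Phi> (\<lambda>x. f x + g x) = \<Phi> f + \<Phi> g) \<and>
     (\<forall>c. \<forall>f\<in>dual V. \<Phi> (\<lambda>x. c * f x) = c * \<Phi> f) \<and>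
     (\<exists>K. \<forall>f\<in>dual V. cmod (\<Phi> f) \<le> K * dual_norm V f)}"

text \<open>The canonical embedding of \<open>V\<close> into its bidual is onto.\<close>

definition reflexive :: "'v::complex_normed_vector set \<Rightarrow> bool" where
  "reflexive V \<longleftrightarrow> (\<forall>\<Phi>\<in>bidual V. \<exists>x\<in>V. \<forall>f\<in>dual V. \<Phi> f = f x)"

end

theory Submission
  imports Defs
begin

text \<open>
  Let \<open>X\<close> be a separable operator space with the \<open>\<lambda>\<close>-CSEP, \<open>\<lambda> < 2\<close>.

  \<^emph>\<open>No copy of \<open>c\<^sub>0\<close>\<close> (lemma \<open>separable_CSEP_no_c0\<close>). Suppose that \<open>X\<close> contains a sequence which is bounded below and all of whose
  signed sums are bounded. By James's distortion argument (\<open>c0_distortion\<close>) it has blocks \<open>u\<^sub>j\<close>, of norm almost \<open>q\<close>, all of whose signed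
  sums have norm at most almost \<open>q\<close>. For a choice \<open>\<sigma>\<close> of signs let \<open>y\<close> be the weak sum of the \<open>\<sigma>\<^sub>j u\<^sub>j\<close>; then \<open>y - 2 \<sigma>\<^sub>j u\<^sub>j\<close> arises from
  \<open>y\<close> by one change of sign and also has norm at most almost \<open>q\<close>. A projection \<open>Q\<close> onto \<open>X\<close> of norm at most \<open>\<lambda>\<close>, defined
  on a separable space containing \<open>X\<close> and \<open>y\<close>, takes \<open>y\<close> to a point \<open>w\<close> of \<open>X\<close> within about \<open>\<lambda> q < 2 q\<close> of every \<open>2 \<sigma>\<^sub>j u\<^sub>j\<close>. So a
  functional norming \<open>u\<^sub>j\<close> reads the sign \<open>\<sigma>\<^sub>j\<close> off \<open>w\<close>. Uncountably many choices of signs yield uncountably many points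
  at mutual distances bounded below, which is impossible in a separable space.

  \<^emph>\<open>A nonreflexive \<open>X\<close> contains \<open>c\<^sub>0\<close>\<close> (\<open>separable_CSEP_reflexive\<close>). The CSEP yields a bounded projection \<open>Q\<close> of
  a separable C*-algebra \<open>Y\<close> onto \<open>X\<close>, and the argument is in the spirit of the theorem of Akemann, Dodds and Gamlen that
  operators on C*-algebras which do not fix \<open>c\<^sub>0\<close> are weakly compact. By James, a nonreflexive space contains a bounded sequence in which
  convex combinations of disjoint successive blocks stay at a distance of at least \<open>\<theta>\<close> (\<open>nonreflexive_separated_sequence\<close>).
  Suitable differences \<open>z\<^sub>i\<close> of such convex combinations can be made null for any countable family of seminorms \<open>\<parallel>\<phi> (z _)\<parallel>\<close>
  and \<open>\<parallel>\<phi> (_ z)\<parallel>\<close> (\<open>successive_averages\<close>, \<open>null_differences\<close>), among them those of the functionals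
  \<open>\<phi>\<^sub>i = f\<^sub>i \<circ> Q\<close> with \<open>f\<^sub>i\<close> norming \<open>z\<^sub>i\<close>. Resolvents of \<open>\<Sum> z\<^sub>k z\<^sub>k\<^sup>*\<close> and \<open>\<Sum> z\<^sub>k\<^sup>* z\<^sub>k\<close> then provide factors \<open>L\<^sub>i\<close>, \<open>R\<^sub>i\<close> in \<open>Y\<close> for which a subsequence
  of \<open>L\<^sub>i z\<^sub>i R\<^sub>i\<close> is almost block diagonal while the \<open>\<phi>\<^sub>i (L\<^sub>i z\<^sub>i R\<^sub>i)\<close> stay away from 0 (\<open>row_disjointification\<close>, \<open>orthogonal_sequence\<close>).
  Its image under \<open>Q\<close> is the forbidden sequence in \<open>X\<close>.

  \<^emph>\<open>Injectivity\<close> (\<open>reflexive_CSEP_injective\<close>). Extend the given map to the separable pieces of the large space and take a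
  weak limit, which lies in the reflexive space \<open>X\<close>; cb norms are lower semicontinuous for such limits.

  The definition of the CSEP tests spaces of operators on \<open>ell2\<close> only. Compressing to the span of countably many vectors
  which norm all matrices over a countable dense set shows that the property holds for separable spaces of operators on every Hilbert space
  (\<open>CSEP_transfer\<close>).
\<close>

declare [[coercion "blinfun_apply :: ('a::real_normed_vector \<Rightarrow>\<^sub>L 'b::real_normed_vector) \<Rightarrow> 'a \<Rightarrow> 'b"]]

section \<open>Inner products, bounded forms and adjoints\<close>

subclass (in complex_hilbert_space) banach ..

lemma scaleC_one [simp]: "1 *\<^sub>C x = (x::'a::complex_normed_vector)"
  using scaleC_of_real[of 1 x] by simp

lemma scaleC_zero_left [simp]: "0 *\<^sub>C x = (0::'a::complex_normed_vector)"
  using scaleC_of_real[of 0 x] by simp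

lemma scaleC_zero_right [simp]: "a *\<^sub>C (0::'a::complex_normed_vector) = 0"
  using norm_scaleC[of a "0::'a"] by simp

lemma scaleC_minus_left: "(- a) *\<^sub>C x = - (a *\<^sub>C (x::'a::complex_normed_vector))"
  using scaleC_add_left[of a "-a" x] by (simp add: eq_neg_iff_add_eq_0 add.commute)

lemma scaleC_minus_right: "a *\<^sub>C (- x) = - (a *\<^sub>C (x::'a::complex_normed_vector))"
  using scaleC_add_right[of a x "-x"] by (simp add: eq_neg_iff_add_eq_0 add.commute)

lemma scaleC_diff_right: "a *\<^sub>C (x - y) = a *\<^sub>C x - a *\<^sub>C (y::'a::complex_normed_vector)"
  by (simp only: diff_conv_add_uminus scaleC_add_right scaleC_minus_right)

lemma scaleC_diff_left: "(a - b) *\<^sub>C x = a *\<^sub>C x - b *\<^sub>C (x::'a::complex_normed_vector)"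
  by (simp only: diff_conv_add_uminus scaleC_add_left scaleC_minus_left)

lemma bounded_linear_scaleC: "bounded_linear (\<lambda>x. a *\<^sub>C (x::'a::complex_normed_vector))"
proof (rule bounded_linear_intro)
  show "a *\<^sub>C (r *\<^sub>R x) = r *\<^sub>R (a *\<^sub>C x)" for r and x :: 'a
    by (simp add: scaleC_scaleC mult.commute flip: scaleC_of_real)
  show "norm (a *\<^sub>C x) \<le> norm x * cmod a" for x :: 'a by (simp add: norm_scaleC)
qed (rule scaleC_add_right)

lemma cinner_zero_right [simp]: "cinner x 0 = 0"
  using cinner_scaleC_right[of x 0 0] by simp

lemma cinner_zero_left [simp]: "cinner 0 x = 0"
  by (subst cinner_commute) simp

lemma cinner_add_left: "cinner (x + y) z = cinner x z + cinner y z"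
  by (subst (1 2 3) cinner_commute) (simp add: cinner_add_right)

lemma cinner_scaleC_left: "cinner (a *\<^sub>C x) y = cnj a * cinner x y"
  by (subst (1 2) cinner_commute) (simp add: cinner_scaleC_right)

lemma cinner_minus_right: "cinner x (- y) = - cinner x y"
  using cinner_add_right[of x y "-y"] by (simp add: eq_neg_iff_add_eq_0 add.commute)

lemma cinner_minus_left: "cinner (- x) y = - cinner x y"
  using cinner_add_left[of x "-x" y] by (simp add: eq_neg_iff_add_eq_0 add.commute)

lemma cinner_diff_right: "cinner x (y - z) = cinner x y - cinner x z"
  by (simp only: diff_conv_add_uminus cinner_add_right cinner_minus_right)

lemma cinner_diff_left: "cinner (x - y) z = cinner x z - cinner y z"
  by (simp only: diff_conv_add_uminus cinner_add_left cinner_minus_left)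

lemma cinner_scaleR_right: "cinner x (r *\<^sub>R y) = r * cinner x y"
  using cinner_scaleC_right[of x "of_real r" y] by (simp add: scaleC_of_real)

lemma cinner_scaleR_left: "cinner (r *\<^sub>R x) y = r * cinner x y"
  using cinner_scaleC_left[of "of_real r" x y] by (simp add: scaleC_of_real)

lemma cinner_sum_right: "cinner x (\<Sum>i\<in>I. f i) = (\<Sum>i\<in>I. cinner x (f i))"
  by (induction I rule: infinite_finite_induct) (auto simp: cinner_add_right)

lemma cinner_sum_left: "cinner (\<Sum>i\<in>I. f i) x = (\<Sum>i\<in>I. cinner (f i) x)"
  by (induction I rule: infinite_finite_induct) (auto simp: cinner_add_left)

lemmas cinner_simps = cinner_add_left cinner_add_right cinner_diff_left cinner_diff_right
  cinner_minus_left cinner_minus_right cinner_scaleC_left cinner_scaleC_right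
  cinner_scaleR_left cinner_scaleR_right

lemma Re_cinner_commute: "Re (cinner x y) = Re (cinner y x)"
  by (subst cinner_commute) simp

lemma Re_cinner_self [simp]: "Re (cinner x x) = (norm x)\<^sup>2"
  by (simp add: cinner_self)

lemma norm_add_square: "(norm (x + y))\<^sup>2 = (norm x)\<^sup>2 + 2 * Re (cinner x y) + (norm (y::'a::complex_hilbert_space))\<^sup>2"
  using Re_cinner_self[of "x + y"] Re_cinner_commute[of y x] by (simp add: cinner_simps)

lemma norm_diff_square: "(norm (x - y))\<^sup>2 = (norm x)\<^sup>2 - 2 * Re (cinner x y) + (norm (y::'a::complex_hilbert_space))\<^sup>2"
  using norm_add_square[of x "-y"] by (simp add: cinner_simps)

lemma Cauchy_Schwarz_cinner: "cmod (cinner x y) \<le> norm x * norm (y::'a::complex_hilbert_space)"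
proof (cases "y = 0")
  case False
  define a where "a = cinner y x / (norm y)\<^sup>2"
  have e: "cinner y x * cinner x y = of_real ((cmod (cinner x y))\<^sup>2)"
    by (subst cinner_commute[of y x]) (simp add: complex_norm_square[symmetric] mult.commute)
  have "Re (cinner x (a *\<^sub>C y)) = (cmod (cinner x y))\<^sup>2 / (norm y)\<^sup>2"
    unfolding a_def by (simp add: cinner_simps e flip: of_real_power of_real_divide)
  moreover have "norm (a *\<^sub>C y) = cmod (cinner x y) / norm y"
    using False cinner_commute[of x y]
    by (simp add: norm_scaleC a_def norm_divide norm_power norm_mult power2_eq_square field_simps)
  ultimately have "(norm (x - a *\<^sub>C y))\<^sup>2 = (norm x)\<^sup>2 - (cmod (cinner x y) / norm y)\<^sup>2"
    by (simp add: norm_diff_square power_divide)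
  then have "(cmod (cinner x y) / norm y)\<^sup>2 \<le> (norm x)\<^sup>2"
    using zero_le_power2[of "norm (x - a *\<^sub>C y)"] by linarith
  then have "cmod (cinner x y) / norm y \<le> norm x" by (rule power2_le_imp_le) simp
  then show ?thesis using False by (simp add: field_simps)
qed simp

lemma norm_le_cinnerI:
  fixes x :: "'a::complex_hilbert_space"
  assumes "\<And>y. cmod (cinner y x) \<le> K * norm y" "0 \<le> K"
  shows "norm x \<le> K"
proof (cases "x = 0")
  case False
  have "(norm x)\<^sup>2 \<le> K * norm x"
    using assms(1)[of x] by (simp add: cinner_self norm_power)
  then show ?thesis using False by (simp add: power2_eq_square)
qed (use assms in simp)

lemma cinner_eqI:
  fixes x y :: "'a::complex_hilbert_space"
  assumes "\<And>z. cinner z x = cinner z y"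
  shows "x = y"
proof -
  have "cinner (x - y) (x - y) = 0" using assms[of "x - y"] by (simp add: cinner_diff_right)
  then show ?thesis by (simp add: cinner_self)
qed

text \<open>
  By the parallelogram law every minimising sequence of \<open>\<parallel>x\<parallel>\<^sup>2 - 2 Re f(x)\<close> is a Cauchy sequence; at the minimum \<open>z\<close> the
  derivative vanishes, which says \<open>Re f = Re \<langle>z, _\<rangle>\<close>.
\<close>

lemma Riesz_representation:
  fixes f :: "'a::complex_hilbert_space \<Rightarrow> complex"
  assumes add: "\<And>x y. f (x + y) = f x + f y" and scale: "\<And>a x. f (a *\<^sub>C x) = a * f x"
    and bound: "\<And>x. cmod (f x) \<le> K * norm x"
  shows "\<exists>z. \<forall>x. f x = cinner z x"
proof -
  define F where "F x = (norm x)\<^sup>2 - 2 * Re (f x)" for x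
  have scaleR: "f (r *\<^sub>R x) = r * f x" for r x
    using scale[of "of_real r" x] by (simp add: scaleC_of_real)
  have "F x \<ge> - K\<^sup>2" for x
  proof -
    have "Re (f x) \<le> K * norm x" using bound[of x] complex_Re_le_cmod[of "f x"] by linarith
    moreover have "0 \<le> (norm x - K)\<^sup>2" by simp
    ultimately show ?thesis unfolding F_def by (simp add: power2_eq_square algebra_simps)
  qed
  then have bdd: "bdd_below (range F)" by (intro bdd_belowI[of _ "- K\<^sup>2"]) auto
  define m where "m = Inf (range F)"
  have m: "m \<le> F x" for x unfolding m_def by (rule cInf_lower[OF _ bdd]) simp
  have "\<exists>x. F x < m + 1 / real (Suc n)" for n
    using cInf_lessD[of "range F" "m + 1 / real (Suc n)"] unfolding m_def by auto
  then obtain X where X: "\<And>n. F (X n) < m + 1 / real (Suc n)" by metis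
  have par: "(norm (x - y))\<^sup>2 \<le> 2 * (F x - m) + 2 * (F y - m)" for x y
  proof -
    have "F ((1/2) *\<^sub>R (x + y)) = (norm (x + y))\<^sup>2 / 4 - Re (f x + f y)"
      by (simp add: F_def scaleR add power_mult_distrib power_divide) (simp add: field_simps)
    with m[of "(1/2) *\<^sub>R (x + y)"]
    have "m \<le> (norm (x + y))\<^sup>2 / 4 - Re (f x + f y)" by simp
    then show ?thesis unfolding norm_diff_square norm_add_square F_def by (simp add: field_simps)
  qed
  have "Cauchy X"
  proof (rule metric_CauchyI)
    fix e :: real assume "0 < e"
    obtain N where N: "inverse (real (Suc N)) < e\<^sup>2 / 4"
      using reals_Archimedean[of "e\<^sup>2 / 4"] \<open>0 < e\<close> by auto
    have less: "F (X n) - m < e\<^sup>2 / 4" if "n \<ge> N" for n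
    proof -
      have "1 / real (Suc n) \<le> inverse (real (Suc N))" using that by (simp add: field_simps)
      then show ?thesis using X[of n] N by linarith
    qed
    have "dist (X n) (X k) < e" if "n \<ge> N" "k \<ge> N" for n k
    proof -
      have "2 * (F (X n) - m) + 2 * (F (X k) - m) < e\<^sup>2"
        using less[OF that(1)] less[OF that(2)] by (simp add: field_simps)
      then have "(norm (X n - X k))\<^sup>2 < e\<^sup>2" using par[of "X n" "X k"] by (rule le_less_trans[rotated])
      then show ?thesis using \<open>0 < e\<close> power2_less_imp_less[of "norm (X n - X k)" e] by (simp add: dist_norm)
    qed
    then show "\<exists>M. \<forall>m\<ge>M. \<forall>n\<ge>M. dist (X m) (X n) < e" by blast
  qed
  then obtain z where z: "X \<longlonglongrightarrow> z" using Cauchy_convergent convergent_def by blast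
  have "bounded_linear f"
    by (rule bounded_linear_intro[of _ K])
      (use bound in \<open>simp_all add: add scaleR scaleR_conv_of_real mult.commute[of _ K]\<close>)
  then have "(\<lambda>n. f (X n)) \<longlonglongrightarrow> f z" using z by (rule bounded_linear.tendsto)
  then have "(\<lambda>n. F (X n)) \<longlonglongrightarrow> F z"
    unfolding F_def by (intro tendsto_intros z)
  moreover have "(\<lambda>n. F (X n)) \<longlonglongrightarrow> m"
  proof (rule tendsto_sandwich[of "\<lambda>_. m" _ _ "\<lambda>n. m + 1 / real (Suc n)"])
    show "(\<lambda>n. m + 1 / real (Suc n)) \<longlonglongrightarrow> m"
      using tendsto_add[OF tendsto_const[of m] LIMSEQ_inverse_real_of_nat] by (simp add: inverse_eq_divide)
  qed (use m X in \<open>auto intro!: always_eventually less_imp_le\<close>)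
  ultimately have Fz: "F z = m" by (rule LIMSEQ_unique)
  have Re: "Re (f h) = Re (cinner z h)" for h
  proof -
    define B where "B = Re (cinner z h) - Re (f h)"
    have q: "0 \<le> t\<^sup>2 * (norm h)\<^sup>2 + 2 * t * B" for t
      using m[of "z + t *\<^sub>R h"] unfolding Fz[symmetric] F_def B_def
      by (simp add: norm_add_square add scaleR cinner_simps power_mult_distrib algebra_simps)
    have "B = 0"
    proof (cases "h = 0")
      case True
      then show ?thesis using q[of 1] q[of "-1"] by simp
    next
      case False
      define t where "t = - B / (norm h)\<^sup>2"
      have "t\<^sup>2 * (norm h)\<^sup>2 + 2 * t * B = - B\<^sup>2 / (norm h)\<^sup>2"
        using False unfolding t_def by (simp add: power2_eq_square field_simps)
      with q[of t] have "B\<^sup>2 / (norm h)\<^sup>2 \<le> 0" by simp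
      then show ?thesis using False by (simp add: divide_le_0_iff)
    qed
    then show ?thesis unfolding B_def by simp
  qed
  have "f h = cinner z h" for h
  proof (rule complex_eqI[OF Re])
    show "Im (f h) = Im (cinner z h)"
      using Re[of "\<i> *\<^sub>C h"] by (simp add: scale cinner_simps)
  qed
  then show ?thesis by blast
qed

text \<open>
  Operators of the library type are only real linear. Adjoints exist for the complex linear ones.
\<close>

abbreviation clin :: "('a::complex_normed_vector \<Rightarrow>\<^sub>L 'b::complex_normed_vector) \<Rightarrow> bool" where
  "clin A \<equiv> clinear_on UNIV (blinfun_apply A)"

lemma scaleC_blinfun_apply [simp]: "blinfun_apply (c *\<^sub>C A) x = c *\<^sub>C A x"
  by (simp add: scaleC_blinfun.rep_eq)

lemma clin_scaleC: "clin A \<Longrightarrow> A (c *\<^sub>C x) = c *\<^sub>C A x"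
  by (simp add: clinear_on_def)

lemma clinI: "(\<And>c x. blinfun_apply A (c *\<^sub>C x) = c *\<^sub>C A x) \<Longrightarrow> clin A"
  by (simp add: clinear_on_def blinfun.add_right)

lemma clin_comp: "clin A \<Longrightarrow> clin B \<Longrightarrow> clin (A o\<^sub>L B)"
  by (simp add: clinear_on_def)

lemma clin_id: "clin id_blinfun"
  by (simp add: clinear_on_def)

text \<open>
  Applied to a fixed first argument, the form is a bounded functional, so this is the Riesz
  representation made uniform in the second argument.
\<close>

lemma bounded_form_operator:
  fixes B :: "'a::complex_hilbert_space \<Rightarrow> 'b::complex_hilbert_space \<Rightarrow> complex"
  assumes left: "\<And>x x' y. B (x + x') y = B x y + B x' y" "\<And>a x y. B (a *\<^sub>C x) y = cnj a * B x y"
    and right: "\<And>x y y'. B x (y + y') = B x y + B x y'" "\<And>a x y. B x (a *\<^sub>C y) = a * B x y"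
    and bound: "\<And>x y. cmod (B x y) \<le> K * norm x * norm y" and "0 \<le> K"
  shows "\<exists>S. clin S \<and> norm S \<le> K \<and> (\<forall>x y. cinner x (blinfun_apply S y) = B x y)"
proof -
  have "\<exists>z. \<forall>x. cnj (B x y) = cinner z x" for y
    by (rule Riesz_representation[where K = "K * norm y"])
      (use bound in \<open>auto simp: left ac_simps\<close>)
  then obtain s where s: "\<And>x y. cnj (B x y) = cinner (s y) x" by metis
  have s: "cinner x (s y) = B x y" for x y
    using s[of x y] cinner_commute[of x "s y"] by (metis complex_cnj_cnj)
  have add: "s (y + y') = s y + s y'" for y y'
    by (rule cinner_eqI) (simp add: s cinner_add_right right)
  have scale: "s (a *\<^sub>C y) = a *\<^sub>C s y" for a y
    by (rule cinner_eqI) (simp add: s cinner_scaleC_right right)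
  have norm: "norm (s y) \<le> K * norm y" for y
    by (rule norm_le_cinnerI) (use bound[of _ y] \<open>0 \<le> K\<close> in \<open>auto simp: s ac_simps\<close>)
  have bl: "bounded_linear s"
    by (rule bounded_linear_intro[of _ K])
      (use norm in \<open>simp_all add: add scale mult.commute[of _ K] flip: scaleC_of_real\<close>)
  have app: "blinfun_apply (Blinfun s) = s" using bl by (rule bounded_linear_Blinfun_apply)
  show ?thesis
    by (rule exI[of _ "Blinfun s"])
      (auto simp: app clinear_on_def add scale s intro!: norm_blinfun_bound norm \<open>0 \<le> K\<close>)
qed

definition adj :: "('a::complex_hilbert_space \<Rightarrow>\<^sub>L 'b::complex_hilbert_space) \<Rightarrow> 'b \<Rightarrow>\<^sub>L 'a" where
  "adj A = (SOME S. clin S \<and> norm S \<le> norm A \<and> (\<forall>x y. cinner x (S y) = cinner (A x) y))"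

lemma
  assumes "clin A"
  shows clin_adj: "clin (adj A)" and norm_adj: "norm (adj A) \<le> norm A"
    and cinner_adj: "cinner x (adj A y) = cinner (A x) y"
proof -
  have "\<exists>S. clin S \<and> norm S \<le> norm A \<and> (\<forall>x y. cinner x (blinfun_apply S y) = cinner (A x) y)"
  proof (rule bounded_form_operator)
    show "cmod (cinner (A x) y) \<le> norm A * norm x * norm y" for x y
      by (rule order_trans[OF Cauchy_Schwarz_cinner]) (intro mult_right_mono norm_blinfun norm_ge_zero)
  qed (simp_all add: blinfun.add_right cinner_simps clin_scaleC[OF assms])
  then have *: "clin (adj A) \<and> norm (adj A) \<le> norm A \<and> (\<forall>x y. cinner x (adj A y) = cinner (A x) y)"
    unfolding adj_def by (rule someI_ex)
  show "clin (adj A)" using * by (rule conjunct1)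
  show "norm (adj A) \<le> norm A" using * by simp
  show "cinner x (adj A y) = cinner (A x) y" using * by simp
qed

lemma cinner_adj': "clin A \<Longrightarrow> cinner (adj A x) y = cinner x (A y)"
  by (subst (1 2) cinner_commute) (simp add: cinner_adj)

lemma adj_eqI:
  assumes "clin A" "\<And>x y. cinner x (blinfun_apply S y) = cinner (A x) y"
  shows "adj A = S"
  by (intro blinfun_eqI cinner_eqI) (simp add: cinner_adj assms)

lemma adj_adj: "clin A \<Longrightarrow> adj (adj A) = A"
  by (rule adj_eqI) (simp_all add: clin_adj cinner_adj')

lemma norm_adj_eq: "clin A \<Longrightarrow> norm (adj A) = norm A"
  using norm_adj[of A] norm_adj[OF clin_adj, of A] by (simp add: adj_adj)

lemma adj_comp: "clin A \<Longrightarrow> clin B \<Longrightarrow> adj (A o\<^sub>L B) = adj B o\<^sub>L adj A"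
  by (rule adj_eqI) (simp_all add: clin_comp cinner_adj)

lemma clin_add: "clin A \<Longrightarrow> clin B \<Longrightarrow> clin (A + B)"
  by (simp add: clinear_on_def blinfun.bilinear_simps scaleC_add_right)

lemma clin_diff: "clin A \<Longrightarrow> clin B \<Longrightarrow> clin (A - B)"
  by (simp add: clinear_on_def blinfun.bilinear_simps scaleC_diff_right)

lemma clin_scale: "clin A \<Longrightarrow> clin (a *\<^sub>C A)"
  by (simp add: clinear_on_def scaleC_scaleC mult.commute scaleC_add_right blinfun.add_right)

lemma clin_zero: "clin 0"
  by (simp add: clinear_on_def)

lemma adj_add: "clin A \<Longrightarrow> clin B \<Longrightarrow> adj (A + B) = adj A + adj B"
  by (rule adj_eqI) (simp_all add: clin_add blinfun.add_left cinner_simps cinner_adj)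

lemma adj_diff: "clin A \<Longrightarrow> clin B \<Longrightarrow> adj (A - B) = adj A - adj B"
  by (rule adj_eqI) (simp_all add: clin_diff blinfun.diff_left cinner_simps cinner_adj)

lemma adj_scale: "clin A \<Longrightarrow> adj (a *\<^sub>C A) = cnj a *\<^sub>C adj A"
  by (rule adj_eqI) (simp_all add: clin_scale cinner_simps cinner_adj)

lemma adj_id: "adj id_blinfun = id_blinfun"
  by (rule adj_eqI[OF clin_id]) simp

lemma norm_blinfun_le_cinnerI:
  fixes A :: "'a::real_normed_vector \<Rightarrow>\<^sub>L 'b::complex_hilbert_space"
  assumes "\<And>x y. cmod (cinner x (A y)) \<le> K * norm x * norm y" "0 \<le> K"
  shows "norm A \<le> K"
  by (intro norm_blinfun_bound norm_le_cinnerI) (use assms in \<open>auto simp: ac_simps\<close>)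

section \<open>Positive operators and their resolvents\<close>

definition pos_op :: "('h::complex_hilbert_space \<Rightarrow>\<^sub>L 'h) \<Rightarrow> bool" where
  "pos_op d \<longleftrightarrow> clin d \<and> (\<forall>x y. cinner (d x) y = cinner x (d y)) \<and> (\<forall>x. 0 \<le> Re (cinner x (d x)))"

text \<open>Positivity of \<open>d\<close> at the vector \<open>r x - d x\<close>.\<close>

lemma pos_op_square_le:
  assumes d: "pos_op d" and le: "\<And>x. Re (cinner x (d x)) \<le> r * (norm x)\<^sup>2" and "0 < r"
  shows "(norm (d x))\<^sup>2 \<le> r * Re (cinner x (d x))"
proof -
  define y where "y = d x"
  have sa: "cinner (d x) y = cinner x (d y)" for x y using d by (simp add: pos_op_def)
  have "Re (cinner x (d y)) = (norm y)\<^sup>2" using sa[of x y] Re_cinner_self[of y] unfolding y_def[symmetric] by simp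
  then have "0 \<le> Re (cinner (r *\<^sub>R x - y) (d (r *\<^sub>R x - y)))" using d by (simp add: pos_op_def)
  also have "\<dots> = r\<^sup>2 * Re (cinner x y) - 2 * r * (norm y)\<^sup>2 + Re (cinner y (d y))"
    using \<open>Re (cinner x (d y)) = _\<close>
    by (simp add: blinfun.bilinear_simps cinner_simps y_def[symmetric] power2_eq_square algebra_simps)
  also have "\<dots> \<le> r\<^sup>2 * Re (cinner x y) - 2 * r * (norm y)\<^sup>2 + r * (norm y)\<^sup>2"
    using le[of y] by simp
  finally have "r * (norm y)\<^sup>2 \<le> r * (r * Re (cinner x y))"
    by (simp add: power2_eq_square algebra_simps)
  then show ?thesis using \<open>0 < r\<close> by (simp add: y_def)
qed

lemma pos_op_contraction_split:
  assumes "pos_op E" "\<And>x. (norm (E x))\<^sup>2 \<le> Re (cinner x (E x))"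
  shows "(norm (E x))\<^sup>2 + (norm (x - E x))\<^sup>2 \<le> (norm x)\<^sup>2"
  using assms(2)[of x] by (simp add: norm_diff_square)

lemma
  assumes d: "pos_op d" and G: "clin G" and eq: "\<And>x. G x + d (G x) = x"
  shows pos_op_resolvent: "pos_op G"
    and resolvent_square_le: "(norm (G x))\<^sup>2 \<le> Re (cinner x (G x))"
    and resolvent_form_le: "Re (cinner (G x) (d (G x))) \<le> Re (cinner x (G x))"
proof -
  have sa: "cinner (d x) y = cinner x (d y)" for x y using d by (simp add: pos_op_def)
  have Re: "Re (cinner x (G x)) = (norm (G x))\<^sup>2 + Re (cinner (G x) (d (G x)))" for x
  proof -
    have "cinner x (G x) = cinner (G x + d (G x)) (G x)" by (simp add: eq)
    then show ?thesis by (simp add: cinner_simps sa)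
  qed
  have pos: "0 \<le> Re (cinner x (d x))" for x using d by (simp add: pos_op_def)
  show 1: "(norm (G x))\<^sup>2 \<le> Re (cinner x (G x))" for x using Re[of x] pos[of "G x"] by linarith
  show "Re (cinner (G x) (d (G x))) \<le> Re (cinner x (G x))" using Re[of x] by simp
  have "cinner (G x) y = cinner x (G y)" for x y
  proof -
    have "cinner (G x) y = cinner (G x) (G y + d (G y))" by (simp add: eq)
    also have "\<dots> = cinner (G x + d (G x)) (G y)" by (simp add: cinner_simps sa)
    finally show ?thesis by (simp add: eq)
  qed
  moreover have "0 \<le> Re (cinner x (G x))" for x
    using 1[of x] zero_le_power2[of "norm (G x)"] by linarith
  ultimately show "pos_op G" unfolding pos_op_def using G by blast
qed

text \<open>
  For \<open>G = (1 + d)\<^sup>-\<^sup>1\<close> the number \<open>\<langle>x, G x\<rangle>\<close> is the maximum of \<open>2 Re \<langle>x, y\<rangle> - \<langle>y, (1 + d) y\<rangle>\<close> over all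
  \<open>y\<close>, and this maximum decreases when \<open>d\<close> grows.
\<close>

lemma resolvent_antimono:
  assumes d: "pos_op d" and d': "pos_op d'"
    and le: "\<And>x. Re (cinner x (d x)) \<le> Re (cinner x (d' x))"
    and G: "clin G" "\<And>x. G x + d (G x) = x" and G': "clin G'" "\<And>x. G' x + d' (G' x) = x"
  shows "Re (cinner x (G' x)) \<le> Re (cinner x (G x))"
proof -
  have sa: "cinner (d x) y = cinner x (d y)" for x y using d by (simp add: pos_op_def)
  define y where "y = G' x"
  define w where "w = G x"
  have w: "w + d w = x" unfolding w_def by (rule G)
  have y: "y + d' y = x" unfolding y_def by (rule G')
  have "0 \<le> (norm (w - y))\<^sup>2 + Re (cinner (w - y) (d (w - y)))" using d by (simp add: pos_op_def)
  also have "\<dots> = Re (cinner (w - y) ((w + d w) - (y + d y)))"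
  proof -
    have "(w + d w) - (y + d y) = (w - y) + d (w - y)" by (simp add: blinfun.bilinear_simps)
    then show ?thesis by (simp only: cinner_add_right plus_complex.sel Re_cinner_self)
  qed
  also have "\<dots> = Re (cinner w x) - Re (cinner y x) - Re (cinner (w + d w) y) + Re (cinner y (y + d y))"
  proof -
    have "cinner w (y + d y) = cinner (w + d w) y" by (simp only: cinner_add_right cinner_add_left sa)
    then show ?thesis unfolding w by (simp add: cinner_diff_left cinner_diff_right)
  qed
  also have "\<dots> = Re (cinner x w) - 2 * Re (cinner x y) + Re (cinner y (y + d y))"
    using Re_cinner_commute[of w x] Re_cinner_commute[of y x] unfolding w by simp
  also have "Re (cinner y (y + d y)) \<le> Re (cinner y (y + d' y))"
    using le[of y] by (simp add: cinner_simps)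
  also have "\<dots> = Re (cinner x y)" using Re_cinner_commute[of x y] by (simp add: y)
  finally show ?thesis by (simp add: y_def w_def)
qed

lemma
  assumes "csubspace V"
  shows csubspace_0: "0 \<in> V" and csubspace_add: "x \<in> V \<Longrightarrow> y \<in> V \<Longrightarrow> x + y \<in> V"
    and csubspace_scaleC: "x \<in> V \<Longrightarrow> c *\<^sub>C x \<in> V"
  using assms by (auto simp: csubspace_def)

lemma csubspace_scaleR: "csubspace V \<Longrightarrow> x \<in> V \<Longrightarrow> r *\<^sub>R x \<in> V"
  using csubspace_scaleC[of V x "of_real r"] by (simp add: scaleC_of_real)

lemma csubspace_minus: "csubspace V \<Longrightarrow> x \<in> V \<Longrightarrow> - x \<in> V"
  using csubspace_scaleR[of V x "-1"] by simp

lemma csubspace_diff: "csubspace V \<Longrightarrow> x \<in> V \<Longrightarrow> y \<in> V \<Longrightarrow> x - y \<in> V"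
  using csubspace_add[of V x "-y"] csubspace_minus[of V y] by simp

lemma csubspace_sum: "csubspace V \<Longrightarrow> (\<And>i. i \<in> I \<Longrightarrow> f i \<in> V) \<Longrightarrow> (\<Sum>i\<in>I. f i) \<in> V"
  by (induction I rule: infinite_finite_induct) (auto simp: csubspace_0 csubspace_add)

section \<open>Separable C*-algebras of operators\<close>

locale cstar_algebra =
  fixes Y :: "('h::complex_hilbert_space \<Rightarrow>\<^sub>L 'h) set"
  assumes operator_space: "operator_space Y"
    and id_mem: "id_blinfun \<in> Y"
    and comp_mem: "A \<in> Y \<Longrightarrow> B \<in> Y \<Longrightarrow> A o\<^sub>L B \<in> Y"
    and adj_mem: "A \<in> Y \<Longrightarrow> adj A \<in> Y"
begin

lemma clin_mem: "A \<in> Y \<Longrightarrow> clin A"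
  and csubspace: "csubspace Y" and closed: "closed Y"
  using operator_space by (auto simp: operator_space_def)

lemmas zero_mem = csubspace_0[OF csubspace]
  and add_mem = csubspace_add[OF csubspace]
  and diff_mem = csubspace_diff[OF csubspace]
  and scaleC_mem = csubspace_scaleC[OF csubspace]
  and scaleR_mem = csubspace_scaleR[OF csubspace]
  and sum_mem = csubspace_sum[OF csubspace]

text \<open>
  With \<open>r \<ge> \<parallel>d\<parallel>\<close> the equation \<open>(1 + d) G = 1\<close> says that \<open>G\<close> is a fixed point of
  \<open>G \<mapsto> (1 + (r - d) G) / (1 + r)\<close>, a contraction because \<open>\<parallel>r - d\<parallel> \<le> r\<close>. Solving it in \<open>Y\<close> shows
  at once that the resolvent exists and that it belongs to \<open>Y\<close>.
\<close>

lemma resolvent_exists: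
  assumes d: "pos_op d" "d \<in> Y"
  shows "\<exists>G\<in>Y. \<forall>x. blinfun_apply G x + d (blinfun_apply G x) = x"
proof -
  define r where "r = norm d + 1"
  have r: "0 < r" unfolding r_def by (rule add_nonneg_pos) auto
  define F where "F G = (1 / (1 + r)) *\<^sub>R (id_blinfun + r *\<^sub>R G - (d o\<^sub>L G))" for G
  have form: "Re (cinner x (d x)) \<le> r * (norm x)\<^sup>2" for x
  proof -
    have "Re (cinner x (d x)) \<le> norm x * norm (d x)"
      using Cauchy_Schwarz_cinner[of x "d x"] complex_Re_le_cmod[of "cinner x (d x)"] by linarith
    also have "\<dots> \<le> norm x * (r * norm x)"
      using norm_blinfun[of d x] by (intro mult_left_mono) (auto simp: r_def algebra_simps intro: add_increasing)
    finally show ?thesis by (simp add: power2_eq_square ac_simps)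
  qed
  have contr: "norm (r *\<^sub>R y - d y) \<le> r * norm y" for y
  proof (rule power2_le_imp_le)
    have "(norm (r *\<^sub>R y - d y))\<^sup>2 = r\<^sup>2 * (norm y)\<^sup>2 - 2 * r * Re (cinner y (d y)) + (norm (d y))\<^sup>2"
      by (simp add: norm_diff_square cinner_simps power_mult_distrib)
    also have "\<dots> \<le> r\<^sup>2 * (norm y)\<^sup>2"
    proof -
      have "0 \<le> r * Re (cinner y (d y))" using d r by (simp add: pos_op_def)
      then show ?thesis using pos_op_square_le[OF d(1) form r, of y] by linarith
    qed
    finally show "(norm (r *\<^sub>R y - d y))\<^sup>2 \<le> (r * norm y)\<^sup>2" by (simp add: power_mult_distrib)
  qed (use r in simp)
  have "\<exists>!G\<in>Y. F G = G"
  proof (rule Banach_fix)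
    show "complete Y" using closed by (simp add: complete_eq_closed)
    show "Y \<noteq> {}" using id_mem by blast
    show "0 \<le> r / (1 + r)" "r / (1 + r) < 1" using r by auto
    show "F ` Y \<subseteq> Y"
      using d unfolding F_def by (auto intro!: scaleR_mem diff_mem add_mem id_mem comp_mem)
    show "dist (F G) (F H) \<le> r / (1 + r) * dist G H" if "G \<in> Y" "H \<in> Y" for G H
    proof -
      have "norm (F G - F H) \<le> r / (1 + r) * norm (G - H)"
      proof (rule norm_blinfun_bound)
        show "0 \<le> r / (1 + r) * norm (G - H)" using r by simp
        fix x
        have "(F G - F H) x = (1 / (1 + r)) *\<^sub>R (r *\<^sub>R ((G - H) x) - d ((G - H) x))"
          unfolding F_def by (simp add: blinfun.bilinear_simps algebra_simps)
        then have "norm ((F G - F H) x) \<le> (1 / (1 + r)) * (r * norm ((G - H) x))"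
          using r contr[of "(G - H) x"] by (simp add: divide_right_mono)
        also have "\<dots> \<le> (1 / (1 + r)) * (r * (norm (G - H) * norm x))"
          using r by (intro mult_left_mono norm_blinfun) auto
        finally show "norm ((F G - F H) x) \<le> r / (1 + r) * norm (G - H) * norm x" by simp
      qed
      then show ?thesis by (simp add: dist_norm)
    qed
  qed
  then obtain G where G: "G \<in> Y" "F G = G" by blast
  have "G x + d (G x) = x" for x
  proof -
    have "(1 + r) *\<^sub>R G x = (1 + r) *\<^sub>R (F G) x" by (simp add: G)
    also have "\<dots> = x + r *\<^sub>R G x - d (G x)"
      using r unfolding F_def by (simp add: blinfun.bilinear_simps)
    finally show ?thesis by (simp add: scaleR_add_left algebra_simps)
  qed
  with G show ?thesis by blast
qed

text \<open>
  \<open>G c F = (1 + c \<Sum>\<^sub>k\<^sub>\<in>\<^sub>F z\<^sub>k z\<^sub>k\<^sup>*)\<^sup>-\<^sup>1\<close>: for large \<open>c\<close> a substitute for the projection onto the common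
  kernel of the \<open>z\<^sub>k\<^sup>*\<close>, available inside the algebra.
\<close>

lemma resolvent_family:
  fixes z :: "nat \<Rightarrow> 'h \<Rightarrow>\<^sub>L 'h"
  assumes z: "\<And>k. z k \<in> Y"
  shows "\<exists>G :: real \<Rightarrow> nat set \<Rightarrow> 'h \<Rightarrow>\<^sub>L 'h. \<forall>c F. 0 < c \<longrightarrow> finite F \<longrightarrow>
     G c F \<in> Y \<and> pos_op (G c F) \<and> (\<forall>x. (norm (G c F x))\<^sup>2 \<le> Re (cinner x (G c F x))) \<and>
     (\<forall>k\<in>F. norm (G c F o\<^sub>L z k) \<le> 1 / sqrt c) \<and>
     id_blinfun - G c F = (\<Sum>k\<in>F. c *\<^sub>R (z k o\<^sub>L (adj (z k) o\<^sub>L G c F))) \<and>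
     (\<forall>F' x. finite F' \<longrightarrow> F \<subseteq> F' \<longrightarrow> Re (cinner x (G c F' x)) \<le> Re (cinner x (G c F x)))"
proof -
  define d where "d c F = (\<Sum>k\<in>F. c *\<^sub>R (z k o\<^sub>L adj (z k)))" for c :: real and F
  have dY: "d c F \<in> Y" for c F
    unfolding d_def by (intro sum_mem scaleR_mem comp_mem adj_mem z)
  have dapp: "d c F x = (\<Sum>k\<in>F. c *\<^sub>R (z k (adj (z k) x)))" for c F x
    unfolding d_def by (induction F rule: infinite_finite_induct) (auto simp: blinfun.bilinear_simps)
  have form: "Re (cinner x (d c F x)) = (\<Sum>k\<in>F. c * (norm (adj (z k) x))\<^sup>2)" for c F x
    unfolding dapp cinner_sum_right Re_sum
    by (intro sum.cong) (simp_all add: cinner_simps cinner_adj'[symmetric] clin_mem z)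
  have pos: "pos_op (d c F)" if "0 < c" for c F
    unfolding pos_op_def form
  proof (intro conjI allI sum_nonneg)
    show "clin (d c F)" by (rule clin_mem[OF dY])
    show "cinner (d c F x) y = cinner x (d c F y)" for x y
      unfolding dapp cinner_sum_left cinner_sum_right
      by (intro sum.cong) (simp_all add: cinner_simps cinner_adj'[symmetric] cinner_adj[symmetric] clin_mem z clin_adj)
  qed (use that in simp)
  have "\<exists>G. G \<in> Y \<and> (\<forall>x. blinfun_apply G x + d c F (blinfun_apply G x) = x)" if "0 < c" for c F
    using resolvent_exists[OF pos dY] that by blast
  then obtain G where GY: "\<And>c F. 0 < c \<Longrightarrow> G c F \<in> Y"
    and Geq: "\<And>c F x. 0 < c \<Longrightarrow> G c F x + d c F (G c F x) = x" by metis
  show ?thesis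
  proof (intro exI[of _ G] allI impI conjI ballI)
    fix c :: real and F :: "nat set" assume c: "0 < c" and F: "finite F"
    note G = clin_mem[OF GY[OF c]] Geq[OF c]
    show "G c F \<in> Y" by (rule GY[OF c])
    show posG: "pos_op (G c F)" by (rule pos_op_resolvent[OF pos[OF c] G])
    show sq: "(norm (G c F x))\<^sup>2 \<le> Re (cinner x (G c F x))" for x
      by (rule resolvent_square_le[OF pos[OF c] G])
    show "norm (G c F o\<^sub>L z k) \<le> 1 / sqrt c" if "k \<in> F" for k
    proof -
      have con: "norm (G c F x) \<le> norm x" for x
      proof (rule power2_le_imp_le)
        show "(norm (G c F x))\<^sup>2 \<le> (norm x)\<^sup>2"
          using pos_op_contraction_split[OF posG sq, of x] zero_le_power2[of "norm (x - G c F x)"]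
          by linarith
      qed simp
      have *: "norm (adj (z k) (G c F x)) \<le> 1 / sqrt c * norm x" for x
      proof (rule power2_le_imp_le)
        have "c * (norm (adj (z k) (G c F x)))\<^sup>2 \<le> Re (cinner (G c F x) (d c F (G c F x)))"
          unfolding form using c F that by (intro member_le_sum[of k F]) auto
        also have "\<dots> \<le> Re (cinner x (G c F x))" by (rule resolvent_form_le[OF pos[OF c] G])
        also have "\<dots> \<le> norm x * norm (G c F x)"
          using Cauchy_Schwarz_cinner[of x "G c F x"] complex_Re_le_cmod[of "cinner x (G c F x)"] by linarith
        also have "\<dots> \<le> (norm x)\<^sup>2" using con[of x] by (simp add: power2_eq_square mult_left_mono)
        finally show "(norm (adj (z k) (G c F x)))\<^sup>2 \<le> (1 / sqrt c * norm x)\<^sup>2"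
          using c by (simp add: power_mult_distrib power_divide field_simps)
      qed (use c in simp)
      show ?thesis
      proof (rule norm_blinfun_le_cinnerI)
        fix x y
        have "cinner x ((G c F o\<^sub>L z k) y) = cinner (adj (z k) (G c F x)) y"
          using posG by (simp add: cinner_adj' clin_mem z pos_op_def)
        then show "cmod (cinner x ((G c F o\<^sub>L z k) y)) \<le> 1 / sqrt c * norm x * norm y"
          using mult_right_mono[OF *[of x], of "norm y"] Cauchy_Schwarz_cinner[of "adj (z k) (G c F x)" y]
          by simp
      qed (use c in simp)
    qed
    have "d c F o\<^sub>L G c F = id_blinfun - G c F"
      using G(2)[of F] by (intro blinfun_eqI) (simp add: blinfun.bilinear_simps eq_diff_eq add.commute)
    moreover have "d c F o\<^sub>L G c F = (\<Sum>k\<in>F. c *\<^sub>R (z k o\<^sub>L (adj (z k) o\<^sub>L G c F)))"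
      by (rule blinfun_eqI) (simp add: dapp blinfun.sum_left blinfun.bilinear_simps)
    ultimately show "id_blinfun - G c F = (\<Sum>k\<in>F. c *\<^sub>R (z k o\<^sub>L (adj (z k) o\<^sub>L G c F)))" by simp
    show "Re (cinner x (G c F' x)) \<le> Re (cinner x (G c F x))" if "finite F'" "F \<subseteq> F'" for F' x
    proof (rule resolvent_antimono[OF pos[OF c] pos[OF c] _ G clin_mem[OF GY[OF c]] Geq[OF c]])
      show "Re (cinner x (d c F x)) \<le> Re (cinner x (d c F' x))" for x
        unfolding form using that c by (intro sum_mono2) auto
    qed
  qed
qed

end

text \<open>Words in countably many operators, so that the algebra which they generate is separable.\<close>

datatype opword = Gen nat | One | Scal rat rat opword | Plus opword opword | Times opword opword
  | Adj opword

instance opword :: countable by countable_datatype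

primrec opval :: "(nat \<Rightarrow> 'h::complex_hilbert_space \<Rightarrow>\<^sub>L 'h) \<Rightarrow> opword \<Rightarrow> 'h \<Rightarrow>\<^sub>L 'h" where
  "opval s (Gen n) = s n"
| "opval s One = id_blinfun"
| "opval s (Scal a b w) = Complex (of_rat a) (of_rat b) *\<^sub>C opval s w"
| "opval s (Plus v w) = opval s v + opval s w"
| "opval s (Times v w) = opval s v o\<^sub>L opval s w"
| "opval s (Adj w) = adj (opval s w)"

definition generated_cstar :: "(nat \<Rightarrow> 'h::complex_hilbert_space \<Rightarrow>\<^sub>L 'h) \<Rightarrow> ('h \<Rightarrow>\<^sub>L 'h) set" where
  "generated_cstar s = closure (range (opval s))"

lemma clin_ident: "clinear_on UNIV (\<lambda>x. x)"
  by (simp add: clinear_on_def)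

lemma clin_opval: "(\<And>n. clin (s n)) \<Longrightarrow> clin (opval s w)"
  by (induction w) (auto simp: clin_ident intro: clin_scale clin_add clin_comp clin_adj)

lemma clin_limit:
  assumes "\<And>n. clin (X n)" "X \<longlonglongrightarrow> A"
  shows "clin A"
proof (rule clinI)
  fix c x
  have "(\<lambda>n. X n (c *\<^sub>C x)) \<longlonglongrightarrow> A (c *\<^sub>C x)"
    by (intro blinfun.tendsto assms tendsto_const)
  moreover have "(\<lambda>n. c *\<^sub>C X n x) \<longlonglongrightarrow> c *\<^sub>C A x"
    by (intro bounded_linear.tendsto[OF bounded_linear_scaleC] blinfun.tendsto assms tendsto_const)
  ultimately show "A (c *\<^sub>C x) = c *\<^sub>C A x"
    using LIMSEQ_unique by (simp add: clin_scaleC[OF assms(1)])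
qed

text \<open>
  Words have rational scalars, so that there are countably many of them; this makes the closure of their values
  invariant under all complex scalars.
\<close>

lemma rational_complex_approx:
  "\<exists>a b. (\<lambda>n. Complex (of_rat (a n)) (of_rat (b n))) \<longlonglongrightarrow> c"
proof -
  have "\<exists>q :: nat \<Rightarrow> rat. (\<lambda>n. of_rat (q n)) \<longlonglongrightarrow> x" for x :: real
  proof -
    have "\<exists>q. x < of_rat q \<and> of_rat q < x + 1 / real (Suc n)" for n by (rule of_rat_dense) simp
    then obtain q where q: "\<And>n. x < of_rat (q n)" "\<And>n. of_rat (q n) < x + 1 / real (Suc n)" by metis
    have "(\<lambda>n. of_rat (q n)) \<longlonglongrightarrow> x"
    proof (rule tendsto_sandwich[of "\<lambda>_. x" _ _ "\<lambda>n. x + 1 / real (Suc n)"])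
      show "(\<lambda>n. x + 1 / real (Suc n)) \<longlonglongrightarrow> x"
        using tendsto_add[OF tendsto_const[of x] LIMSEQ_inverse_real_of_nat] by (simp add: inverse_eq_divide)
    qed (use q in \<open>auto intro!: always_eventually less_imp_le\<close>)
    then show ?thesis by blast
  qed
  then obtain a b where "(\<lambda>n. of_rat (a n)) \<longlonglongrightarrow> Re c" "(\<lambda>n. of_rat (b n)) \<longlonglongrightarrow> Im c" by metis
  from tendsto_Complex[OF this] show ?thesis by auto
qed

lemma
  assumes s: "\<And>n. clin (s n)"
  shows cstar_algebra_generated: "cstar_algebra (generated_cstar s)"
    and generated_cstar_mem: "s n \<in> generated_cstar s"
    and generated_cstar_separable: "\<exists>D. countable D \<and> generated_cstar s \<subseteq> closure D"
proof -
  let ?Y = "generated_cstar s"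
  have in_range: "opval s w \<in> ?Y" for w
    unfolding generated_cstar_def by (rule subsetD[OF closure_subset]) simp
  have lim: "\<exists>w. (\<lambda>n. opval s (w n)) \<longlonglongrightarrow> A" if "A \<in> ?Y" for A
  proof -
    from that obtain X where X: "\<And>n. X n \<in> range (opval s)" "X \<longlonglongrightarrow> A"
      unfolding generated_cstar_def closure_sequential by blast
    then have "\<forall>n. \<exists>w. X n = opval s w" by blast
    then obtain w where "\<And>n. X n = opval s (w n)" by metis
    then have "X = (\<lambda>n. opval s (w n))" by blast
    then show ?thesis using X(2) by blast
  qed
  have closed: "A \<in> ?Y" if "X \<longlonglongrightarrow> A" "\<And>n. X n \<in> ?Y" for X A
    using closed_sequentially[of ?Y X A] that by (simp add: generated_cstar_def)
  have clin: "clin A" if A: "A \<in> ?Y" for A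
  proof -
    obtain w where "(\<lambda>n. opval s (w n)) \<longlonglongrightarrow> A" using lim[OF A] by blast
    then show ?thesis by (rule clin_limit[rotated]) (rule clin_opval[OF s])
  qed
  show "cstar_algebra ?Y"
  proof
    show "operator_space ?Y"
      unfolding operator_space_def csubspace_def
    proof (intro conjI ballI allI)
      show "0 \<in> ?Y"
        using in_range[of "Scal 0 0 One"] by (simp add: Complex_eq)
      show "A + B \<in> ?Y" if AB: "A \<in> ?Y" "B \<in> ?Y" for A B
      proof -
        obtain v w where "(\<lambda>n. opval s (v n)) \<longlonglongrightarrow> A" "(\<lambda>n. opval s (w n)) \<longlonglongrightarrow> B"
          using lim[OF AB(1)] lim[OF AB(2)] by blast
        from tendsto_add[OF this] show ?thesis
          by (rule closed) (use in_range[of "Plus (v _) (w _)"] in simp)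
      qed
      show "c *\<^sub>C A \<in> ?Y" if A: "A \<in> ?Y" for c A
      proof -
        obtain w where w: "(\<lambda>n. opval s (w n)) \<longlonglongrightarrow> A" using lim[OF A] by blast
        obtain a b where ab: "(\<lambda>n. Complex (of_rat (a n)) (of_rat (b n))) \<longlonglongrightarrow> c"
          using rational_complex_approx by blast
        have "(\<lambda>n. Complex (of_rat (a n)) (of_rat (b n)) *\<^sub>C opval s (w n)) \<longlonglongrightarrow> c *\<^sub>C A"
        proof (rule LIM_zero_cancel)
          let ?q = "\<lambda>n. Complex (of_rat (a n)) (of_rat (b n))"
          have "(\<lambda>n. cmod (?q n) * norm (opval s (w n) - A) + cmod (?q n - c) * norm A) \<longlonglongrightarrow>
            cmod c * norm (A - A) + cmod (c - c) * norm A"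
            by (intro tendsto_intros ab w)
          then have z: "(\<lambda>n. cmod (?q n) * norm (opval s (w n) - A) + cmod (?q n - c) * norm A) \<longlonglongrightarrow> 0"
            by simp
          show "(\<lambda>n. ?q n *\<^sub>C opval s (w n) - c *\<^sub>C A) \<longlonglongrightarrow> 0"
          proof (rule Lim_null_comparison[OF always_eventually z], intro allI)
            fix n
            have "?q n *\<^sub>C opval s (w n) - c *\<^sub>C A = ?q n *\<^sub>C (opval s (w n) - A) + (?q n - c) *\<^sub>C A"
              by (simp add: scaleC_diff_right scaleC_diff_left)
            then show "norm (?q n *\<^sub>C opval s (w n) - c *\<^sub>C A)
                \<le> cmod (?q n) * norm (opval s (w n) - A) + cmod (?q n - c) * norm A"
              by (metis norm_triangle_ineq norm_scaleC)
          qed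
        qed
        then show ?thesis by (rule closed) (use in_range[of "Scal (a _) (b _) (w _)"] in simp)
      qed
      show "clin A" if "A \<in> ?Y" for A using that by (rule clin)
      show "closed ?Y" by (simp add: generated_cstar_def)
    qed
    show "id_blinfun \<in> ?Y" using in_range[of One] by simp
    show "A o\<^sub>L B \<in> ?Y" if AB: "A \<in> ?Y" "B \<in> ?Y" for A B
    proof -
      obtain v w where "(\<lambda>n. opval s (v n)) \<longlonglongrightarrow> A" "(\<lambda>n. opval s (w n)) \<longlonglongrightarrow> B"
        using lim[OF AB(1)] lim[OF AB(2)] by blast
      from bounded_bilinear.tendsto[OF bounded_bilinear_blinfun_compose this] show ?thesis
        by (rule closed) (use in_range[of "Times (v _) (w _)"] in simp)
    qed
    show "adj A \<in> ?Y" if A: "A \<in> ?Y" for A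
    proof -
      obtain w where w: "(\<lambda>n. opval s (w n)) \<longlonglongrightarrow> A" using lim[OF A] by blast
      have "(\<lambda>n. adj (opval s (w n))) \<longlonglongrightarrow> adj A"
      proof (rule LIM_zero_cancel, rule Lim_null_comparison)
        show "\<forall>\<^sub>F n in sequentially. norm (adj (opval s (w n)) - adj A) \<le> norm (opval s (w n) - A)"
          by (intro always_eventually allI)
            (metis adj_diff clin_diff clin_opval s clin A norm_adj)
        show "(\<lambda>n. norm (opval s (w n) - A)) \<longlonglongrightarrow> 0"
          using w by (simp add: LIM_zero tendsto_norm_zero)
      qed
      then show ?thesis by (rule closed) (use in_range[of "Adj (w _)"] in simp)
    qed
  qed
  show "s n \<in> ?Y" using in_range[of "Gen n"] by simp
  show "\<exists>D. countable D \<and> ?Y \<subseteq> closure D"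
    by (rule exI[of _ "range (opval s)"]) (simp add: generated_cstar_def)
qed

text \<open>
  A countable set whose closure contains \<open>S\<close> may lie outside \<open>S\<close>; nearby points of \<open>S\<close> replace its elements.
  In particular, separability passes to subsets.
\<close>

lemma separable_space_iff:
  fixes S :: "'a::metric_space set"
  shows "separable_space (top_of_set S) \<longleftrightarrow> (\<exists>D. countable D \<and> S \<subseteq> closure D)"
proof
  assume "separable_space (top_of_set S)"
  then obtain C where C: "countable C" "C \<subseteq> S" "(top_of_set S) closure_of C = S"
    by (auto simp: separable_space_def)
  have "S \<subseteq> closure C"
    using C closure_of_subtopology_subset[of euclidean S C] by auto
  with C show "\<exists>D. countable D \<and> S \<subseteq> closure D" by blast
next
  assume "\<exists>D. countable D \<and> S \<subseteq> closure D"
  then obtain D where D: "countable D" "S \<subseteq> closure D" by blast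
  define p where "p d n = (SOME x. x \<in> S \<and> dist x d < inverse (real (Suc n)))" for d n
  define C where "C = {p d n | d n. d \<in> D} \<inter> S"
  have "countable C"
  proof -
    have "{p d n | d n. d \<in> D} = (\<lambda>(d, n). p d n) ` (D \<times> UNIV)" by auto
    then show ?thesis unfolding C_def using D(1) by simp
  qed
  moreover have "S \<subseteq> closure C"
  proof
    fix x assume x: "x \<in> S"
    show "x \<in> closure C"
      unfolding closure_approachable
    proof (intro allI impI)
      fix e :: real assume "0 < e"
      then obtain n where n: "inverse (real (Suc n)) < e / 2"
        using reals_Archimedean[of "e / 2"] by auto
      obtain d where d: "d \<in> D" "dist d x < inverse (real (Suc n))"
        using D(2) x closure_approachable[of x D] by (metis inverse_positive_iff_positive of_nat_0_less_iff subsetD zero_less_Suc)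
      have "p d n \<in> S \<and> dist (p d n) d < inverse (real (Suc n))"
        unfolding p_def by (rule someI[of _ x]) (use x d in \<open>auto simp: dist_commute\<close>)
      then have "p d n \<in> C" "dist (p d n) x < e"
        using d n dist_triangle[of "p d n" x d] unfolding C_def by auto
      then show "\<exists>y\<in>C. dist y x < e" by blast
    qed
  qed
  moreover have "C \<subseteq> S" unfolding C_def by blast
  ultimately show "separable_space (top_of_set S)"
    unfolding separable_space_def
    by (intro exI[of _ C]) (auto simp: closure_of_subtopology inf.absorb2)
qed

section \<open>Matrix norms and completely bounded maps\<close>

lemma matrix_norm_cong:
  assumes "\<And>i j. i < n \<Longrightarrow> j < n \<Longrightarrow> A i j = B i j"
  shows "matrix_norm n A = matrix_norm n B"
  unfolding matrix_norm_def using assms by (intro arg_cong[where f = Sup] image_cong L2_set_cong) auto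

lemma matrix_apply_le_sum:
  fixes A :: "nat \<Rightarrow> nat \<Rightarrow> 'a::real_normed_vector \<Rightarrow>\<^sub>L 'b::real_normed_vector"
  shows "L2_set (\<lambda>i. norm (\<Sum>j<n. blinfun_apply (A i j) (v j))) {..<n}
     \<le> (\<Sum>i<n. \<Sum>j<n. norm (A i j)) * L2_set (\<lambda>j. norm (v j)) {..<n}"
proof -
  have "L2_set (\<lambda>i. norm (\<Sum>j<n. blinfun_apply (A i j) (v j))) {..<n}
      \<le> (\<Sum>i<n. norm (\<Sum>j<n. blinfun_apply (A i j) (v j)))"
    by (rule L2_set_le_sum) simp
  also have "\<dots> \<le> (\<Sum>i<n. \<Sum>j<n. norm (A i j) * L2_set (\<lambda>j. norm (v j)) {..<n})"
  proof (intro sum_mono sum_norm_le)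
    fix i j assume "j \<in> {..<n}"
    then have "norm (v j) \<le> L2_set (\<lambda>j. norm (v j)) {..<n}" using member_le_L2_set[of "{..<n}" j "\<lambda>j. norm (v j)"] by simp
    then show "norm (blinfun_apply (A i j) (v j)) \<le> norm (A i j) * L2_set (\<lambda>j. norm (v j)) {..<n}"
      by (rule order_trans[OF norm_blinfun mult_left_mono]) simp
  qed
  finally show ?thesis by (simp add: sum_distrib_right)
qed

lemma matrix_norm_upper:
  assumes "L2_set (\<lambda>j. norm (v j)) {..<n} \<le> 1"
  shows "L2_set (\<lambda>i. norm (\<Sum>j<n. blinfun_apply (A i j) (v j))) {..<n} \<le> matrix_norm n A"
  unfolding matrix_norm_def
proof (rule cSUP_upper)
  show "v \<in> {v. L2_set (\<lambda>j. norm (v j)) {..<n} \<le> 1}" using assms by simp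
  show "bdd_above ((\<lambda>v. L2_set (\<lambda>i. norm (\<Sum>j<n. blinfun_apply (A i j) (v j))) {..<n}) `
      {v. L2_set (\<lambda>j. norm (v j)) {..<n} \<le> 1})"
  proof (rule bdd_aboveI2)
    fix v :: "nat \<Rightarrow> 'a" assume "v \<in> {v. L2_set (\<lambda>j. norm (v j)) {..<n} \<le> 1}"
    then have "(\<Sum>i<n. \<Sum>j<n. norm (A i j)) * L2_set (\<lambda>j. norm (v j)) {..<n} \<le> (\<Sum>i<n. \<Sum>j<n. norm (A i j)) * 1"
      by (intro mult_left_mono sum_nonneg) auto
    then show "L2_set (\<lambda>i. norm (\<Sum>j<n. blinfun_apply (A i j) (v j))) {..<n} \<le> (\<Sum>i<n. \<Sum>j<n. norm (A i j))"
      using matrix_apply_le_sum[where n = n and A = A and v = v] by linarith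
  qed
qed

lemma matrix_norm_nonneg: "0 \<le> matrix_norm n A"
  using matrix_norm_upper[of "\<lambda>_. 0" n A] by (simp add: L2_set_def)

lemma matrix_norm_apply:
  "L2_set (\<lambda>i. norm (\<Sum>j<n. blinfun_apply (A i j) (v j))) {..<n}
     \<le> matrix_norm n A * L2_set (\<lambda>j. norm (v j)) {..<n}"
proof (cases "L2_set (\<lambda>j. norm (v j)) {..<n} = 0")
  case True
  then show ?thesis using matrix_apply_le_sum[where n = n and A = A and v = v] by simp
next
  case False
  define t where "t = L2_set (\<lambda>j. norm (v j)) {..<n}"
  have t: "0 < t" using False L2_set_nonneg[of "\<lambda>j. norm (v j)" "{..<n}"] unfolding t_def by linarith
  have "L2_set (\<lambda>j. norm ((1 / t) *\<^sub>R v j)) {..<n} = t * (1 / t)"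
    unfolding t_def using t[unfolded t_def] by (subst L2_set_left_distrib) (auto simp: field_simps)
  then have "L2_set (\<lambda>i. norm (\<Sum>j<n. blinfun_apply (A i j) ((1 / t) *\<^sub>R v j))) {..<n} \<le> matrix_norm n A"
    using t by (intro matrix_norm_upper) auto
  moreover have "L2_set (\<lambda>i. norm (\<Sum>j<n. blinfun_apply (A i j) ((1 / t) *\<^sub>R v j))) {..<n}
      = L2_set (\<lambda>i. norm (\<Sum>j<n. blinfun_apply (A i j) (v j))) {..<n} * (1 / t)"
    using t by (subst L2_set_left_distrib) (auto simp: blinfun.scaleR_right simp flip: scaleR_sum_right)
  ultimately show ?thesis using t by (simp add: t_def[symmetric] field_simps)
qed

text \<open>
  The norm of a matrix is the supremum of the absolute values of the following forms. They depend on finitely many inner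
  products \<open>\<langle>x, A y\<rangle>\<close> of the entries, hence are easy to compress to subspaces and to pass to weak limits.
\<close>

abbreviation matrix_form ::
  "nat \<Rightarrow> (nat \<Rightarrow> nat \<Rightarrow> 'h::complex_hilbert_space \<Rightarrow>\<^sub>L 'h) \<Rightarrow> (nat \<Rightarrow> 'h) \<Rightarrow> (nat \<Rightarrow> 'h) \<Rightarrow> complex" where
  "matrix_form n A x y \<equiv> \<Sum>i<n. \<Sum>j<n. cinner (x i) (blinfun_apply (A i j) (y j))"

lemma matrix_form_le:
  "cmod (matrix_form n A x y)
     \<le> matrix_norm n A * L2_set (\<lambda>j. norm (x j)) {..<n} * L2_set (\<lambda>j. norm (y j)) {..<n}"
proof -
  have "cmod (matrix_form n A x y) = cmod (\<Sum>i<n. cinner (x i) (\<Sum>j<n. blinfun_apply (A i j) (y j)))"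
    by (simp add: cinner_sum_right)
  also have "\<dots> \<le> (\<Sum>i<n. norm (x i) * norm (\<Sum>j<n. blinfun_apply (A i j) (y j)))"
    by (intro sum_norm_le Cauchy_Schwarz_cinner)
  also have "\<dots> \<le> L2_set (\<lambda>j. norm (x j)) {..<n} * L2_set (\<lambda>i. norm (\<Sum>j<n. blinfun_apply (A i j) (y j))) {..<n}"
    using L2_set_mult_ineq[of "\<lambda>j. norm (x j)" "\<lambda>i. norm (\<Sum>j<n. blinfun_apply (A i j) (y j))" "{..<n}"]
    by simp
  also have "\<dots> \<le> L2_set (\<lambda>j. norm (x j)) {..<n} * (matrix_norm n A * L2_set (\<lambda>j. norm (y j)) {..<n})"
    by (intro mult_left_mono matrix_norm_apply L2_set_nonneg)
  finally show ?thesis by (simp add: ac_simps)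
qed

lemma matrix_form_attains:
  fixes A :: "nat \<Rightarrow> nat \<Rightarrow> 'h::complex_hilbert_space \<Rightarrow>\<^sub>L 'h"
  assumes "t < matrix_norm n A"
  shows "\<exists>x y. L2_set (\<lambda>j. norm (x j)) {..<n} \<le> 1 \<and> L2_set (\<lambda>j. norm (y j)) {..<n} \<le> 1 \<and>
    t < cmod (matrix_form n A x y)"
proof (cases "t < 0")
  case True
  then show ?thesis by (intro exI[of _ "\<lambda>_. 0"]) (simp add: L2_set_def)
next
  case False
  have ne: "{v :: nat \<Rightarrow> 'h. L2_set (\<lambda>j. norm (v j)) {..<n} \<le> 1} \<noteq> {}"
    by (auto intro!: exI[of _ "\<lambda>_. 0"] simp: L2_set_def)
  obtain y where y: "L2_set (\<lambda>j. norm (y j)) {..<n} \<le> 1"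
    "t < L2_set (\<lambda>i. norm (\<Sum>j<n. blinfun_apply (A i j) (y j))) {..<n}"
    using less_cSupD[OF _ assms[unfolded matrix_norm_def]] ne by auto
  define w where "w i = (\<Sum>j<n. blinfun_apply (A i j) (y j))" for i
  define s where "s = L2_set (\<lambda>i. norm (w i)) {..<n}"
  have s: "t < s" "0 < s" using y(2) False unfolding s_def w_def by auto
  define x where "x i = (1 / s) *\<^sub>R w i" for i
  have "L2_set (\<lambda>j. norm (x j)) {..<n} = s * (1 / s)"
    unfolding x_def s_def using s(2)[unfolded s_def] by (subst L2_set_left_distrib) (auto simp: field_simps)
  have f1: "matrix_form n A x y = (\<Sum>i<n. of_real (1 / s) * of_real ((norm (w i))\<^sup>2))"
    unfolding cinner_sum_right[symmetric] w_def[symmetric] x_def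
    by (simp add: cinner_simps cinner_self)
  have f2: "(\<Sum>i<n. of_real (1 / s) * of_real ((norm (w i))\<^sup>2)) = complex_of_real (1 / s * (\<Sum>i<n. (norm (w i))\<^sup>2))"
    by (simp only: sum_distrib_left of_real_sum of_real_mult)
  have f3: "(\<Sum>i<n. (norm (w i))\<^sup>2) = s\<^sup>2"
    unfolding s_def L2_set_def by (simp add: sum_nonneg)
  have "matrix_form n A x y = of_real s"
    unfolding f1 f2 f3 using s by (simp add: power2_eq_square)
  moreover have "L2_set (\<lambda>j. norm (x j)) {..<n} = 1"
    using \<open>L2_set _ _ = s * (1 / s)\<close> s by simp
  ultimately have "L2_set (\<lambda>j. norm (x j)) {..<n} \<le> 1 \<and> L2_set (\<lambda>j. norm (y j)) {..<n} \<le> 1 \<and>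
    t < cmod (matrix_form n A x y)"
    using y(1) s by simp
  then show ?thesis by blast
qed

lemma matrix_norm_leI:
  assumes "\<And>x y. cmod (matrix_form n A x y) \<le> K * L2_set (\<lambda>j. norm (x j)) {..<n} * L2_set (\<lambda>j. norm (y j)) {..<n}"
    and "0 \<le> K"
  shows "matrix_norm n A \<le> K"
proof (rule ccontr)
  assume "\<not> ?thesis"
  then obtain x y where xy: "L2_set (\<lambda>j. norm (x j)) {..<n} \<le> 1" "L2_set (\<lambda>j. norm (y j)) {..<n} \<le> 1"
    "K < cmod (matrix_form n A x y)"
    using matrix_form_attains[of K n A] by auto
  have "K * L2_set (\<lambda>j. norm (x j)) {..<n} * L2_set (\<lambda>j. norm (y j)) {..<n} \<le> K * 1 * 1"
    using xy \<open>0 \<le> K\<close> by (intro mult_mono mult_left_mono mult_nonneg_nonneg) (auto simp: L2_set_nonneg)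
  then show False using assms(1)[of x y] xy(3) by linarith
qed

lemma matrix_norm_le_sum: "matrix_norm n A \<le> (\<Sum>i<n. \<Sum>j<n. norm (A i j))"
  for A :: "nat \<Rightarrow> nat \<Rightarrow> 'h::complex_hilbert_space \<Rightarrow>\<^sub>L 'h"
proof (rule matrix_norm_leI)
  fix x y :: "nat \<Rightarrow> 'h"
  have "cmod (matrix_form n A x y) \<le> (\<Sum>i<n. norm (x i) * norm (\<Sum>j<n. blinfun_apply (A i j) (y j)))"
    unfolding cinner_sum_right[symmetric] by (intro sum_norm_le Cauchy_Schwarz_cinner)
  also have "\<dots> \<le> L2_set (\<lambda>j. norm (x j)) {..<n} * L2_set (\<lambda>i. norm (\<Sum>j<n. blinfun_apply (A i j) (y j))) {..<n}"
    using L2_set_mult_ineq[of "\<lambda>j. norm (x j)" "\<lambda>i. norm (\<Sum>j<n. blinfun_apply (A i j) (y j))" "{..<n}"]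
    by simp
  also have "\<dots> \<le> L2_set (\<lambda>j. norm (x j)) {..<n} * ((\<Sum>i<n. \<Sum>j<n. norm (A i j)) * L2_set (\<lambda>j. norm (y j)) {..<n})"
    by (intro mult_left_mono matrix_apply_le_sum L2_set_nonneg)
  finally show "cmod (matrix_form n A x y)
      \<le> (\<Sum>i<n. \<Sum>j<n. norm (A i j)) * L2_set (\<lambda>j. norm (x j)) {..<n} * L2_set (\<lambda>j. norm (y j)) {..<n}"
    by (simp add: ac_simps)
qed (simp add: sum_nonneg)

lemma matrix_norm_triangle:
  "matrix_norm n (\<lambda>i j. A i j + B i j) \<le> matrix_norm n A + matrix_norm n B"
proof (rule matrix_norm_leI)
  fix x y
  have "matrix_form n (\<lambda>i j. A i j + B i j) x y = matrix_form n A x y + matrix_form n B x y"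
    by (simp add: blinfun.add_left cinner_add_right sum.distrib)
  then show "cmod (matrix_form n (\<lambda>i j. A i j + B i j) x y) \<le>
      (matrix_norm n A + matrix_norm n B) * L2_set (\<lambda>j. norm (x j)) {..<n} * L2_set (\<lambda>j. norm (y j)) {..<n}"
    using norm_triangle_ineq[of "matrix_form n A x y" "matrix_form n B x y"]
      matrix_form_le[where n = n and A = A and x = x and y = y] matrix_form_le[where n = n and A = B and x = x and y = y]
    by (simp add: distrib_right)
qed (simp add: matrix_norm_nonneg)

lemma matrix_norm_scaleR_le: "matrix_norm n (\<lambda>i j. r *\<^sub>R A i j) \<le> \<bar>r\<bar> * matrix_norm n A"
proof (rule matrix_norm_leI)
  fix x y
  have "matrix_form n (\<lambda>i j. r *\<^sub>R A i j) x y = of_real r * matrix_form n A x y"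
    by (simp add: blinfun.scaleR_left cinner_simps sum_distrib_left)
  then show "cmod (matrix_form n (\<lambda>i j. r *\<^sub>R A i j) x y) \<le>
      \<bar>r\<bar> * matrix_norm n A * L2_set (\<lambda>j. norm (x j)) {..<n} * L2_set (\<lambda>j. norm (y j)) {..<n}"
    using mult_left_mono[OF matrix_form_le[where n = n and A = A and x = x and y = y], of "\<bar>r\<bar>"]
    by (simp add: norm_mult ac_simps)
qed (simp add: matrix_norm_nonneg)

lemma matrix_norm_1: "matrix_norm (Suc 0) A = norm (A 0 0)"
proof (rule antisym)
  show "matrix_norm (Suc 0) A \<le> norm (A 0 0)"
    using matrix_norm_le_sum[of "Suc 0" A] by simp
  show "norm (A 0 0) \<le> matrix_norm (Suc 0) A"
    using matrix_norm_apply[where n = "Suc 0" and A = A and v = "\<lambda>_. v" for v] matrix_norm_nonneg[of "Suc 0" A]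
    by (intro norm_blinfun_bound) (auto simp: lessThan_Suc)
qed

lemma zero_in_cb_values: "0 \<in> cb_values X T"
proof -
  have z: "matrix_norm 0 B = 0" for B :: "nat \<Rightarrow> nat \<Rightarrow> 'c::complex_hilbert_space \<Rightarrow>\<^sub>L 'c"
    using matrix_norm_le_sum[of 0 B] matrix_norm_nonneg[of 0 B] by simp
  have "(\<lambda>_ _. 0) \<in> matrix_unit_ball X 0" by (simp add: matrix_unit_ball_def z)
  then have "matrix_norm 0 (\<lambda>i j. T 0) \<in> cb_values X T" unfolding cb_values_def by fast
  then show ?thesis by (simp add: z)
qed

lemma cb_norm_nonneg: "completely_bounded X Z T \<Longrightarrow> 0 \<le> cb_norm X T"
  unfolding cb_norm_def completely_bounded_def by (intro cSup_upper zero_in_cb_values) auto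

text \<open>
  As the matrix may have norm 0, it is divided by numbers slightly above its norm before the definition applies.
\<close>

lemma cb_norm_bound:
  assumes T: "completely_bounded X Z T" and X: "csubspace X"
    and A: "\<And>i j. i < n \<Longrightarrow> j < n \<Longrightarrow> A i j \<in> X"
  shows "matrix_norm n (\<lambda>i j. T (A i j)) \<le> cb_norm X T * matrix_norm n A"
proof -
  let ?c = "cb_norm X T"
  note c = cb_norm_nonneg[OF T]
  have *: "matrix_norm n (\<lambda>i j. T (A i j)) \<le> (matrix_norm n A + e) * ?c" if "0 < e" for e
  proof -
    define s where "s = matrix_norm n A + e"
    have s: "0 < s" using matrix_norm_nonneg[of n A] that unfolding s_def by linarith
    define B where "B i j = (1 / s) *\<^sub>R A i j" for i j
    have "matrix_norm n B \<le> \<bar>1 / s\<bar> * matrix_norm n A"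
      unfolding B_def by (rule matrix_norm_scaleR_le)
    also have "\<dots> \<le> 1" using s that unfolding s_def by (simp add: field_simps)
    finally have "B \<in> matrix_unit_ball X n"
      using A X by (auto simp: matrix_unit_ball_def B_def csubspace_scaleR)
    then have "matrix_norm n (\<lambda>i j. T (B i j)) \<in> cb_values X T" unfolding cb_values_def by blast
    then have le: "matrix_norm n (\<lambda>i j. T (B i j)) \<le> ?c"
      unfolding cb_norm_def using T by (intro cSup_upper) (auto simp: completely_bounded_def)
    have "matrix_norm n (\<lambda>i j. T (A i j)) = matrix_norm n (\<lambda>i j. s *\<^sub>R T (B i j))"
    proof (rule matrix_norm_cong)
      fix i j assume "i < n" "j < n"
      then have "T (B i j) = (1 / s) *\<^sub>R T (A i j)"
        using A T unfolding B_def completely_bounded_def clinear_on_def by (metis scaleC_of_real)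
      then show "T (A i j) = s *\<^sub>R T (B i j)" using s by simp
    qed
    also have "\<dots> \<le> \<bar>s\<bar> * matrix_norm n (\<lambda>i j. T (B i j))" by (rule matrix_norm_scaleR_le)
    also have "\<dots> \<le> s * ?c" using s le by (simp add: mult_left_mono)
    finally show ?thesis by (simp add: s_def)
  qed
  show ?thesis
  proof (rule field_le_epsilon)
    fix e :: real assume "0 < e"
    define e' where "e' = e / (?c + 1)"
    have "0 < e'" "e' * ?c \<le> e" unfolding e'_def using c \<open>0 < e\<close> by (auto simp: field_simps)
    then show "matrix_norm n (\<lambda>i j. T (A i j)) \<le> ?c * matrix_norm n A + e"
      using *[of e'] by (simp add: algebra_simps)
  qed
qed

lemma cb_norm_bound_1:
  assumes "completely_bounded X Z T" "csubspace X" "A \<in> X"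
  shows "norm (T A) \<le> cb_norm X T * norm A"
  using cb_norm_bound[OF assms(1,2), of "Suc 0" "\<lambda>_ _. A"] assms(3) by (simp add: matrix_norm_1)

lemma completely_boundedI:
  assumes "clinear_on X T" "\<And>A. A \<in> X \<Longrightarrow> T A \<in> Z" "0 \<le> K"
    and "\<And>n A. (\<And>i j. i < n \<Longrightarrow> j < n \<Longrightarrow> A i j \<in> X) \<Longrightarrow>
      matrix_norm n (\<lambda>i j. T (A i j)) \<le> K * matrix_norm n A"
  shows "completely_bounded X Z T" "cb_norm X T \<le> K"
proof -
  have le: "x \<le> K" if x: "x \<in> cb_values X T" for x
  proof -
    obtain n A where A: "A \<in> matrix_unit_ball X n" "x = matrix_norm n (\<lambda>i j. T (A i j))"
      using x unfolding cb_values_def by blast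
    then have "x \<le> K * matrix_norm n A" using assms(4) by (simp add: matrix_unit_ball_def)
    also have "\<dots> \<le> K * 1" using A \<open>0 \<le> K\<close> by (intro mult_left_mono) (auto simp: matrix_unit_ball_def)
    finally show ?thesis by simp
  qed
  show "completely_bounded X Z T"
    unfolding completely_bounded_def using assms(1,2) le by (auto intro!: bdd_aboveI)
  show "cb_norm X T \<le> K"
    unfolding cb_norm_def using zero_in_cb_values le by (intro cSup_least) auto
qed

text \<open>
  Used in both directions below: to pull a map back along a complete isometry \<open>J\<close>, and to compose an extension with \<open>J\<close>.
\<close>

lemma cb_values_image:
  assumes iso: "\<And>n A. (\<And>i j. i < n \<Longrightarrow> j < n \<Longrightarrow> A i j \<in> X) \<Longrightarrow>
      matrix_norm n (\<lambda>i j. J (A i j)) = matrix_norm n A"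
    and S: "\<And>A. A \<in> X \<Longrightarrow> S (J A) = T A"
  shows "cb_values (J ` X) S = cb_values X T"
proof (intro set_eqI iffI)
  fix x assume "x \<in> cb_values (J ` X) S"
  then obtain n B where B: "B \<in> matrix_unit_ball (J ` X) n" "x = matrix_norm n (\<lambda>i j. S (B i j))"
    unfolding cb_values_def by blast
  define A where "A i j = inv_into X J (B i j)" for i j
  have A: "A i j \<in> X" "J (A i j) = B i j" if "i < n" "j < n" for i j
    using B(1) that unfolding A_def matrix_unit_ball_def
    by (auto intro: inv_into_into f_inv_into_f)
  have "matrix_norm n A = matrix_norm n B"
    using iso[of n A] A matrix_norm_cong[of n "\<lambda>i j. J (A i j)" B] by simp
  then have "A \<in> matrix_unit_ball X n" using A(1) B(1) by (simp add: matrix_unit_ball_def)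
  moreover have "x = matrix_norm n (\<lambda>i j. T (A i j))"
    unfolding B(2) by (rule matrix_norm_cong) (use A S in metis)
  ultimately show "x \<in> cb_values X T" unfolding cb_values_def by blast
next
  fix x assume "x \<in> cb_values X T"
  then obtain n A where A: "A \<in> matrix_unit_ball X n" "x = matrix_norm n (\<lambda>i j. T (A i j))"
    unfolding cb_values_def by blast
  then have "(\<lambda>i j. J (A i j)) \<in> matrix_unit_ball (J ` X) n"
    using iso[of n A] by (auto simp: matrix_unit_ball_def)
  moreover have "x = matrix_norm n (\<lambda>i j. S (J (A i j)))"
    unfolding A(2) using A(1) S by (intro matrix_norm_cong) (auto simp: matrix_unit_ball_def)
  ultimately show "x \<in> cb_values (J ` X) S"
    unfolding cb_values_def by (intro UN_I[of n] image_eqI[of _ _ "\<lambda>i j. J (A i j)"]) simp_all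
qed

section \<open>Separable operator spaces act on \<open>ell2\<close>\<close>

text \<open>
  As \<open>sgn 0 = 0\<close>, a vector that depends on its predecessors contributes the vector 0, and the sequence is orthonormal
  apart from zeros.
\<close>

fun gram_schmidt :: "(nat \<Rightarrow> 'h::complex_hilbert_space) \<Rightarrow> nat \<Rightarrow> 'h" where
  "gram_schmidt s n = sgn (s n - (\<Sum>k<n. cinner (gram_schmidt s k) (s n) *\<^sub>C gram_schmidt s k))"

declare gram_schmidt.simps [simp del]

lemma gram_schmidt_norm_cases: "gram_schmidt s n = 0 \<or> norm (gram_schmidt s n) = 1"
  by (subst (1 2) gram_schmidt.simps) (simp add: norm_sgn sgn_zero_iff)

lemma gram_schmidt_orth_less:
  assumes "k < n"
  shows "cinner (gram_schmidt s k) (gram_schmidt s n) = 0"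
  using assms
proof (induction n arbitrary: k rule: less_induct)
  case (less n)
  let ?u = "gram_schmidt s"
  have orth: "cinner (?u k) (?u j) = 0" if "j < n" "j \<noteq> k" for j
  proof (cases "j < k")
    case True
    then have "cinner (?u j) (?u k) = 0" using less.IH less.prems by blast
    then show ?thesis by (subst cinner_commute) simp
  next
    case False
    then show ?thesis using less.IH[of j k] that by simp
  qed
  have "(\<Sum>j<n. cinner (?u j) (s n) * cinner (?u k) (?u j)) = cinner (?u k) (s n) * cinner (?u k) (?u k)"
    using less.prems by (subst sum.remove[of _ k]) (auto intro!: sum.neutral simp: orth)
  moreover have "cinner (?u k) (s n) * cinner (?u k) (?u k) = cinner (?u k) (s n)"
    using gram_schmidt_norm_cases[of s k] by (auto simp: cinner_self)
  ultimately have "cinner (?u k) (s n - (\<Sum>j<n. cinner (?u j) (s n) *\<^sub>C ?u j)) = 0"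
    by (simp add: cinner_simps cinner_sum_right)
  then show ?case
    by (subst (2) gram_schmidt.simps) (simp add: sgn_div_norm cinner_simps)
qed

lemma gram_schmidt_orth: "k \<noteq> n \<Longrightarrow> cinner (gram_schmidt s k) (gram_schmidt s n) = 0"
  using gram_schmidt_orth_less[of k n s] gram_schmidt_orth_less[of n k s]
  by (cases k n rule: linorder_cases) (auto simp: cinner_commute[of "gram_schmidt s k"])

lemma gram_schmidt_expansion:
  "s n = (\<Sum>k\<le>n. cinner (gram_schmidt s k) (s n) *\<^sub>C gram_schmidt s k)"
proof -
  let ?u = "gram_schmidt s"
  define r where "r = s n - (\<Sum>k<n. cinner (?u k) (s n) *\<^sub>C ?u k)"
  have u: "?u n = sgn r" unfolding r_def by (rule gram_schmidt.simps)
  have "r = norm r *\<^sub>R ?u n" unfolding u by (cases "r = 0") (simp_all add: sgn_div_norm)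
  have "cinner (?u n) (s n) = cinner (?u n) r"
    unfolding r_def by (simp add: cinner_simps cinner_sum_right gram_schmidt_orth)
  also have "\<dots> = of_real (norm r)"
    unfolding u by (cases "r = 0") (simp_all add: sgn_div_norm cinner_simps cinner_self power2_eq_square)
  finally have "cinner (?u n) (s n) *\<^sub>C ?u n = r" using \<open>r = norm r *\<^sub>R ?u n\<close> by (simp add: scaleC_of_real)
  then show ?thesis unfolding lessThan_Suc_atMost[symmetric] by (simp add: r_def)
qed

lemma gram_schmidt_Bessel: "(\<Sum>k<N. (cmod (cinner (gram_schmidt s k) x))\<^sup>2) \<le> (norm x)\<^sup>2"
proof -
  let ?u = "gram_schmidt s"
  define c where "c k = cinner (?u k) x" for k
  define p where "p = (\<Sum>k<N. c k *\<^sub>C ?u k)"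
  have cc: "cnj (c k) * c k = of_real ((cmod (c k))\<^sup>2)" for k
    by (simp only: complex_norm_square mult.commute)
  have px: "Re (cinner x p) = (\<Sum>k<N. (cmod (c k))\<^sup>2)"
  proof -
    have "Re (cinner x p) = Re (cinner p x)" by (rule Re_cinner_commute)
    also have "cinner p x = (\<Sum>k<N. cnj (c k) * c k)" unfolding p_def by (simp add: cinner_sum_left cinner_simps c_def)
    finally show ?thesis by (simp add: cc)
  qed
  have "cinner (?u k) p = c k * cinner (?u k) (?u k)" if "k < N" for k
    unfolding p_def cinner_sum_right cinner_scaleC_right
    using that by (subst sum.remove[of _ k]) (auto intro!: sum.neutral simp: gram_schmidt_orth)
  then have "cinner p p = (\<Sum>k<N. cnj (c k) * (c k * cinner (?u k) (?u k)))"
    by (subst (1) p_def) (simp add: cinner_sum_left cinner_simps)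
  also have "\<dots> = (\<Sum>k<N. of_real ((cmod (c k))\<^sup>2 * (norm (?u k))\<^sup>2))"
    by (simp add: mult.assoc[symmetric] cc cinner_self)
  finally have "(norm p)\<^sup>2 = (\<Sum>k<N. (cmod (c k))\<^sup>2 * (norm (?u k))\<^sup>2)"
    using Re_cinner_self[of p] by simp
  also have "\<dots> \<le> (\<Sum>k<N. (cmod (c k))\<^sup>2)"
    using gram_schmidt_norm_cases[of s] by (intro sum_mono) (metis mult.right_neutral mult_zero_right norm_zero order_refl power_one zero_le_power2 zero_power2)
  finally show ?thesis
    using norm_diff_square[of x p] zero_le_power2[of "norm (x - p)"] px by (simp add: c_def)
qed

text \<open>
  \<open>W\<close> reads off the coordinates with respect to the Gram-Schmidt sequence. It is a contraction by Bessel's inequality, and \<open>W\<^sup>* W\<close>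
  fixes each \<open>s\<^sub>n\<close> because \<open>s\<^sub>n\<close> is a finite combination of that sequence.
\<close>

lemma ell2_coordinate_map:
  fixes s :: "nat \<Rightarrow> 'h::complex_hilbert_space"
  shows "\<exists>W :: 'h \<Rightarrow>\<^sub>L ell2. clin W \<and> norm W \<le> 1 \<and> (\<forall>n. adj W (W (s n)) = s n)"
proof -
  let ?u = "gram_schmidt s"
  have bound: "L2_set (\<lambda>i. cmod (cinner (?u i) x)) {..<n} \<le> norm x" for x n
    unfolding L2_set_def by (rule real_le_lsqrt) (auto simp: gram_schmidt_Bessel)
  define w where "w x = Abs_ell2 (\<lambda>k. cinner (?u k) x)" for x
  have nth: "ell2_nth (w x) k = cinner (?u k) x" for x k
    unfolding w_def using ell2_boundI(1)[OF bound] by (subst Abs_ell2_inverse) auto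
  have eq: "x = y" if "\<And>k. ell2_nth x k = ell2_nth y k" for x y
    using that by (simp add: ell2_nth_inject[symmetric] fun_eq_iff)
  have add: "w (x + y) = w x + w y" for x y
    by (rule eq) (simp add: nth plus_ell2.rep_eq cinner_simps)
  have scale: "w (c *\<^sub>C x) = c *\<^sub>C w x" for c x
    by (rule eq) (simp add: nth scaleC_ell2.rep_eq cinner_simps)
  have norm: "norm (w x) \<le> norm x" for x
    unfolding norm_ell2.rep_eq nth by (rule ell2_boundI(2)[OF bound])
  have "bounded_linear w"
    by (rule bounded_linear_intro[of _ 1])
      (use norm in \<open>simp_all add: add scale flip: scaleC_of_real\<close>)
  then have app: "blinfun_apply (Blinfun w) = w" by (rule bounded_linear_Blinfun_apply)
  define W where "W = Blinfun w"
  have W: "clin W" unfolding W_def by (rule clinI) (simp add: app scale)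
  have "norm W \<le> 1" unfolding W_def by (rule norm_blinfun_bound) (use norm in \<open>auto simp: app\<close>)
  moreover have "adj W (W (s n)) = s n" for n
  proof (rule cinner_eqI)
    fix z
    have zero: "cinner (?u k) (s n) = 0" if "n < k" for k
      using that by (subst gram_schmidt_expansion) (auto simp: cinner_sum_right cinner_simps gram_schmidt_orth)
    have "cinner z (adj W (W (s n))) = cinner (w z) (w (s n))" by (simp add: cinner_adj[OF W]) (simp add: W_def app)
    also have "\<dots> = (\<Sum>k. cnj (cinner (?u k) z) * cinner (?u k) (s n))"
      by (simp add: cinner_ell2.rep_eq nth)
    also have "\<dots> = (\<Sum>k\<le>n. cnj (cinner (?u k) z) * cinner (?u k) (s n))"
      by (rule suminf_finite) (auto simp: zero)
    also have "\<dots> = cinner z (\<Sum>k\<le>n. cinner (?u k) (s n) *\<^sub>C ?u k)"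
      by (simp add: cinner_sum_right cinner_simps cinner_commute[of z] mult.commute)
    also have "\<dots> = cinner z (s n)" by (simp flip: gram_schmidt_expansion)
    finally show "cinner z (adj W (W (s n))) = cinner z (s n)" .
  qed
  ultimately show ?thesis using W by blast
qed

text \<open>
  Countably many vectors almost attain the norms of all matrices over a dense sequence. Compression
  to their closed span, read in an orthonormal basis, therefore keeps all matrix norms.
\<close>

lemma separable_complete_isometry:
  fixes Y :: "('h::complex_hilbert_space \<Rightarrow>\<^sub>L 'h) set"
  assumes Y: "csubspace Y" and sep: "separable_space (top_of_set Y)"
  shows "\<exists>W :: 'h \<Rightarrow>\<^sub>L ell2. clin W \<and>
    (\<forall>n A. (\<forall>i<n. \<forall>j<n. A i j \<in> Y) \<longrightarrow> matrix_norm n (\<lambda>i j. (W o\<^sub>L A i j) o\<^sub>L adj W) = matrix_norm n A)"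
proof -
  obtain D where D: "countable D" "D \<subseteq> Y" "Y \<subseteq> closure D"
    using sep unfolding separable_space_def by (auto simp: closure_of_subtopology inf.absorb2)
  \<comment> \<open>matrices are listed row by row, so that those over \<open>D\<close> are indexed by the countable set \<open>lists D\<close>\<close>
  define mat where "mat n l i j = l ! (i * n + j)" for n :: nat and l :: "('h \<Rightarrow>\<^sub>L 'h) list" and i j
  define near where "near n l m p \<longleftrightarrow> L2_set (\<lambda>j. norm (fst p j)) {..<n} \<le> 1 \<and>
      L2_set (\<lambda>j. norm (snd p j)) {..<n} \<le> 1 \<and>
      matrix_norm n (mat n l) - 1 / real (Suc m) < cmod (matrix_form n (mat n l) (fst p) (snd p))"
    for n l m and p :: "(nat \<Rightarrow> 'h) \<times> (nat \<Rightarrow> 'h)"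
  define p where "p n l m = (SOME p. near n l m p)" for n l m
  have p: "near n l m (p n l m)" for n l m
  proof -
    obtain x y where "L2_set (\<lambda>j. norm (x j)) {..<n} \<le> 1" "L2_set (\<lambda>j. norm (y j)) {..<n} \<le> 1"
      "matrix_norm n (mat n l) - 1 / real (Suc m) < cmod (matrix_form n (mat n l) x y)"
      using matrix_form_attains[of "matrix_norm n (mat n l) - 1 / real (Suc m)" n "mat n l"] by auto
    then have "near n l m (x, y)" by (simp add: near_def)
    then show ?thesis unfolding p_def by (rule someI)
  qed
  define x where "x n l m = fst (p n l m)" for n l m
  define y where "y n l m = snd (p n l m)" for n l m
  have xy: "L2_set (\<lambda>j. norm (x n l m j)) {..<n} \<le> 1" "L2_set (\<lambda>j. norm (y n l m j)) {..<n} \<le> 1"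
      "matrix_norm n (mat n l) - 1 / real (Suc m) < cmod (matrix_form n (mat n l) (x n l m) (y n l m))"
    for n l m
    using p[of n l m] unfolding near_def x_def y_def by auto
  define S where "S = (\<lambda>(n, l, m, i). x n l m i) ` (UNIV \<times> lists D \<times> UNIV \<times> UNIV) \<union>
    (\<lambda>(n, l, m, i). y n l m i) ` (UNIV \<times> lists D \<times> UNIV \<times> UNIV)"
  have "countable S" unfolding S_def using D(1) by (intro countable_Un countable_image countable_SIGMA) auto
  have Sx: "x n l m i \<in> S" "y n l m i \<in> S" if "l \<in> lists D" for n l m i
    using that unfolding S_def
    by (auto intro!: image_eqI[of _ _ "(n, l, m, i)"])
  have "S \<noteq> {}" using Sx(1)[of "[]"] by auto
  obtain W :: "'h \<Rightarrow>\<^sub>L ell2" where W: "clin W" "norm W \<le> 1" "\<And>n. adj W (W (from_nat_into S n)) = from_nat_into S n"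
    using ell2_coordinate_map by blast
  have WS: "adj W (W v) = v" if "v \<in> S" for v
    using W(3)[of "to_nat_on S v"] that \<open>countable S\<close> by simp
  have Wle: "norm (W v) \<le> norm v" for v
    using norm_blinfun[of W v] mult_right_mono[OF W(2), of "norm v"] by simp
  have Wle': "norm (adj W v) \<le> norm v" for v
    using norm_blinfun[of "adj W" v] mult_right_mono[OF order_trans[OF norm_adj[OF W(1)] W(2)], of "norm v"] by simp
  have form: "matrix_form n (\<lambda>i j. (W o\<^sub>L A i j) o\<^sub>L adj W) p q = matrix_form n A (\<lambda>i. adj W (p i)) (\<lambda>j. adj W (q j))"
    for n A p q by (simp add: cinner_adj'[OF W(1)])
  have le: "matrix_norm n (\<lambda>i j. (W o\<^sub>L A i j) o\<^sub>L adj W) \<le> matrix_norm n A" for n A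
  proof (rule matrix_norm_leI)
    fix p q :: "nat \<Rightarrow> ell2"
    have "cmod (matrix_form n A (\<lambda>i. adj W (p i)) (\<lambda>j. adj W (q j))) \<le> matrix_norm n A *
        L2_set (\<lambda>i. norm (adj W (p i))) {..<n} * L2_set (\<lambda>i. norm (adj W (q i))) {..<n}"
      by (rule matrix_form_le)
    also have "\<dots> \<le> matrix_norm n A * L2_set (\<lambda>i. norm (p i)) {..<n} * L2_set (\<lambda>i. norm (q i)) {..<n}"
      by (intro mult_mono mult_nonneg_nonneg L2_set_mono Wle' matrix_norm_nonneg L2_set_nonneg order_refl norm_ge_zero)
    finally show "cmod (matrix_form n (\<lambda>i j. (W o\<^sub>L A i j) o\<^sub>L adj W) p q) \<le> matrix_norm n A *
        L2_set (\<lambda>i. norm (p i)) {..<n} * L2_set (\<lambda>i. norm (q i)) {..<n}"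
      unfolding form .
  qed (rule matrix_norm_nonneg)
  have dense: "matrix_norm n (mat n l) \<le> matrix_norm n (\<lambda>i j. (W o\<^sub>L mat n l i j) o\<^sub>L adj W)"
    if l: "l \<in> lists D" for n l
  proof (rule field_le_epsilon)
    fix e :: real assume "0 < e"
    then obtain m where m: "inverse (real (Suc m)) < e" using reals_Archimedean by blast
    let ?x = "x n l m" and ?y = "y n l m" and ?B = "\<lambda>i j. (W o\<^sub>L mat n l i j) o\<^sub>L adj W"
    have "cmod (matrix_form n (mat n l) ?x ?y) = cmod (matrix_form n ?B (\<lambda>i. W (?x i)) (\<lambda>i. W (?y i)))"
      unfolding form by (simp add: WS Sx[OF l])
    also have "\<dots> \<le> matrix_norm n ?B * L2_set (\<lambda>i. norm (W (?x i))) {..<n} * L2_set (\<lambda>i. norm (W (?y i))) {..<n}"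
      by (rule matrix_form_le)
    also have "\<dots> \<le> matrix_norm n ?B * L2_set (\<lambda>i. norm (?x i)) {..<n} * L2_set (\<lambda>i. norm (?y i)) {..<n}"
      by (intro mult_mono mult_nonneg_nonneg L2_set_mono Wle matrix_norm_nonneg L2_set_nonneg order_refl norm_ge_zero)
    also have "\<dots> \<le> matrix_norm n ?B * 1 * 1"
      by (intro mult_mono mult_nonneg_nonneg xy matrix_norm_nonneg L2_set_nonneg) auto
    finally show "matrix_norm n (mat n l) \<le> matrix_norm n ?B + e"
      using xy(3)[of n l m] m by (simp add: inverse_eq_divide)
  qed
  have "matrix_norm n A \<le> matrix_norm n (\<lambda>i j. (W o\<^sub>L A i j) o\<^sub>L adj W)"
    if A: "\<forall>i<n. \<forall>j<n. A i j \<in> Y" for n A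
  proof (rule field_le_epsilon)
    fix e :: real assume "0 < e"
    define d where "d = e / (2 * (real n * real n + 1))"
    have "0 < d" "real n * real n * d \<le> e / 2"
      unfolding d_def using \<open>0 < e\<close> by (auto simp: field_simps add_pos_nonneg intro: add_nonneg_pos)
    have "\<exists>b\<in>D. norm (A i j - b) < d" if "i < n" "j < n" for i j
    proof -
      have "A i j \<in> closure D" using A D(3) that by blast
      then show ?thesis using \<open>0 < d\<close> unfolding closure_approachable by (metis dist_commute dist_norm)
    qed
    then obtain b where b: "\<And>i j. i < n \<Longrightarrow> j < n \<Longrightarrow> b i j \<in> D \<and> norm (A i j - b i j) < d" by metis
    define l where "l = map (\<lambda>k. b (k div n) (k mod n)) [0..<n * n]"
    have ij: "i * n + j < n * n" if "i < n" "j < n" for i j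
    proof -
      have "i * n + j < Suc i * n" using that by simp
      also have "\<dots> \<le> n * n" using that by (intro mult_le_mono1) simp
      finally show ?thesis .
    qed
    have mat: "mat n l i j = b i j" if "i < n" "j < n" for i j
      using that ij[OF that] unfolding mat_def l_def by simp
    have "l \<in> lists D"
    proof -
      have "b (k div n) (k mod n) \<in> D" if "k < n * n" for k
      proof -
        have "0 < n" using that by (cases n) auto
        then show ?thesis using b[of "k div n" "k mod n"] that by (simp add: less_mult_imp_div_less)
      qed
      then show ?thesis unfolding l_def by auto
    qed
    define E where "E i j = A i j - mat n l i j" for i j
    have "matrix_norm n E \<le> (\<Sum>i<n. \<Sum>j<n. norm (E i j))" by (rule matrix_norm_le_sum)
    also have "\<dots> \<le> (\<Sum>i<n. \<Sum>j<n. d)"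
      unfolding E_def by (intro sum_mono) (use b mat in \<open>auto intro!: less_imp_le\<close>)
    also have "\<dots> \<le> e / 2" using \<open>real n * real n * d \<le> e / 2\<close> by simp
    finally have E: "matrix_norm n E \<le> e / 2" .
    have "matrix_norm n A = matrix_norm n (\<lambda>i j. mat n l i j + E i j)" by (simp add: E_def)
    also have "\<dots> \<le> matrix_norm n (mat n l) + matrix_norm n E" by (rule matrix_norm_triangle)
    also have "matrix_norm n (mat n l) \<le> matrix_norm n (\<lambda>i j. (W o\<^sub>L mat n l i j) o\<^sub>L adj W)"
      by (rule dense[OF \<open>l \<in> lists D\<close>])
    also have "\<dots> = matrix_norm n (\<lambda>i j. ((W o\<^sub>L A i j) o\<^sub>L adj W) + (- 1) *\<^sub>R ((W o\<^sub>L E i j) o\<^sub>L adj W))"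
      by (intro matrix_norm_cong blinfun_eqI) (simp add: E_def blinfun.bilinear_simps)
    also have "\<dots> \<le> matrix_norm n (\<lambda>i j. (W o\<^sub>L A i j) o\<^sub>L adj W) +
        matrix_norm n (\<lambda>i j. (- 1) *\<^sub>R ((W o\<^sub>L E i j) o\<^sub>L adj W))"
      by (rule matrix_norm_triangle)
    also have "matrix_norm n (\<lambda>i j. (- 1) *\<^sub>R ((W o\<^sub>L E i j) o\<^sub>L adj W)) \<le> \<bar>- 1\<bar> * matrix_norm n E"
      by (rule order_trans[OF matrix_norm_scaleR_le mult_left_mono[OF le]]) simp
    finally show "matrix_norm n A \<le> matrix_norm n (\<lambda>i j. (W o\<^sub>L A i j) o\<^sub>L adj W) + e"
      using E by simp
  qed
  with le W(1) show ?thesis by (intro exI[of _ W]) (auto intro!: antisym)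
qed

text \<open>
  Both test spaces and the map are carried to \<open>ell2\<close> by the same complete isometry. Images of closed subspaces are closed
  because they are complete.
\<close>

theorem CSEP_transfer:
  fixes Z :: "('k::complex_hilbert_space \<Rightarrow>\<^sub>L 'k) set"
  assumes "CSEP TYPE(ell2) lam Z"
  shows "CSEP TYPE('h::complex_hilbert_space) lam Z"
  unfolding CSEP_def cb_extension_property_def
proof (intro allI impI, elim conjE)
  fix X Y :: "('h \<Rightarrow>\<^sub>L 'h) set" and T
  assume Y: "operator_space Y" "separable_space (top_of_set Y)" and X: "operator_space X" "X \<subseteq> Y"
    and T: "completely_bounded X Z T"
  have csY: "csubspace Y" using Y by (simp add: operator_space_def)
  obtain W :: "'h \<Rightarrow>\<^sub>L ell2" where W: "clin W" and
    isoW: "\<And>n A. (\<forall>i<n. \<forall>j<n. A i j \<in> Y) \<Longrightarrow> matrix_norm n (\<lambda>i j. (W o\<^sub>L A i j) o\<^sub>L adj W) = matrix_norm n A"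
    using separable_complete_isometry[OF csY Y(2)] by blast
  define J where "J A = (W o\<^sub>L A) o\<^sub>L adj W" for A
  have iso: "matrix_norm n (\<lambda>i j. J (A i j)) = matrix_norm n A" if "\<And>i j. i < n \<Longrightarrow> j < n \<Longrightarrow> A i j \<in> Y" for n A
    using isoW[of n A] that unfolding J_def by blast
  have normJ: "norm (J A) = norm A" if "A \<in> Y" for A
    using iso[of "Suc 0" "\<lambda>_ _. A"] that by (simp add: matrix_norm_1)
  have Jadd: "J (A + B) = J A + J B" for A B
    unfolding J_def by (rule blinfun_eqI) (simp add: blinfun.bilinear_simps)
  have Jscale: "J (c *\<^sub>C A) = c *\<^sub>C J A" for c A
    unfolding J_def by (rule blinfun_eqI) (simp add: clin_scaleC[OF W])
  have Jlin: "bounded_linear J"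
  proof -
    have "bounded_linear (\<lambda>A. (W o\<^sub>L A) o\<^sub>L adj W)"
      by (intro bounded_linear_compose[OF bounded_bilinear.bounded_linear_left[OF bounded_bilinear_blinfun_compose]
            bounded_bilinear.bounded_linear_right[OF bounded_bilinear_blinfun_compose]])
    then show ?thesis unfolding J_def .
  qed
  have inj: "A = B" if AB: "A \<in> Y" "B \<in> Y" "J A = J B" for A B
  proof -
    have "norm (A - B) = norm (J (A - B))" using normJ csubspace_diff[OF csY] AB by simp
    also have "J (A - B) = 0" using AB(3) linear_diff[OF bounded_linear.linear[OF Jlin]] by simp
    finally show ?thesis by simp
  qed
  have image: "operator_space (J ` V)" if V: "operator_space V" "V \<subseteq> Y" for V
    unfolding operator_space_def
  proof (intro conjI ballI)
    show "clin B" if "B \<in> J ` V" for B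
      using that V(1) W unfolding J_def operator_space_def by (auto intro!: clin_comp clin_adj)
    have cs: "csubspace V" using V(1) by (simp add: operator_space_def)
    show "csubspace (J ` V)"
      unfolding csubspace_def
    proof (intro conjI ballI allI)
      show "0 \<in> J ` V" using csubspace_0[OF cs] linear_simps(3)[OF Jlin] by force
      show "A + B \<in> J ` V" if "A \<in> J ` V" "B \<in> J ` V" for A B
        using that csubspace_add[OF cs] by (auto simp flip: Jadd)
      show "c *\<^sub>C A \<in> J ` V" if "A \<in> J ` V" for c A
        using that csubspace_scaleC[OF cs] by (auto simp flip: Jscale)
    qed
    have "subspace V" unfolding subspace_def using cs csubspace_scaleR csubspace_add csubspace_0 by blast
    moreover have "complete V" using V(1) by (simp add: operator_space_def complete_eq_closed)
    moreover have "\<forall>A\<in>V. norm (J A) \<ge> 1 * norm A" using normJ V(2) by (simp add: subset_iff)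
    ultimately have "complete (J ` V)"
      using complete_isometric_image[OF zero_less_one _ Jlin] by blast
    then show "closed (J ` V)" by (simp add: complete_eq_closed)
  qed
  have sep: "separable_space (top_of_set (J ` Y))"
    by (rule separable_space_continuous_map_image[OF Y(2), of _ J])
      (auto intro: linear_continuous_on[OF Jlin])
  define T1 where "T1 B = T (inv_into Y J B)" for B
  have inv: "inv_into Y J (J A) = A" if "A \<in> Y" for A
    using inj that by (intro inv_into_f_f inj_onI) auto
  have T1: "T1 (J A) = T A" if "A \<in> X" for A
    using that X(2) unfolding T1_def by (simp add: inv subset_iff)
  have vals1: "cb_values (J ` X) T1 = cb_values X T"
    using X(2) T1 by (intro cb_values_image iso) auto
  have Xcs: "csubspace X" using X(1) by (simp add: operator_space_def)
  have "completely_bounded (J ` X) Z T1"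
    unfolding completely_bounded_def vals1 clinear_on_def
  proof (intro conjI ballI allI)
    show "T1 (A + B) = T1 A + T1 B" if "A \<in> J ` X" "B \<in> J ` X" for A B
      using that T csubspace_add[OF Xcs]
      by (auto simp: T1 completely_bounded_def clinear_on_def simp flip: Jadd)
    show "T1 (c *\<^sub>C A) = c *\<^sub>C T1 A" if "A \<in> J ` X" for c A
      using that T csubspace_scaleC[OF Xcs]
      by (auto simp: T1 completely_bounded_def clinear_on_def simp flip: Jscale)
  qed (use T T1 in \<open>auto simp: completely_bounded_def\<close>)
  moreover have "cb_extension_property lam (J ` X) (J ` Y) Z"
    using assms image[OF X] image[OF Y(1)] sep X(2) unfolding CSEP_def by blast
  ultimately obtain P where P: "completely_bounded (J ` Y) Z P" "\<forall>B\<in>J ` X. P B = T1 B"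
    "cb_norm (J ` Y) P \<le> lam * cb_norm (J ` X) T1"
    unfolding cb_extension_property_def by blast
  have vals2: "cb_values (J ` Y) P = cb_values Y (\<lambda>A. P (J A))"
    by (rule cb_values_image) (use iso in auto)
  show "\<exists>T'. completely_bounded Y Z T' \<and> (\<forall>A\<in>X. T' A = T A) \<and> cb_norm Y T' \<le> lam * cb_norm X T"
  proof (intro exI[of _ "\<lambda>A. P (J A)"] conjI ballI)
    show "completely_bounded Y Z (\<lambda>A. P (J A))"
      using P(1) unfolding completely_bounded_def vals2 clinear_on_def by (simp add: Jadd Jscale)
    show "P (J A) = T A" if "A \<in> X" for A using P(2) T1 that by simp
    show "cb_norm Y (\<lambda>A. P (J A)) \<le> lam * cb_norm X T"
      using P(3) unfolding cb_norm_def vals1 vals2 .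
  qed
qed

section \<open>A separated sequence in a nonreflexive operator space\<close>

lemma dual_bdd_above:
  assumes f: "f \<in> dual V"
  shows "bdd_above ((\<lambda>x. cmod (f x)) ` {x \<in> V. norm x \<le> 1})"
proof -
  obtain K where K: "\<forall>x\<in>V. cmod (f x) \<le> K * norm x" using f by (auto simp: dual_def)
  show ?thesis
  proof (rule bdd_aboveI2)
    fix y assume "y \<in> {x \<in> V. norm x \<le> 1}"
    then have "cmod (f y) \<le> K * norm y" "norm y \<le> 1" using K by auto
    moreover have "K * norm y \<le> \<bar>K\<bar> * 1"
      using \<open>norm y \<le> 1\<close> by (intro mult_mono) auto
    ultimately show "cmod (f y) \<le> \<bar>K\<bar>" by linarith
  qed
qed

lemma dual_norm_nonneg:
  assumes V: "csubspace V" and f: "f \<in> dual V"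
  shows "0 \<le> dual_norm V f"
proof -
  have "cmod (f 0) \<le> dual_norm V f"
    unfolding dual_norm_def using csubspace_0[OF V] by (intro cSUP_upper dual_bdd_above f) simp
  then show ?thesis using norm_ge_zero order_trans by blast
qed

lemma dual_bound:
  assumes V: "csubspace V" and f: "f \<in> dual V" and x: "x \<in> V"
  shows "cmod (f x) \<le> dual_norm V f * norm x"
proof (cases "x = 0")
  case True
  obtain K where "\<forall>x\<in>V. cmod (f x) \<le> K * norm x" using f by (auto simp: dual_def)
  then show ?thesis using x True by auto
next
  case False
  have lin: "\<forall>c. \<forall>x\<in>V. f (c *\<^sub>C x) = c * f x" using f by (simp add: dual_def)
  have mem: "(1 / norm x) *\<^sub>R x \<in> {x \<in> V. norm x \<le> 1}"
    using False V x by (simp add: csubspace_scaleR)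
  have "cmod (f ((1 / norm x) *\<^sub>R x)) \<le> dual_norm V f"
    unfolding dual_norm_def using mem dual_bdd_above[OF f] by (rule cSUP_upper)
  moreover have "f ((1 / norm x) *\<^sub>R x) = of_real (1 / norm x) * f x"
    using lin x by (metis scaleC_of_real)
  ultimately show ?thesis using False by (simp add: norm_divide field_simps)
qed

lemma bidual_add: "\<Phi> \<in> bidual V \<Longrightarrow> f \<in> dual V \<Longrightarrow> g \<in> dual V \<Longrightarrow> \<Phi> (\<lambda>x. f x + g x) = \<Phi> f + \<Phi> g"
  and bidual_scale: "\<Phi> \<in> bidual V \<Longrightarrow> f \<in> dual V \<Longrightarrow> \<Phi> (\<lambda>x. c * f x) = c * \<Phi> f"
  by (simp_all add: bidual_def)

lemma dual_norm_le:
  assumes "csubspace V" "\<And>x. x \<in> V \<Longrightarrow> norm x \<le> 1 \<Longrightarrow> cmod (f x) \<le> K"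
  shows "dual_norm V f \<le> K"
  unfolding dual_norm_def using assms csubspace_0[OF assms(1)] by (intro cSUP_least) auto

lemma
  assumes "f \<in> dual V"
  shows dual_add: "x \<in> V \<Longrightarrow> y \<in> V \<Longrightarrow> f (x + y) = f x + f y"
    and dual_scaleC: "x \<in> V \<Longrightarrow> f (c *\<^sub>C x) = c * f x"
    and dual_scaleR: "x \<in> V \<Longrightarrow> f (r *\<^sub>R x) = r * f x"
  using assms by (auto simp: dual_def simp flip: scaleC_of_real)

lemma dual_diff:
  assumes "csubspace V" "f \<in> dual V" "x \<in> V" "y \<in> V"
  shows "f (x - y) = f x - f y"
  using dual_add[OF assms(2,3), of "-y"] dual_scaleR[OF assms(2,4), of "-1"] csubspace_minus[OF assms(1,4)]
  by simp

lemma dual_sum: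
  assumes "csubspace V" "finite G" "G \<subseteq> dual V" "\<Phi> \<in> bidual V"
  shows "(\<lambda>x. \<Sum>g\<in>G. w g * g x) \<in> dual V \<and> \<Phi> (\<lambda>x. \<Sum>g\<in>G. w g * g x) = (\<Sum>g\<in>G. w g * \<Phi> g)"
  using assms(2,3)
proof (induction G rule: finite_induct)
  case empty
  have z: "(\<lambda>x. 0) \<in> dual V" by (auto simp: dual_def intro!: exI[of _ 0])
  from bidual_scale[OF assms(4) z, of 0] z show ?case by simp
next
  case (insert g G)
  let ?s = "\<lambda>x. \<Sum>g\<in>G. w g * g x"
  have IH: "?s \<in> dual V" "\<Phi> ?s = (\<Sum>g\<in>G. w g * \<Phi> g)" and g: "g \<in> dual V" using insert by auto
  have wg: "(\<lambda>x. w g * g x) \<in> dual V"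
  proof -
    obtain K where "\<forall>x\<in>V. cmod (g x) \<le> K * norm x" using g by (auto simp: dual_def)
    then have "\<forall>x\<in>V. cmod (w g * g x) \<le> (cmod (w g) * K) * norm x"
      by (simp add: norm_mult mult.assoc mult_left_mono)
    then show ?thesis using g by (auto simp: dual_def algebra_simps intro!: exI[of _ "cmod (w g) * K"])
  qed
  have sum: "(\<lambda>x. w g * g x + ?s x) \<in> dual V"
  proof -
    obtain K L where "\<forall>x\<in>V. cmod (w g * g x) \<le> K * norm x" "\<forall>x\<in>V. cmod (?s x) \<le> L * norm x"
      using wg IH(1) unfolding dual_def by blast
    then have "\<forall>x\<in>V. cmod (w g * g x + ?s x) \<le> (K + L) * norm x"
      by (auto intro!: order_trans[OF norm_triangle_ineq] add_mono simp: distrib_right)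
    moreover have "\<forall>x. x \<notin> V \<longrightarrow> w g * g x + ?s x = 0" using wg IH(1) unfolding dual_def by simp
    moreover have "\<forall>x\<in>V. \<forall>y\<in>V. w g * g (x + y) + ?s (x + y) = (w g * g x + ?s x) + (w g * g y + ?s y)"
      by (simp add: dual_add[OF IH(1)] dual_add[OF wg])
    moreover have "\<forall>c. \<forall>x\<in>V. w g * g (c *\<^sub>C x) + ?s (c *\<^sub>C x) = c * (w g * g x + ?s x)"
      by (simp add: dual_scaleC[OF IH(1)] dual_scaleC[OF wg] distrib_left)
    ultimately show ?thesis unfolding dual_def by blast
  qed
  have "\<Phi> (\<lambda>x. w g * g x + ?s x) = \<Phi> (\<lambda>x. w g * g x) + \<Phi> ?s"
    by (rule bidual_add[OF assms(4) wg IH(1)])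
  moreover have "\<Phi> (\<lambda>x. w g * g x) = w g * \<Phi> g"
    by (rule bidual_scale[OF assms(4) g])
  ultimately show ?case using sum insert.hyps IH(2) by simp
qed

text \<open>
  Goldstine's theorem for finitely many functionals. If the distance were bounded below, the
  derivative of \<open>\<Sum> \<bar>g x - \<Phi> g\<bar>\<^sup>2\<close> at an almost minimal point \<open>x\<close> of the ball would be a combination \<open>f\<close> of
  the functionals for which \<open>\<Phi> f\<close> exceeds \<open>K\<close> times the norm of \<open>f\<close>.
\<close>

lemma Goldstine_finite:
  fixes V :: "'v::complex_normed_vector set"
  assumes V: "csubspace V" and \<Phi>: "\<Phi> \<in> bidual V" and K: "\<And>f. f \<in> dual V \<Longrightarrow> cmod (\<Phi> f) \<le> K * dual_norm V f"
    and "0 < K" and G: "finite G" "G \<subseteq> dual V" and "0 < \<delta>"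
  shows "\<exists>x\<in>V. norm x \<le> K \<and> (\<forall>g\<in>G. cmod (g x - \<Phi> g) \<le> \<delta>)"
proof (rule ccontr)
  assume none: "\<not> ?thesis"
  define S where "S = {x\<in>V. norm x \<le> K}"
  define q where "q x = (\<Sum>g\<in>G. (cmod (\<Phi> g - g x))\<^sup>2)" for x
  have "0 \<in> S" using V \<open>0 < K\<close> by (simp add: S_def csubspace_0)
  have q_ge: "\<delta>\<^sup>2 \<le> q x" if x: "x \<in> S" for x
  proof -
    obtain g where g: "g \<in> G" "\<delta> < cmod (g x - \<Phi> g)"
      using none x unfolding S_def by (auto simp: not_le)
    then have "\<delta>\<^sup>2 \<le> (cmod (\<Phi> g - g x))\<^sup>2" using \<open>0 < \<delta>\<close> by (intro power_mono) (auto simp: norm_minus_commute)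
    also have "\<dots> \<le> q x" unfolding q_def using g G(1) by (intro member_le_sum) auto
    finally show ?thesis .
  qed
  have bdd: "bdd_below (q ` S)" using q_ge by (intro bdd_belowI2) auto
  define m where "m = Inf (q ` S)"
  have m_le: "m \<le> q x" if "x \<in> S" for x unfolding m_def using bdd that by (intro cInf_lower) auto
  have "\<delta>\<^sup>2 \<le> m" unfolding m_def using \<open>0 \<in> S\<close> q_ge by (intro cInf_greatest) auto
  then have "0 < m" using \<open>0 < \<delta>\<close> by (meson less_le_trans zero_less_power)
  define B where "B = (\<Sum>g\<in>G. (dual_norm V g * (2 * K))\<^sup>2)"
  have "0 \<le> B" unfolding B_def by (intro sum_nonneg) auto
  \<comment> \<open>the step length: the quadratic error term \<open>t (1 + B) / 2\<close> must not exceed \<open>m / 2\<close>\<close>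
  define t where "t = min 1 (m / (1 + B))"
  have t: "0 < t" "t \<le> 1" and tm: "t \<le> m / (1 + B)"
    using \<open>0 < m\<close> \<open>0 \<le> B\<close> unfolding t_def by auto
  have t: "0 < t" "t \<le> 1" "t * (1 + B) \<le> m"
    using t tm \<open>0 \<le> B\<close> by (simp_all add: pos_le_divide_eq)
  obtain x where x: "x \<in> S" "q x < m + t\<^sup>2"
    using cInf_lessD[of "q ` S" "m + t\<^sup>2"] \<open>0 \<in> S\<close> t(1) unfolding m_def by auto
  have xV: "x \<in> V" using x(1) by (simp add: S_def)
  define w where "w g = cnj (\<Phi> g - g x)" for g
  define f where "f y = (\<Sum>g\<in>G. w g * g y)" for y
  have f: "f \<in> dual V" "\<Phi> f = (\<Sum>g\<in>G. w g * \<Phi> g)"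
    using dual_sum[OF V G \<Phi>, of w] unfolding f_def by auto
  have below: "Re (f y) \<le> Re (f x) + m / 2" if y: "y \<in> S" for y
  proof -
    have yV: "y \<in> V" using y by (simp add: S_def)
    have gd: "g \<in> dual V" if "g \<in> G" for g using that G(2) by blast
    have "norm ((1 - t) *\<^sub>R x + t *\<^sub>R y) \<le> (1 - t) * norm x + t * norm y"
      using t by (intro order_trans[OF norm_triangle_ineq]) auto
    also have "\<dots> \<le> (1 - t) * K + t * K"
      using x(1) y t unfolding S_def by (intro add_mono mult_left_mono) auto
    finally have "norm ((1 - t) *\<^sub>R x + t *\<^sub>R y) \<le> K" by (simp add: algebra_simps)
    then have "(1 - t) *\<^sub>R x + t *\<^sub>R y \<in> S"
      unfolding S_def using V xV yV by (simp add: csubspace_add csubspace_scaleR)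
    then have "m \<le> q ((1 - t) *\<^sub>R x + t *\<^sub>R y)" by (rule m_le)
    also have "\<dots> = (\<Sum>g\<in>G. (cmod (\<Phi> g - g x))\<^sup>2 - 2 * t * Re (w g * g (y - x)) + t\<^sup>2 * (cmod (g (y - x)))\<^sup>2)"
      unfolding q_def
    proof (intro sum.cong refl)
      fix g assume g: "g \<in> G"
      have e: "\<Phi> g - g ((1 - t) *\<^sub>R x + t *\<^sub>R y) = (\<Phi> g - g x) - t * g (y - x)"
      proof -
        have "g ((1 - t) *\<^sub>R x + t *\<^sub>R y) = of_real (1 - t) * g x + of_real t * g y"
          using V xV yV gd[OF g] by (simp only: dual_add dual_scaleR csubspace_scaleR)
        then show ?thesis using V xV yV gd[OF g] by (simp add: dual_diff algebra_simps)
      qed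
      have sq: "(cmod (a - of_real t * b))\<^sup>2 = (cmod a)\<^sup>2 - 2 * t * Re (cnj a * b) + t\<^sup>2 * (cmod b)\<^sup>2" for a b
        unfolding cmod_power2 by (simp add: power2_eq_square algebra_simps)
      show "(cmod (\<Phi> g - g ((1 - t) *\<^sub>R x + t *\<^sub>R y)))\<^sup>2
          = (cmod (\<Phi> g - g x))\<^sup>2 - 2 * t * Re (w g * g (y - x)) + t\<^sup>2 * (cmod (g (y - x)))\<^sup>2"
        unfolding e w_def by (rule sq)
    qed
    also have "\<dots> = q x - 2 * t * Re (f (y - x)) + t\<^sup>2 * (\<Sum>g\<in>G. (cmod (g (y - x)))\<^sup>2)"
      unfolding q_def f_def Re_sum by (simp only: sum.distrib sum_subtractf sum_distrib_left)
    also have "(\<Sum>g\<in>G. (cmod (g (y - x)))\<^sup>2) \<le> B"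
      unfolding B_def
    proof (intro sum_mono power_mono norm_ge_zero)
      fix g assume g: "g \<in> G"
      have "cmod (g (y - x)) \<le> dual_norm V g * norm (y - x)"
        using V xV yV gd[OF g] by (intro dual_bound csubspace_diff)
      moreover have "0 \<le> dual_norm V g" by (rule dual_norm_nonneg[OF V gd[OF g]])
      moreover have "norm (y - x) \<le> 2 * K"
        using x(1) y norm_triangle_ineq4[of y x] unfolding S_def by auto
      ultimately show "cmod (g (y - x)) \<le> dual_norm V g * (2 * K)"
        by (meson mult_left_mono order_trans)
    qed
    finally have "2 * t * Re (f (y - x)) \<le> t\<^sup>2 * (1 + B)"
      using x(2) t(1) by (simp add: algebra_simps)
    then have "2 * Re (f (y - x)) \<le> t * (1 + B)" using t(1) by (simp add: power2_eq_square)
    then show ?thesis using t(3) V f(1) xV yV by (simp add: dual_diff)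
  qed
  have "dual_norm V f \<le> (Re (f x) + m / 2) / K"
  proof (rule dual_norm_le[OF V])
    fix z assume z: "z \<in> V" "norm z \<le> 1"
    define u where "u = cnj (sgn (f z))"
    have "cmod u \<le> 1" unfolding u_def by (simp add: norm_sgn)
    have "K *\<^sub>R (u *\<^sub>C z) \<in> S"
      unfolding S_def using V z \<open>0 < K\<close> \<open>cmod u \<le> 1\<close> mult_mono[of "cmod u" 1 "norm z" 1]
      by (simp add: csubspace_scaleR csubspace_scaleC norm_scaleC)
    then have "Re (f (K *\<^sub>R (u *\<^sub>C z))) \<le> Re (f x) + m / 2" by (rule below)
    moreover have "f (K *\<^sub>R (u *\<^sub>C z)) = K * (u * f z)"
      using f(1) z V by (simp add: dual_scaleR dual_scaleC csubspace_scaleC)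
    moreover have "u * f z = cmod (f z)"
      unfolding u_def by (cases "f z = 0") (simp_all add: sgn_eq complex_norm_square[symmetric] power2_eq_square mult.commute)
    ultimately show "cmod (f z) \<le> (Re (f x) + m / 2) / K" using \<open>0 < K\<close> by (simp add: field_simps)
  qed
  then have "K * dual_norm V f \<le> Re (f x) + m / 2" using \<open>0 < K\<close> by (simp add: field_simps)
  moreover have "Re (\<Phi> f) \<le> K * dual_norm V f"
    using K[OF f(1)] complex_Re_le_cmod[of "\<Phi> f"] by linarith
  moreover have "Re (\<Phi> f) - Re (f x) = q x"
  proof -
    have "\<Phi> f - f x = (\<Sum>g\<in>G. w g * (\<Phi> g - g x))" unfolding f(2) by (simp add: f_def sum_subtractf right_diff_distrib)
    also have "\<dots> = of_real (q x)"
      unfolding q_def w_def of_real_sum by (intro sum.cong) (simp_all only: complex_norm_square mult.commute)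
    finally show ?thesis by (metis Re_complex_of_real minus_complex.sel(1))
  qed
  ultimately show False using m_le[OF x(1)] \<open>0 < m\<close> by linarith
qed

text \<open>
  Elements of the dual vanish off \<open>X\<close>. These functionals norm the operators in \<open>X\<close>.
\<close>

definition vector_functional ::
  "('k::complex_hilbert_space \<Rightarrow>\<^sub>L 'k) set \<Rightarrow> 'k \<Rightarrow> 'k \<Rightarrow> ('k \<Rightarrow>\<^sub>L 'k) \<Rightarrow> complex" where
  "vector_functional X p q A = (if A \<in> X then cinner p (A q) else 0)"

lemma cmod_cinner_blinfun_le: "cmod (cinner p (A q)) \<le> norm p * norm q * norm A"
  for A :: "'a::real_normed_vector \<Rightarrow>\<^sub>L 'b::complex_hilbert_space"
  using order_trans[OF Cauchy_Schwarz_cinner mult_left_mono[OF norm_blinfun norm_ge_zero]]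
  by (simp add: ac_simps)

lemma
  assumes X: "csubspace X"
  shows vector_functional_dual: "vector_functional X p q \<in> dual X"
    and vector_functional_norm: "dual_norm X (vector_functional X p q) \<le> norm p * norm q"
proof -
  show "vector_functional X p q \<in> dual X"
    unfolding dual_def vector_functional_def
    using X cmod_cinner_blinfun_le[of p _ q]
    by (auto simp: csubspace_add csubspace_scaleC blinfun.add_left cinner_simps intro!: exI[of _ "norm p * norm q"])
  show "dual_norm X (vector_functional X p q) \<le> norm p * norm q"
  proof (rule dual_norm_le[OF X])
    fix A assume A: "A \<in> X" "norm A \<le> 1"
    have "norm p * norm q * norm A \<le> norm p * norm q * 1" using A(2) by (intro mult_left_mono) auto
    then show "cmod (vector_functional X p q A) \<le> norm p * norm q"
      using cmod_cinner_blinfun_le[of p A q] A(1) by (simp add: vector_functional_def)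
  qed
qed

lemma blinfun_norm_attains:
  fixes A :: "'a::complex_hilbert_space \<Rightarrow>\<^sub>L 'b::complex_hilbert_space"
  assumes "t < norm A"
  shows "\<exists>p q. norm p \<le> 1 \<and> norm q \<le> 1 \<and> t < Re (cinner p (A q))"
proof (cases "t < 0")
  case True
  then show ?thesis by (intro exI[of _ 0]) simp
next
  case False
  obtain q where q: "t * norm q < norm (A q)"
    using norm_blinfun_bound[of t A] assms False by (meson not_le)
  have "q \<noteq> 0" using q by auto
  define p where "p = (1 / norm (A q)) *\<^sub>R A q"
  have pos: "0 < norm (A q)" using q False by (smt (verit) mult_nonneg_nonneg norm_ge_zero)
  have "norm p \<le> 1" unfolding p_def by simp
  moreover have "norm ((1 / norm q) *\<^sub>R q) \<le> 1" by simp
  moreover have "Re (cinner p (A ((1 / norm q) *\<^sub>R q))) = norm (A q) / norm q"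
    unfolding p_def using pos by (simp add: blinfun.bilinear_simps cinner_simps power2_eq_square)
  moreover have "t < norm (A q) / norm q" using q \<open>q \<noteq> 0\<close> by (simp add: field_simps)
  ultimately show ?thesis by metis
qed

text \<open>
  Approximants of \<open>\<Phi>\<close> in \<open>X\<close> would form a Cauchy sequence, vector functionals being norming, and its limit would represent \<open>\<Phi>\<close>.
\<close>

lemma bidual_distance:
  fixes X :: "('k::complex_hilbert_space \<Rightarrow>\<^sub>L 'k) set"
  assumes X: "csubspace X" "closed X" and \<Phi>: "\<Phi> \<in> bidual X" and out: "\<not> (\<exists>x\<in>X. \<forall>f\<in>dual X. \<Phi> f = f x)"
  shows "\<exists>\<theta>>0. \<forall>u\<in>X. \<exists>g\<in>dual X. dual_norm X g \<le> 1 \<and> \<theta> < cmod (\<Phi> g - g u)"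
proof (rule ccontr)
  assume no: "\<not> ?thesis"
  have "\<exists>u\<in>X. \<forall>g\<in>dual X. dual_norm X g \<le> 1 \<longrightarrow> cmod (\<Phi> g - g u) \<le> 1 / real (Suc n)" for n
  proof -
    have "0 < 1 / real (Suc n)" by simp
    then show ?thesis using no by (meson not_le)
  qed
  then obtain u where u: "\<And>n. u n \<in> X"
    "\<And>n g. g \<in> dual X \<Longrightarrow> dual_norm X g \<le> 1 \<Longrightarrow> cmod (\<Phi> g - g (u n)) \<le> 1 / real (Suc n)" by metis
  have close: "norm (u m - u n) \<le> 1 / real (Suc m) + 1 / real (Suc n)" for m n
  proof (rule ccontr)
    assume "\<not> ?thesis"
    then obtain p q where pq: "norm p \<le> 1" "norm q \<le> 1"
      "1 / real (Suc m) + 1 / real (Suc n) < Re (cinner p ((u m - u n) q))"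
      using blinfun_norm_attains[of "1 / real (Suc m) + 1 / real (Suc n)" "u m - u n"] by auto
    let ?g = "vector_functional X p q"
    have g: "?g \<in> dual X" "dual_norm X ?g \<le> 1"
      using vector_functional_dual[OF X(1)] vector_functional_norm[OF X(1), of p q] pq
        mult_mono[of "norm p" 1 "norm q" 1] by auto
    have "?g (u m) - ?g (u n) = cinner p ((u m - u n) q)"
      using u(1) by (simp add: vector_functional_def blinfun.diff_left cinner_simps)
    then have "cinner p ((u m - u n) q) = (\<Phi> ?g - ?g (u n)) - (\<Phi> ?g - ?g (u m))" by simp
    then have "Re (cinner p ((u m - u n) q)) \<le> cmod ((\<Phi> ?g - ?g (u n)) - (\<Phi> ?g - ?g (u m)))"
      by (metis complex_Re_le_cmod)
    also have "\<dots> \<le> cmod (\<Phi> ?g - ?g (u n)) + cmod (\<Phi> ?g - ?g (u m))" by (rule norm_triangle_ineq4)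
    also have "\<dots> \<le> 1 / real (Suc n) + 1 / real (Suc m)"
      by (intro add_mono u(2)[OF g])
    finally show False using pq(3) by simp
  qed
  have lim0: "(\<lambda>n. 1 / real (Suc n)) \<longlonglongrightarrow> 0" using LIMSEQ_inverse_real_of_nat by (simp add: inverse_eq_divide)
  have "Cauchy u"
  proof (rule metric_CauchyI)
    fix e :: real assume "0 < e"
    then obtain N where N: "inverse (real (Suc N)) < e / 2" using reals_Archimedean[of "e / 2"] by auto
    have "dist (u m) (u n) < e" if "N \<le> m" "N \<le> n" for m n
    proof -
      have "1 / real (Suc m) \<le> inverse (real (Suc N))" "1 / real (Suc n) \<le> inverse (real (Suc N))"
        using that by (auto simp: field_simps)
      then show ?thesis using close[of m n] N by (simp add: dist_norm)
    qed
    then show "\<exists>M. \<forall>m\<ge>M. \<forall>n\<ge>M. dist (u m) (u n) < e" by blast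
  qed
  then obtain x where x: "u \<longlonglongrightarrow> x" using Cauchy_convergent convergent_def by blast
  have xX: "x \<in> X" using closed_sequentially[OF X(2) u(1) x] .
  have ball: "\<Phi> g = g x" if g: "g \<in> dual X" "dual_norm X g \<le> 1" for g
  proof -
    have "(\<lambda>n. g (u n) - \<Phi> g) \<longlonglongrightarrow> 0"
      by (rule Lim_null_comparison[OF _ lim0])
        (use u(2)[OF g] in \<open>auto intro!: always_eventually simp: norm_minus_commute\<close>)
    then have 1: "(\<lambda>n. g (u n)) \<longlonglongrightarrow> \<Phi> g" by (rule LIM_zero_cancel)
    have "(\<lambda>n. g (u n) - g x) \<longlonglongrightarrow> 0"
    proof (rule Lim_null_comparison)
      show "\<forall>\<^sub>F n in sequentially. cmod (g (u n) - g x) \<le> dual_norm X g * norm (u n - x)"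
        using dual_bound[OF X(1) g(1) csubspace_diff[OF X(1) u(1) xX]]
        by (intro always_eventually allI) (simp add: dual_diff[OF X(1) g(1) u(1) xX])
      show "(\<lambda>n. dual_norm X g * norm (u n - x)) \<longlonglongrightarrow> 0"
        using tendsto_mult_left[OF tendsto_norm_zero[OF LIM_zero[OF x]], of "dual_norm X g"] by simp
    qed
    then have 2: "(\<lambda>n. g (u n)) \<longlonglongrightarrow> g x" by (rule LIM_zero_cancel)
    show ?thesis using LIMSEQ_unique[OF 1 2] .
  qed
  have "\<Phi> f = f x" if f: "f \<in> dual X" for f
  proof -
    define c where "c = \<bar>dual_norm X f\<bar> + 1"
    have c: "0 < c" unfolding c_def by simp
    let ?g = "\<lambda>x. of_real (1 / c) * f x"
    have g: "?g \<in> dual X" "\<Phi> ?g = of_real (1 / c) * \<Phi> f"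
      using dual_sum[of X "{f}" \<Phi> "\<lambda>_. of_real (1 / c)"] X(1) \<Phi> f by auto
    have "dual_norm X ?g \<le> 1"
    proof (rule dual_norm_le[OF X(1)])
      fix y assume y: "y \<in> X" "norm y \<le> 1"
      have "cmod (f y) \<le> dual_norm X f * norm y" by (rule dual_bound[OF X(1) f y(1)])
      also have "\<dots> \<le> c * 1" using y(2) unfolding c_def by (intro mult_mono) auto
      finally show "cmod (?g y) \<le> 1" using c by (simp add: norm_mult norm_divide)
    qed
    from ball[OF g(1) this] have "of_real (1 / c) * \<Phi> f = of_real (1 / c) * f x" unfolding g(2) .
    then show ?thesis using c by simp
  qed
  then show False using out xX by blast
qed

text \<open>
  The geometric form of nonreflexivity due to James. With \<open>\<Phi>\<close> at distance more than \<open>\<theta>\<close> from \<open>X\<close>, finitely many functionals separate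
  \<open>\<Phi>\<close> from the compact hull of the points chosen so far. By Goldstine's theorem all later points can be chosen to imitate \<open>\<Phi>\<close>
  on these functionals, and then so do their convex combinations.
\<close>

lemma nonreflexive_separated_sequence:
  fixes X :: "('k::complex_hilbert_space \<Rightarrow>\<^sub>L 'k) set"
  assumes X: "csubspace X" "closed X" and nr: "\<not> reflexive X"
  shows "\<exists>x \<theta>. 0 < \<theta> \<and> (\<forall>k::nat. x k \<in> X \<and> norm (x k) \<le> 1) \<and>
    (\<forall>n. \<forall>u\<in>convex hull (x ` {..<n}). \<forall>v\<in>convex hull (x ` {n..}). \<theta> \<le> norm (v - u))"
proof -
  obtain \<Phi> where \<Phi>: "\<Phi> \<in> bidual X" and out: "\<not> (\<exists>x\<in>X. \<forall>f\<in>dual X. \<Phi> f = f x)"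
    using nr unfolding reflexive_def by blast
  obtain \<theta> where "0 < \<theta>" and \<theta>: "\<And>u. u \<in> X \<Longrightarrow> \<exists>g\<in>dual X. dual_norm X g \<le> 1 \<and> \<theta> < cmod (\<Phi> g - g u)"
    using bidual_distance[OF X \<Phi> out] by blast
  obtain K0 where K0: "\<forall>f\<in>dual X. cmod (\<Phi> f) \<le> K0 * dual_norm X f"
    using \<Phi> unfolding bidual_def by blast
  define K where "K = \<bar>K0\<bar> + 1"
  have K: "cmod (\<Phi> f) \<le> K * dual_norm X f" if "f \<in> dual X" for f
  proof -
    have "0 \<le> dual_norm X f" by (rule dual_norm_nonneg[OF X(1) that])
    then have "K0 * dual_norm X f \<le> K * dual_norm X f" unfolding K_def by (intro mult_right_mono) auto
    then show ?thesis using K0 that by fastforce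
  qed
  have "0 < K" unfolding K_def by simp
  have hullX: "convex hull S \<subseteq> X" if "S \<subseteq> X" for S
    using that by (rule hull_minimal) (auto simp: convex_def csubspace_add csubspace_scaleR X)
  define P where "P s \<longleftrightarrow> (case s of (S, G, x) \<Rightarrow> finite S \<and> S \<subseteq> X \<and> finite G \<and> G \<subseteq> dual X \<and>
      x \<in> X \<and> norm x \<le> K \<and> (\<forall>g\<in>G. cmod (g x - \<Phi> g) \<le> \<theta> / 4))"
    for s :: "('k \<Rightarrow>\<^sub>L 'k) set \<times> (('k \<Rightarrow>\<^sub>L 'k) \<Rightarrow> complex) set \<times> ('k \<Rightarrow>\<^sub>L 'k)"
  define Q where "Q s s' \<longleftrightarrow> (case s of (S, G, x) \<Rightarrow> case s' of (S', G', x') \<Rightarrow>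
      S' = insert x S \<and> G \<subseteq> G' \<and> (\<forall>u\<in>convex hull S'. \<exists>g\<in>G'. dual_norm X g \<le> 1 \<and> 3 * \<theta> / 4 \<le> cmod (\<Phi> g - g u)))"
    for s s' :: "('k \<Rightarrow>\<^sub>L 'k) set \<times> (('k \<Rightarrow>\<^sub>L 'k) \<Rightarrow> complex) set \<times> ('k \<Rightarrow>\<^sub>L 'k)"
  have step: "\<exists>s'. P s' \<and> Q s s'" if "P s" for s
  proof -
    obtain S G x where s: "s = (S, G, x)" by (cases s)
    have S: "finite (insert x S)" "insert x S \<subseteq> X" and G: "finite G" "G \<subseteq> dual X"
      using that unfolding P_def s by auto
    obtain N where N: "finite N" "N \<subseteq> convex hull (insert x S)" "convex hull (insert x S) \<subseteq> (\<Union>y\<in>N. ball y (\<theta> / 4))"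
      using seq_compact_imp_totally_bounded[OF compact_imp_seq_compact[OF finite_imp_compact_convex_hull[OF S(1)]], rule_format, of "\<theta> / 4"] \<open>0 < \<theta>\<close>
      by auto
    have NX: "y \<in> X" if "y \<in> N" for y using that N(2) hullX[OF S(2)] by blast
    obtain h where h: "\<And>u. u \<in> X \<Longrightarrow> h u \<in> dual X \<and> dual_norm X (h u) \<le> 1 \<and> \<theta> < cmod (\<Phi> (h u) - h u u)"
      using \<theta> by metis
    define G' where "G' = G \<union> h ` N"
    have G': "finite G'" "G' \<subseteq> dual X" unfolding G'_def using G N(1) h NX by auto
    obtain x' where x': "x' \<in> X" "norm x' \<le> K" "\<forall>g\<in>G'. cmod (g x' - \<Phi> g) \<le> \<theta> / 4"
      using Goldstine_finite[OF X(1) \<Phi> K \<open>0 < K\<close> G', of "\<theta> / 4"] \<open>0 < \<theta>\<close> by auto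
    have "\<exists>g\<in>G'. dual_norm X g \<le> 1 \<and> 3 * \<theta> / 4 \<le> cmod (\<Phi> g - g u)" if u: "u \<in> convex hull (insert x S)" for u
    proof -
      obtain y where y: "y \<in> N" "dist y u < \<theta> / 4" using u N(3) by auto
      let ?g = "h y"
      have uX: "u \<in> X" using u hullX[OF S(2)] by blast
      have g: "?g \<in> dual X" "dual_norm X ?g \<le> 1" "\<theta> < cmod (\<Phi> ?g - ?g y)" using h NX[OF y(1)] by auto
      have "cmod (?g u - ?g y) \<le> dual_norm X ?g * norm (u - y)"
        using dual_bound[OF X(1) g(1) csubspace_diff[OF X(1) uX NX[OF y(1)]]] dual_diff[OF X(1) g(1) uX NX[OF y(1)]] by simp
      also have "\<dots> \<le> 1 * norm (u - y)" using g(2) by (intro mult_right_mono) auto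
      also have "\<dots> \<le> \<theta> / 4" using y(2) by (simp add: dist_norm norm_minus_commute)
      finally have "3 * \<theta> / 4 \<le> cmod (\<Phi> ?g - ?g u)"
        using g(3) norm_triangle_ineq[of "\<Phi> ?g - ?g u" "?g u - ?g y"] by simp
      then show ?thesis using g(2) y(1) unfolding G'_def by blast
    qed
    then show ?thesis
      using S G' x' unfolding P_def Q_def s by (intro exI[of _ "(insert x S, G', x')"]) (auto simp: G'_def)
  qed
  have "\<exists>s. P s" using X(1) \<open>0 < K\<close> unfolding P_def
    by (intro exI[of _ "({}, {}, 0)"]) (simp add: csubspace_0)
  then obtain s where s: "\<And>n. P (s n)" "\<And>n. Q (s n) (s (Suc n))"
    using dependent_nat_choice[of "\<lambda>_. P" "\<lambda>_. Q"] step by metis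
  define S where "S n = fst (s n)" for n
  define G where "G n = fst (snd (s n))" for n
  define x where "x n = snd (snd (s n))" for n
  have sn: "s n = (S n, G n, x n)" for n by (simp add: S_def G_def x_def)
  have Pn: "G n \<subseteq> dual X" "x n \<in> X" "norm (x n) \<le> K" "\<And>g. g \<in> G n \<Longrightarrow> cmod (g (x n) - \<Phi> g) \<le> \<theta> / 4" for n
    using s(1)[of n] unfolding sn P_def by auto
  have Qn: "S (Suc n) = insert (x n) (S n)" "G n \<subseteq> G (Suc n)"
    "\<And>u. u \<in> convex hull (S (Suc n)) \<Longrightarrow> \<exists>g\<in>G (Suc n). dual_norm X g \<le> 1 \<and> 3 * \<theta> / 4 \<le> cmod (\<Phi> g - g u)" for n
    using s(2)[of n] unfolding sn Q_def by auto
  have Gmono: "G m \<subseteq> G n" if "m \<le> n" for m n using that Qn(2) by (rule lift_Suc_mono_le[rotated])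
  have xS: "x ` {..<n} \<subseteq> S n" for n
    by (induction n) (auto simp: lessThan_Suc Qn(1))
  have sep: "\<theta> / 2 \<le> norm (v - u)" if u: "u \<in> convex hull (x ` {..<n})" and v: "v \<in> convex hull (x ` {n..})" for n u v
  proof (cases n)
    case 0
    then show ?thesis using u by simp
  next
    case (Suc m)
    have "u \<in> convex hull (S n)" using u hull_mono[OF xS] by blast
    then obtain g where g: "g \<in> G n" "dual_norm X g \<le> 1" "3 * \<theta> / 4 \<le> cmod (\<Phi> g - g u)"
      using Qn(3) unfolding Suc by blast
    have gd: "g \<in> dual X" using g(1) Pn(1) by blast
    have uX: "u \<in> X" using u hullX[of "x ` {..<n}"] Pn(2) by blast
    have vX: "v \<in> X" using v hullX[of "x ` {n..}"] Pn(2) by blast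
    have "convex {y \<in> X. cmod (g y - \<Phi> g) \<le> \<theta> / 4}"
    proof (rule convexI)
      fix y z and a b :: real
      assume y: "y \<in> {y \<in> X. cmod (g y - \<Phi> g) \<le> \<theta> / 4}" and z: "z \<in> {y \<in> X. cmod (g y - \<Phi> g) \<le> \<theta> / 4}"
        and ab: "0 \<le> a" "0 \<le> b" "a + b = 1"
      have "g (a *\<^sub>R y + b *\<^sub>R z) - \<Phi> g = a * g y + b * g z - of_real (a + b) * \<Phi> g"
        using y z X(1) gd by (simp add: dual_add dual_scaleR csubspace_scaleR ab(3))
      also have "\<dots> = a * (g y - \<Phi> g) + b * (g z - \<Phi> g)" by (simp add: algebra_simps)
      finally have "cmod (g (a *\<^sub>R y + b *\<^sub>R z) - \<Phi> g) \<le> a * cmod (g y - \<Phi> g) + b * cmod (g z - \<Phi> g)"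
        using norm_triangle_ineq[of "a * (g y - \<Phi> g)" "b * (g z - \<Phi> g)"] ab by (simp add: norm_mult)
      also have "\<dots> \<le> a * (\<theta> / 4) + b * (\<theta> / 4)" using y z ab by (intro add_mono mult_left_mono) auto
      also have "\<dots> = \<theta> / 4" using ab by (simp flip: distrib_right)
      finally show "a *\<^sub>R y + b *\<^sub>R z \<in> {y \<in> X. cmod (g y - \<Phi> g) \<le> \<theta> / 4}"
        using y z X(1) by (simp add: csubspace_add csubspace_scaleR)
    qed
    moreover have "x ` {n..} \<subseteq> {y \<in> X. cmod (g y - \<Phi> g) \<le> \<theta> / 4}"
      using Pn(2,4) Gmono g(1) by blast
    ultimately have "cmod (g v - \<Phi> g) \<le> \<theta> / 4" using hull_minimal v by blast
    then have "\<theta> / 2 \<le> cmod (g (v - u))"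
      using g(3) norm_triangle_ineq[of "g v - g u" "\<Phi> g - g v"] norm_minus_commute[of "\<Phi> g" "g v"]
      by (simp add: dual_diff[OF X(1) gd vX uX])
    also have "\<dots> \<le> dual_norm X g * norm (v - u)" by (rule dual_bound[OF X(1) gd csubspace_diff[OF X(1) vX uX]])
    also have "\<dots> \<le> 1 * norm (v - u)" using g(2) by (intro mult_right_mono) auto
    finally show ?thesis by simp
  qed
  define y where "y n = (1 / K) *\<^sub>R x n" for n
  have img: "convex hull (y ` I) = (\<lambda>z. (1 / K) *\<^sub>R z) ` (convex hull (x ` I))" for I
    unfolding y_def by (simp add: convex_hull_scaling[symmetric] image_image)
  show ?thesis
  proof (intro exI[of _ y] exI[of _ "\<theta> / 2 / K"] conjI allI ballI)
    show "0 < \<theta> / 2 / K" using \<open>0 < \<theta>\<close> \<open>0 < K\<close> by simp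
    show "y k \<in> X" "norm (y k) \<le> 1" for k
      using Pn(2,3)[of k] X(1) \<open>0 < K\<close> by (simp_all add: y_def csubspace_scaleR)
    fix n u v assume "u \<in> convex hull (y ` {..<n})" "v \<in> convex hull (y ` {n..})"
    then obtain u' v' where "u' \<in> convex hull (x ` {..<n})" "v' \<in> convex hull (x ` {n..})"
      "u = (1 / K) *\<^sub>R u'" "v = (1 / K) *\<^sub>R v'" unfolding img by blast
    then have "\<theta> / 2 \<le> norm (v' - u')" "norm (v - u) = norm (v' - u') / K"
      using sep \<open>0 < K\<close> by (auto simp flip: scaleR_diff_right)
    then show "\<theta> / 2 / K \<le> norm (v - u)"
      using divide_right_mono[of "\<theta> / 2" "norm (v' - u')" K] \<open>0 < K\<close> by simp
  qed
qed

section \<open>Averages which are small on both sides\<close>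

lemma parallelogram_law: "(norm (x + y))\<^sup>2 + (norm (x - y))\<^sup>2 = 2 * (norm x)\<^sup>2 + 2 * (norm (y::'a::complex_hilbert_space))\<^sup>2"
  by (simp add: norm_add_square norm_diff_square)

definition bounded_functional :: "('h::complex_hilbert_space \<Rightarrow>\<^sub>L 'h) set \<Rightarrow> real \<Rightarrow> (('h \<Rightarrow>\<^sub>L 'h) \<Rightarrow> complex) \<Rightarrow> bool" where
  "bounded_functional Y C \<phi> \<longleftrightarrow> (\<forall>a\<in>Y. \<forall>b\<in>Y. \<phi> (a + b) = \<phi> a + \<phi> b) \<and>
     (\<forall>c. \<forall>a\<in>Y. \<phi> (c *\<^sub>C a) = c * \<phi> a) \<and> (\<forall>a\<in>Y. cmod (\<phi> a) \<le> C * norm a)"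

definition functional_star :: "(('h::complex_hilbert_space \<Rightarrow>\<^sub>L 'h) \<Rightarrow> complex) \<Rightarrow> ('h \<Rightarrow>\<^sub>L 'h) \<Rightarrow> complex" where
  "functional_star \<phi> a = cnj (\<phi> (adj a))"

context cstar_algebra
begin

abbreviation unit_ball :: "('h \<Rightarrow>\<^sub>L 'h) set" where "unit_ball \<equiv> {b\<in>Y. norm b \<le> 1}"

text \<open>The norm of the functional \<open>b \<mapsto> \<phi> (a b)\<close>.\<close>

definition left_seminorm :: "(('h \<Rightarrow>\<^sub>L 'h) \<Rightarrow> complex) \<Rightarrow> ('h \<Rightarrow>\<^sub>L 'h) \<Rightarrow> real" where
  "left_seminorm \<phi> a = (SUP b\<in>unit_ball. cmod (\<phi> (a o\<^sub>L b)))"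

lemma
  assumes "bounded_functional Y C \<phi>"
  shows functional_add: "a \<in> Y \<Longrightarrow> b \<in> Y \<Longrightarrow> \<phi> (a + b) = \<phi> a + \<phi> b"
    and functional_scaleC: "a \<in> Y \<Longrightarrow> \<phi> (c *\<^sub>C a) = c * \<phi> a"
    and functional_scaleR: "a \<in> Y \<Longrightarrow> \<phi> (r *\<^sub>R a) = r * \<phi> a"
    and functional_bound: "a \<in> Y \<Longrightarrow> cmod (\<phi> a) \<le> C * norm a"
  using assms by (auto simp: bounded_functional_def simp flip: scaleC_of_real)

lemma functional_zero: "bounded_functional Y C \<phi> \<Longrightarrow> \<phi> 0 = 0"
  using functional_scaleR[OF _ zero_mem, of C \<phi> 0] by simp

lemma functional_diff: "bounded_functional Y C \<phi> \<Longrightarrow> a \<in> Y \<Longrightarrow> b \<in> Y \<Longrightarrow> \<phi> (a - b) = \<phi> a - \<phi> b"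
  using functional_add[of C \<phi> a "-b"] functional_scaleR[of C \<phi> b "-1"] csubspace_minus[OF csubspace, of b]
  by simp

lemma functional_sum:
  "bounded_functional Y C \<phi> \<Longrightarrow> (\<And>i. i \<in> I \<Longrightarrow> a i \<in> Y) \<Longrightarrow> \<phi> (\<Sum>i\<in>I. a i) = (\<Sum>i\<in>I. \<phi> (a i))"
  by (induction I rule: infinite_finite_induct) (auto simp: functional_zero functional_add sum_mem)

lemma bounded_functional_star: "bounded_functional Y C \<phi> \<Longrightarrow> bounded_functional Y C (functional_star \<phi>)"
  unfolding bounded_functional_def functional_star_def
  by (auto simp: adj_add adj_scale clin_mem adj_mem) (metis adj_mem clin_mem norm_adj_eq)

lemma norm_comp_le_1: "norm a \<le> 1 \<Longrightarrow> norm b \<le> 1 \<Longrightarrow> norm (a o\<^sub>L b) \<le> 1"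
  using order_trans[OF norm_blinfun_compose mult_mono[of "norm a" 1 "norm b" 1]] by auto

lemma left_seminorm_bdd:
  assumes \<phi>: "bounded_functional Y C \<phi>" and a: "a \<in> Y"
  shows "bdd_above ((\<lambda>b. cmod (\<phi> (a o\<^sub>L b))) ` unit_ball)"
proof (rule bdd_aboveI2)
  fix b assume b: "b \<in> unit_ball"
  have "cmod (\<phi> (a o\<^sub>L b)) \<le> C * norm (a o\<^sub>L b)" using functional_bound[OF \<phi>] comp_mem a b by blast
  also have "\<dots> \<le> \<bar>C\<bar> * (norm a * 1)"
    using b by (intro mult_mono order_trans[OF norm_blinfun_compose] mult_left_mono) auto
  finally show "cmod (\<phi> (a o\<^sub>L b)) \<le> \<bar>C\<bar> * (norm a * 1)" .
qed

lemma le_left_seminorm: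
  assumes "bounded_functional Y C \<phi>" "a \<in> Y" "b \<in> Y" "norm b \<le> 1"
  shows "cmod (\<phi> (a o\<^sub>L b)) \<le> left_seminorm \<phi> a"
  unfolding left_seminorm_def using assms by (intro cSUP_upper left_seminorm_bdd) auto

lemma left_seminorm_nonneg:
  assumes "bounded_functional Y C \<phi>" "a \<in> Y"
  shows "0 \<le> left_seminorm \<phi> a"
  using order_trans[OF norm_ge_zero le_left_seminorm[OF assms zero_mem]] by simp

lemma left_seminorm_scale:
  assumes \<phi>: "bounded_functional Y C \<phi>" and a: "a \<in> Y" and r: "0 < r"
  shows "r * left_seminorm \<phi> a \<le> left_seminorm \<phi> (r *\<^sub>R a)"
proof -
  have "left_seminorm \<phi> a \<le> left_seminorm \<phi> (r *\<^sub>R a) / r"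
    unfolding left_seminorm_def[of \<phi> a]
  proof (rule cSUP_least)
    show "unit_ball \<noteq> {}" using zero_mem by (auto intro!: exI[of _ 0])
    fix b assume b: "b \<in> unit_ball"
    have "(r *\<^sub>R a) o\<^sub>L b = r *\<^sub>R (a o\<^sub>L b)" by (rule blinfun_eqI) (simp add: blinfun.bilinear_simps)
    then have "r * cmod (\<phi> (a o\<^sub>L b)) = cmod (\<phi> ((r *\<^sub>R a) o\<^sub>L b))"
      using functional_scaleR[OF \<phi> comp_mem[OF a], of b r] b r by (simp add: norm_mult)
    also have "\<dots> \<le> left_seminorm \<phi> (r *\<^sub>R a)"
      using b by (intro le_left_seminorm[OF \<phi>] scaleR_mem a) auto
    finally show "cmod (\<phi> (a o\<^sub>L b)) \<le> left_seminorm \<phi> (r *\<^sub>R a) / r" using r by (simp add: field_simps)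
  qed
  then show ?thesis using r by (simp add: field_simps)
qed

text \<open>
  Put \<open>c\<^sub>i = \<phi> (a\<^sub>i b\<^sub>i)\<close> and evaluate \<open>\<phi>\<close> at \<open>\<Sum> cnj(c\<^sub>i) a\<^sub>i b\<^sub>i\<close>. This is the product of a row of norm at most 1 and of the column of
  the \<open>cnj(c\<^sub>i) b\<^sub>i\<close>, whose norm is at most \<open>(\<Sum> \<bar>c\<^sub>i\<bar>\<^sup>2)\<^sup>1\<^sup>/\<^sup>2\<close>.
\<close>

lemma functional_row_bound:
  assumes \<phi>: "bounded_functional Y C \<phi>" and "0 \<le> C"
    and a: "\<And>i. i < n \<Longrightarrow> a i \<in> Y" and row: "\<And>x. (\<Sum>i<n. (norm (adj (a i) x))\<^sup>2) \<le> (norm x)\<^sup>2"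
    and b: "\<And>i. i < n \<Longrightarrow> b i \<in> unit_ball"
  shows "(\<Sum>i<n. (cmod (\<phi> (a i o\<^sub>L b i)))\<^sup>2) \<le> C\<^sup>2"
proof -
  define c where "c i = \<phi> (a i o\<^sub>L b i)" for i
  define M where "M = (\<Sum>i<n. (cmod (c i))\<^sup>2)"
  define A where "A = (\<Sum>i<n. cnj (c i) *\<^sub>C (a i o\<^sub>L b i))"
  have mem: "a i o\<^sub>L b i \<in> Y" if "i < n" for i using a b that by (intro comp_mem) auto
  have "A \<in> Y" unfolding A_def using mem by (intro sum_mem scaleC_mem) auto
  have "0 \<le> M" unfolding M_def by (intro sum_nonneg) auto
  have "\<phi> A = (\<Sum>i<n. cnj (c i) * c i)"
    unfolding A_def using mem by (subst functional_sum[OF \<phi>]) (auto intro: scaleC_mem simp: functional_scaleC[OF \<phi>] c_def)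
  also have "\<dots> = of_real M" unfolding M_def of_real_sum by (intro sum.cong) (simp_all only: complex_norm_square mult.commute)
  finally have "M = cmod (\<phi> A)" using \<open>0 \<le> M\<close> by simp
  also have "\<dots> \<le> C * norm A" by (rule functional_bound[OF \<phi> \<open>A \<in> Y\<close>])
  also have "norm A \<le> sqrt M"
  proof (rule norm_blinfun_le_cinnerI)
    fix x y
    have "cinner x (A y) = (\<Sum>i<n. cnj (c i) * cinner (adj (a i) x) (b i y))"
      unfolding A_def blinfun.sum_left cinner_sum_right
      using a by (intro sum.cong) (simp_all add: cinner_simps cinner_adj' clin_mem)
    then have "cmod (cinner x (A y)) \<le> (\<Sum>i<n. cmod (c i) * (norm (adj (a i) x) * norm y))"
    proof (simp, intro sum_norm_le)
      fix i assume i: "i \<in> {..<n}"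
      have "norm (b i y) \<le> 1 * norm y"
        using b[of i] i by (intro order_trans[OF norm_blinfun] mult_right_mono) auto
      then show "cmod (cnj (c i) * cinner (adj (a i) x) (b i y)) \<le> cmod (c i) * (norm (adj (a i) x) * norm y)"
        using order_trans[OF Cauchy_Schwarz_cinner[of "adj (a i) x" "b i y"] mult_left_mono[of "norm (b i y)" "norm y"]]
        by (simp add: norm_mult mult_left_mono)
    qed
    also have "\<dots> = (\<Sum>i<n. \<bar>cmod (c i)\<bar> * \<bar>norm (adj (a i) x)\<bar>) * norm y"
      by (simp add: sum_distrib_right mult.assoc)
    also have "\<dots> \<le> L2_set (\<lambda>i. cmod (c i)) {..<n} * L2_set (\<lambda>i. norm (adj (a i) x)) {..<n} * norm y"
      by (intro mult_right_mono L2_set_mult_ineq norm_ge_zero)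
    also have "\<dots> \<le> sqrt M * norm x * norm y"
      unfolding M_def L2_set_def using row[of x]
      by (intro mult_right_mono mult_left_mono) (auto intro!: real_le_lsqrt sum_nonneg)
    finally show "cmod (cinner x (A y)) \<le> sqrt M * norm x * norm y" .
  qed (use \<open>0 \<le> M\<close> in simp)
  finally have "sqrt M * sqrt M \<le> C * sqrt M" using \<open>0 \<le> C\<close> \<open>0 \<le> M\<close> by (simp add: mult_left_mono)
  then have "sqrt M \<le> C" using \<open>0 \<le> C\<close> \<open>0 \<le> M\<close> by (cases "M = 0") (simp_all del: real_sqrt_mult_self)
  then have "M \<le> C\<^sup>2" using \<open>0 \<le> M\<close> by (metis real_sqrt_ge_zero real_sqrt_pow2 power_mono)
  then show ?thesis by (simp add: M_def c_def)
qed

text \<open>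
  The suprema in the seminorms need not be attained; the constant 4 pays for choosing arguments which reach half of them.
\<close>

lemma left_seminorm_row_bound:
  assumes \<phi>: "bounded_functional Y C \<phi>" and "0 \<le> C" and as: "set as \<subseteq> Y"
    and row: "\<And>x. (\<Sum>a\<leftarrow>as. (norm (adj a x))\<^sup>2) \<le> (norm x)\<^sup>2"
  shows "(\<Sum>a\<leftarrow>as. (left_seminorm \<phi> a)\<^sup>2) \<le> 4 * C\<^sup>2"
proof -
  have "\<exists>b\<in>unit_ball. left_seminorm \<phi> a \<le> 2 * cmod (\<phi> (a o\<^sub>L b))" if a: "a \<in> Y" for a
  proof (cases "left_seminorm \<phi> a = 0")
    case True
    then show ?thesis using zero_mem by (intro bexI[of _ 0]) auto
  next
    case False
    then have "left_seminorm \<phi> a / 2 < left_seminorm \<phi> a" using left_seminorm_nonneg[OF \<phi> a] by simp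
    moreover have "unit_ball \<noteq> {}" using zero_mem by (auto intro!: exI[of _ 0])
    ultimately obtain b where "b \<in> unit_ball" "left_seminorm \<phi> a / 2 < cmod (\<phi> (a o\<^sub>L b))"
      using less_cSUP_iff[OF _ left_seminorm_bdd[OF \<phi> a]] unfolding left_seminorm_def by blast
    then show ?thesis by (intro bexI[of _ b]) auto
  qed
  then obtain b where b: "\<And>a. a \<in> Y \<Longrightarrow> b a \<in> unit_ball \<and> left_seminorm \<phi> a \<le> 2 * cmod (\<phi> (a o\<^sub>L b a))" by metis
  have nth: "as ! i \<in> Y" if "i < length as" for i using as that by auto
  have "(\<Sum>a\<leftarrow>as. (left_seminorm \<phi> a)\<^sup>2) = (\<Sum>i<length as. (left_seminorm \<phi> (as ! i))\<^sup>2)"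
    by (simp add: sum_list_sum_nth atLeast0LessThan)
  also have "\<dots> \<le> (\<Sum>i<length as. 4 * (cmod (\<phi> (as ! i o\<^sub>L b (as ! i))))\<^sup>2)"
  proof (rule sum_mono)
    fix i assume "i \<in> {..<length as}"
    then have i: "as ! i \<in> Y" using nth by simp
    have "(left_seminorm \<phi> (as ! i))\<^sup>2 \<le> (2 * cmod (\<phi> (as ! i o\<^sub>L b (as ! i))))\<^sup>2"
      using b[OF i] left_seminorm_nonneg[OF \<phi> i] by (intro power_mono) auto
    then show "(left_seminorm \<phi> (as ! i))\<^sup>2 \<le> 4 * (cmod (\<phi> (as ! i o\<^sub>L b (as ! i))))\<^sup>2" by (simp add: power_mult_distrib)
  qed
  also have "\<dots> \<le> 4 * C\<^sup>2"
    unfolding sum_distrib_left[symmetric]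
    using functional_row_bound[OF \<phi> \<open>0 \<le> C\<close>, of "length as" "\<lambda>i. as ! i" "\<lambda>i. b (as ! i)"] row b nth
    by (simp add: sum_list_sum_nth atLeast0LessThan)
  finally show ?thesis .
qed

text \<open>
  Split a block of \<open>2\<^sup>L\<close> terms into halves, quarters and so on, and take half the difference of the means over each pair of
  neighbouring parts, weighted as in the Haar system. By the parallelogram law the resulting list is row and column bounded,
  whatever \<open>L\<close> is. If \<open>S\<close> exceeded \<open>\<epsilon>\<close> on all differences of successive means, each of the \<open>L\<close> levels would
  contribute at least \<open>\<epsilon> / 4\<close> to the sum of \<open>S\<close> over the list.
\<close>

lemma successive_averages:
  fixes S :: "('h \<Rightarrow>\<^sub>L 'h) \<Rightarrow> real"
  assumes x: "\<And>k::nat. x k \<in> Y" "\<And>k. norm (x k) \<le> 1"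
    and scale: "\<And>r a. 0 < r \<Longrightarrow> a \<in> Y \<Longrightarrow> r\<^sup>2 * S a \<le> S (r *\<^sub>R a)"
    and bound: "\<And>as. set as \<subseteq> Y \<Longrightarrow> (\<And>v. (\<Sum>a\<leftarrow>as. (norm (adj a v))\<^sup>2) \<le> (norm v)\<^sup>2) \<Longrightarrow>
      (\<And>v. (\<Sum>a\<leftarrow>as. (norm (blinfun_apply a v))\<^sup>2) \<le> (norm v)\<^sup>2) \<Longrightarrow> (\<Sum>a\<leftarrow>as. S a) \<le> B"
    and "0 < \<epsilon>"
  shows "\<exists>n. \<exists>u\<in>convex hull (x ` {..<n}). \<exists>v\<in>convex hull (x ` {n..}). S (v - u) \<le> \<epsilon>"
proof (rule ccontr)
  assume none: "\<not> ?thesis"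
  have big: "\<epsilon> < S (v - u)" if "u \<in> convex hull (x ` {..<n})" "v \<in> convex hull (x ` {n..})" for n u v
    using none that by (meson not_le)
  have hullY: "convex hull (x ` I) \<subseteq> Y" for I
    by (rule hull_minimal) (auto simp: convex_def x intro: add_mem scaleR_mem)
  have sub: "convex hull (x ` I) \<subseteq> convex hull (x ` I')" if "I \<subseteq> I'" for I I'
    by (intro hull_mono image_mono that)
  have half: "(norm ((1/2) *\<^sub>R (p - q)))\<^sup>2 + (norm ((1/2) *\<^sub>R (q + p)))\<^sup>2 = (norm q)\<^sup>2 / 2 + (norm p)\<^sup>2 / 2"
    for p q :: 'h
    using parallelogram_law[of q p] by (simp add: power_mult_distrib power_divide norm_minus_commute)
  \<comment> \<open>\<open>y\<close> is the mean over a block of length \<open>2\<^sup>L\<close> and \<open>as\<close> consists of the weighted half differences\<close>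
  have "\<exists>as n1 y. set as \<subseteq> Y \<and> y \<in> convex hull (x ` {n0..<n1}) \<and>
      (\<forall>v. (\<Sum>a\<leftarrow>as. (norm (adj a v))\<^sup>2) + (norm (adj y v))\<^sup>2 \<le> (norm v)\<^sup>2) \<and>
      (\<forall>v. (\<Sum>a\<leftarrow>as. (norm (blinfun_apply a v))\<^sup>2) + (norm (y v))\<^sup>2 \<le> (norm v)\<^sup>2) \<and>
      real L * (\<epsilon> / 4) \<le> (\<Sum>a\<leftarrow>as. S a)" for L n0
  proof (induction L arbitrary: n0)
    case 0
    have "norm (x n0 v) \<le> norm v" for v
      using norm_blinfun[of "x n0" v] mult_right_mono[OF x(2)[of n0], of "norm v"] by simp
    moreover have "norm (adj (x n0) v) \<le> norm v" for v
      using norm_blinfun[of "adj (x n0)" v] mult_right_mono[OF x(2)[of n0], of "norm v"]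
      by (simp add: norm_adj_eq clin_mem x)
    ultimately show ?case
      by (intro exI[of _ "[]"] exI[of _ "Suc n0"] exI[of _ "x n0"]) (auto intro!: hull_inc power_mono)
  next
    case (Suc L)
    obtain as n1 y where 1: "set as \<subseteq> Y" "y \<in> convex hull (x ` {n0..<n1})"
      "\<And>v. (\<Sum>a\<leftarrow>as. (norm (adj a v))\<^sup>2) + (norm (adj y v))\<^sup>2 \<le> (norm v)\<^sup>2"
      "\<And>v. (\<Sum>a\<leftarrow>as. (norm (blinfun_apply a v))\<^sup>2) + (norm (y v))\<^sup>2 \<le> (norm v)\<^sup>2"
      "real L * (\<epsilon> / 4) \<le> (\<Sum>a\<leftarrow>as. S a)" using Suc.IH by blast
    obtain as' n2 y' where 2: "set as' \<subseteq> Y" "y' \<in> convex hull (x ` {n1..<n2})"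
      "\<And>v. (\<Sum>a\<leftarrow>as'. (norm (adj a v))\<^sup>2) + (norm (adj y' v))\<^sup>2 \<le> (norm v)\<^sup>2"
      "\<And>v. (\<Sum>a\<leftarrow>as'. (norm (blinfun_apply a v))\<^sup>2) + (norm (y' v))\<^sup>2 \<le> (norm v)\<^sup>2"
      "real L * (\<epsilon> / 4) \<le> (\<Sum>a\<leftarrow>as'. S a)" using Suc.IH by blast
    define r where "r = 1 / sqrt 2"
    have r: "0 < r" "r\<^sup>2 = 1 / 2" unfolding r_def by (simp_all add: power_divide)
    define d where "d = (1/2) *\<^sub>R (y' - y)"
    define w where "w = (1/2) *\<^sub>R (y + y')"
    define bs where "bs = map (\<lambda>a. r *\<^sub>R a) (as @ as') @ [d]"
    have yY: "y \<in> Y" "y' \<in> Y" using 1(2) 2(2) hullY by blast+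
    have dY: "d \<in> Y" unfolding d_def using yY by (intro scaleR_mem diff_mem)
    have adjR: "adj (t *\<^sub>R a) = t *\<^sub>R adj a" if "a \<in> Y" for t a
      using adj_scale[OF clin_mem[OF that], of "of_real t"] by (simp add: scaleC_of_real)
    have "n1 > n0" using 1(2) by (cases "n0 < n1") auto
    have "n2 > n1" using 2(2) by (cases "n1 < n2") auto
    have "w \<in> convex hull (x ` {n0..<n2})"
    proof -
      have "y \<in> convex hull (x ` {n0..<n2})" using subsetD[OF sub 1(2)] \<open>n2 > n1\<close> by simp
      moreover have "y' \<in> convex hull (x ` {n0..<n2})" using subsetD[OF sub 2(2)] \<open>n1 > n0\<close> by simp
      ultimately have "(1/2) *\<^sub>R y + (1/2) *\<^sub>R y' \<in> convex hull (x ` {n0..<n2})"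
        by (intro convexD[OF convex_convex_hull]) auto
      then show ?thesis by (simp add: w_def scaleR_add_right)
    qed
    moreover have "set bs \<subseteq> Y" unfolding bs_def using 1(1) 2(1) dY by (auto intro: scaleR_mem)
    moreover have "(\<Sum>a\<leftarrow>bs. (norm (adj a v))\<^sup>2) + (norm (adj w v))\<^sup>2 \<le> (norm v)\<^sup>2" for v
    proof -
      have scaled: "(\<Sum>a\<leftarrow>cs. (norm (adj (r *\<^sub>R a) v))\<^sup>2) = (\<Sum>a\<leftarrow>cs. (norm (adj a v))\<^sup>2) / 2" if "set cs \<subseteq> Y" for cs
        using that by (induction cs) (auto simp: adjR blinfun.scaleR_left power_mult_distrib r field_simps)
      have "(norm (adj d v))\<^sup>2 + (norm (adj w v))\<^sup>2 = (norm (adj y v))\<^sup>2 / 2 + (norm (adj y' v))\<^sup>2 / 2"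
        using half[of "adj y' v" "adj y v"] yY
        by (simp add: d_def w_def adjR diff_mem add_mem adj_diff adj_add clin_mem blinfun.bilinear_simps)
      then show ?thesis
        using 1(3)[of v] 2(3)[of v] scaled[OF 1(1)] scaled[OF 2(1)] by (simp add: bs_def comp_def)
    qed
    moreover have "(\<Sum>a\<leftarrow>bs. (norm (blinfun_apply a v))\<^sup>2) + (norm (w v))\<^sup>2 \<le> (norm v)\<^sup>2" for v
    proof -
      have scaled: "(\<Sum>a\<leftarrow>cs. (norm (blinfun_apply (r *\<^sub>R a) v))\<^sup>2) = (\<Sum>a\<leftarrow>cs. (norm (blinfun_apply a v))\<^sup>2) / 2" for cs
        by (induction cs) (auto simp: blinfun.scaleR_left power_mult_distrib r field_simps)
      have "(norm (d v))\<^sup>2 + (norm (w v))\<^sup>2 = (norm (y v))\<^sup>2 / 2 + (norm (y' v))\<^sup>2 / 2"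
        using half[of "y' v" "y v"] by (simp add: d_def w_def blinfun.bilinear_simps)
      then show ?thesis
        using 1(4)[of v] 2(4)[of v] scaled[of as] scaled[of as'] by (simp add: bs_def comp_def)
    qed
    moreover have "real (Suc L) * (\<epsilon> / 4) \<le> (\<Sum>a\<leftarrow>bs. S a)"
    proof -
      have scaled: "(\<Sum>a\<leftarrow>cs. S a) / 2 \<le> (\<Sum>a\<leftarrow>cs. S (r *\<^sub>R a))" if "set cs \<subseteq> Y" for cs
        using that
      proof (induction cs)
        case (Cons a cs)
        then show ?case using scale[OF r(1), of a] by (simp add: r)
      qed simp
      have "\<epsilon> < S (y' - y)"
      proof (rule big)
        show "y \<in> convex hull (x ` {..<n1})" by (rule subsetD[OF sub 1(2)]) auto
        show "y' \<in> convex hull (x ` {n1..})" by (rule subsetD[OF sub 2(2)]) auto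
      qed
      then have "\<epsilon> / 4 \<le> S d"
        using scale[of "1/2" "y' - y"] yY by (simp add: d_def diff_mem power_divide)
      then show ?thesis
        using 1(5) 2(5) scaled[OF 1(1)] scaled[OF 2(1)] by (simp add: bs_def comp_def algebra_simps)
    qed
    ultimately show ?case by blast
  qed
  note claim = this
  obtain L :: nat where L: "B < real L * (\<epsilon> / 4)"
    using reals_Archimedean3[of "\<epsilon> / 4"] \<open>0 < \<epsilon>\<close> by (metis divide_pos_pos zero_less_numeral)
  obtain as n1 y where as: "set as \<subseteq> Y"
      "\<And>v. (\<Sum>a\<leftarrow>as. (norm (adj a v))\<^sup>2) + (norm (adj y v))\<^sup>2 \<le> (norm v)\<^sup>2"
      "\<And>v. (\<Sum>a\<leftarrow>as. (norm (blinfun_apply a v))\<^sup>2) + (norm (y v))\<^sup>2 \<le> (norm v)\<^sup>2"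
      "real L * (\<epsilon> / 4) \<le> (\<Sum>a\<leftarrow>as. S a)" using claim[of 0 L] by blast
  have "(\<Sum>a\<leftarrow>as. S a) \<le> B"
  proof (rule bound[OF as(1)])
    show "(\<Sum>a\<leftarrow>as. (norm (adj a v))\<^sup>2) \<le> (norm v)\<^sup>2" for v
      using as(2)[of v] zero_le_power2[of "norm (adj y v)"] by linarith
    show "(\<Sum>a\<leftarrow>as. (norm (blinfun_apply a v))\<^sup>2) \<le> (norm v)\<^sup>2" for v
      using as(3)[of v] zero_le_power2[of "norm (y v)"] by linarith
  qed
  then show False using as(4) L by linarith
qed

section \<open>Null sequences for countably many functionals\<close>

text \<open>
  The norms of the functionals \<open>c \<mapsto> \<phi> (b z\<^sub>k c)\<close>, respectively \<open>c \<mapsto> \<phi> (c z\<^sub>k b)\<close>, tend to 0 for every fixed \<open>b\<close>. The supremum over \<open>c\<close> is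
  what later allows arbitrary factors on the far side of \<open>z\<^sub>k\<close>.
\<close>

definition left_null :: "(('h \<Rightarrow>\<^sub>L 'h) \<Rightarrow> complex) \<Rightarrow> (nat \<Rightarrow> 'h \<Rightarrow>\<^sub>L 'h) \<Rightarrow> bool" where
  "left_null \<phi> z \<longleftrightarrow> (\<forall>b\<in>Y. \<forall>e>0. \<exists>k0. \<forall>k\<ge>k0. \<forall>c\<in>unit_ball. cmod (\<phi> (b o\<^sub>L (z k o\<^sub>L c))) \<le> e)"

definition right_null :: "(('h \<Rightarrow>\<^sub>L 'h) \<Rightarrow> complex) \<Rightarrow> (nat \<Rightarrow> 'h \<Rightarrow>\<^sub>L 'h) \<Rightarrow> bool" where
  "right_null \<phi> z \<longleftrightarrow> (\<forall>b\<in>Y. \<forall>e>0. \<exists>k0. \<forall>k\<ge>k0. \<forall>c\<in>unit_ball. cmod (\<phi> ((c o\<^sub>L z k) o\<^sub>L b)) \<le> e)"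

lemma functional_mult_left:
  assumes \<phi>: "bounded_functional Y C \<phi>" and b: "b \<in> Y" and "0 \<le> C"
  shows "bounded_functional Y (C * norm b) (\<lambda>a. \<phi> (b o\<^sub>L a))"
  unfolding bounded_functional_def
proof (intro conjI ballI allI)
  show "\<phi> (b o\<^sub>L (a + a')) = \<phi> (b o\<^sub>L a) + \<phi> (b o\<^sub>L a')" if "a \<in> Y" "a' \<in> Y" for a a'
  proof -
    have "b o\<^sub>L (a + a') = (b o\<^sub>L a) + (b o\<^sub>L a')" by (rule blinfun_eqI) (simp add: blinfun.bilinear_simps)
    then show ?thesis using functional_add[OF \<phi>] comp_mem b that by simp
  qed
  show "\<phi> (b o\<^sub>L (c *\<^sub>C a)) = c * \<phi> (b o\<^sub>L a)" if "a \<in> Y" for a c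
  proof -
    have "b o\<^sub>L (c *\<^sub>C a) = c *\<^sub>C (b o\<^sub>L a)" by (rule blinfun_eqI) (simp add: clin_scaleC clin_mem b)
    then show ?thesis using functional_scaleC[OF \<phi>] comp_mem b that by simp
  qed
  show "cmod (\<phi> (b o\<^sub>L a)) \<le> C * norm b * norm a" if "a \<in> Y" for a
    using order_trans[OF functional_bound[OF \<phi> comp_mem[OF b that]] mult_left_mono[OF norm_blinfun_compose \<open>0 \<le> C\<close>]]
    by (simp add: mult.assoc)
qed

lemma functional_mult_right:
  assumes \<phi>: "bounded_functional Y C \<phi>" and b: "b \<in> Y" and "0 \<le> C"
  shows "bounded_functional Y (C * norm b) (\<lambda>a. \<phi> (a o\<^sub>L b))"
  unfolding bounded_functional_def
proof (intro conjI ballI allI)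
  show "\<phi> ((a + a') o\<^sub>L b) = \<phi> (a o\<^sub>L b) + \<phi> (a' o\<^sub>L b)" if "a \<in> Y" "a' \<in> Y" for a a'
  proof -
    have "(a + a') o\<^sub>L b = (a o\<^sub>L b) + (a' o\<^sub>L b)" by (rule blinfun_eqI) (simp add: blinfun.bilinear_simps)
    then show ?thesis using functional_add[OF \<phi>] comp_mem b that by simp
  qed
  show "\<phi> ((c *\<^sub>C a) o\<^sub>L b) = c * \<phi> (a o\<^sub>L b)" if "a \<in> Y" for a c
  proof -
    have "(c *\<^sub>C a) o\<^sub>L b = c *\<^sub>C (a o\<^sub>L b)" by (rule blinfun_eqI) simp
    then show ?thesis using functional_scaleC[OF \<phi>] comp_mem b that by simp
  qed
  show "cmod (\<phi> (a o\<^sub>L b)) \<le> C * norm b * norm a" if "a \<in> Y" for a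
    using order_trans[OF functional_bound[OF \<phi> comp_mem[OF that b]] mult_left_mono[OF norm_blinfun_compose \<open>0 \<le> C\<close>]]
    by (simp add: ac_simps)
qed

text \<open>
  The sum of the squares of finitely many seminorms as above is admissible in the averaging argument, by the row bound; adjoints turn
  the seminorms on the right into seminorms on the left.
\<close>

lemma small_on_finitely_many:
  fixes I :: "'i set"
  assumes x: "\<And>k::nat. x k \<in> Y" "\<And>k. norm (x k) \<le> 1" and I: "finite I"
    and \<psi>: "\<And>i. i \<in> I \<Longrightarrow> bounded_functional Y (K i) (\<psi> i)" "\<And>i. i \<in> I \<Longrightarrow> bounded_functional Y (K i) (\<omega> i)"
    and K: "\<And>i. i \<in> I \<Longrightarrow> 0 \<le> K i" and "0 < \<epsilon>"
  shows "\<exists>n. \<exists>u\<in>convex hull (x ` {..<n}). \<exists>v\<in>convex hull (x ` {n..}). \<forall>i\<in>I. \<forall>c\<in>unit_ball.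
    cmod (\<psi> i ((v - u) o\<^sub>L c)) \<le> \<epsilon> \<and> cmod (\<omega> i (c o\<^sub>L (v - u))) \<le> \<epsilon>"
proof -
  define S where "S a = (\<Sum>i\<in>I. (left_seminorm (\<psi> i) a)\<^sup>2 + (left_seminorm (functional_star (\<omega> i)) (adj a))\<^sup>2)" for a
  note \<omega> = bounded_functional_star[OF \<psi>(2)]
  have adjR: "adj (t *\<^sub>R a) = t *\<^sub>R adj a" if "a \<in> Y" for t a
    using adj_scale[OF clin_mem[OF that], of "of_real t"] by (simp add: scaleC_of_real)
  have "\<exists>n. \<exists>u\<in>convex hull (x ` {..<n}). \<exists>v\<in>convex hull (x ` {n..}). S (v - u) \<le> \<epsilon>\<^sup>2"
  proof (rule successive_averages[OF x])
    show "r\<^sup>2 * S a \<le> S (r *\<^sub>R a)" if "0 < r" "a \<in> Y" for r a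
      unfolding S_def sum_distrib_left
    proof (rule sum_mono)
      fix i assume i: "i \<in> I"
      have "(r * left_seminorm (\<psi> i) a)\<^sup>2 \<le> (left_seminorm (\<psi> i) (r *\<^sub>R a))\<^sup>2"
        using that left_seminorm_nonneg[OF \<psi>(1)[OF i] that(2)]
        by (intro power_mono left_seminorm_scale[OF \<psi>(1)[OF i]]) auto
      moreover have "(r * left_seminorm (functional_star (\<omega> i)) (adj a))\<^sup>2 \<le> (left_seminorm (functional_star (\<omega> i)) (adj (r *\<^sub>R a)))\<^sup>2"
        unfolding adjR[OF that(2)]
        using that left_seminorm_nonneg[OF \<omega>[OF i] adj_mem[OF that(2)]]
        by (intro power_mono left_seminorm_scale[OF \<omega>[OF i]] adj_mem) auto
      ultimately show "r\<^sup>2 * ((left_seminorm (\<psi> i) a)\<^sup>2 + (left_seminorm (functional_star (\<omega> i)) (adj a))\<^sup>2)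
          \<le> (left_seminorm (\<psi> i) (r *\<^sub>R a))\<^sup>2 + (left_seminorm (functional_star (\<omega> i)) (adj (r *\<^sub>R a)))\<^sup>2"
        by (simp add: power_mult_distrib distrib_left)
    qed
    show "(\<Sum>a\<leftarrow>as. S a) \<le> (\<Sum>i\<in>I. 8 * (K i)\<^sup>2)"
      if as: "set as \<subseteq> Y" and row: "\<And>v. (\<Sum>a\<leftarrow>as. (norm (adj a v))\<^sup>2) \<le> (norm v)\<^sup>2"
        and col: "\<And>v. (\<Sum>a\<leftarrow>as. (norm (blinfun_apply a v))\<^sup>2) \<le> (norm v)\<^sup>2" for as
    proof -
      have "(\<Sum>a\<leftarrow>as. S a) = (\<Sum>i\<in>I. (\<Sum>a\<leftarrow>as. (left_seminorm (\<psi> i) a)\<^sup>2) +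
          (\<Sum>a\<leftarrow>map adj as. (left_seminorm (functional_star (\<omega> i)) a)\<^sup>2))"
        unfolding S_def by (induction as) (simp_all add: sum.distrib)
      also have "\<dots> \<le> (\<Sum>i\<in>I. 4 * (K i)\<^sup>2 + 4 * (K i)\<^sup>2)"
      proof (intro sum_mono add_mono)
        fix i assume i: "i \<in> I"
        show "(\<Sum>a\<leftarrow>as. (left_seminorm (\<psi> i) a)\<^sup>2) \<le> 4 * (K i)\<^sup>2"
          by (rule left_seminorm_row_bound[OF \<psi>(1)[OF i] K[OF i] as row])
        show "(\<Sum>a\<leftarrow>map adj as. (left_seminorm (functional_star (\<omega> i)) a)\<^sup>2) \<le> 4 * (K i)\<^sup>2"
        proof (rule left_seminorm_row_bound[OF \<omega>[OF i] K[OF i]])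
          show "set (map adj as) \<subseteq> Y" using as adj_mem by auto
          have "(\<Sum>a\<leftarrow>map adj as. (norm (adj a v))\<^sup>2) = (\<Sum>a\<leftarrow>as. (norm (blinfun_apply a v))\<^sup>2)" for v
            using as by (induction as) (auto simp: adj_adj clin_mem)
          then show "(\<Sum>a\<leftarrow>map adj as. (norm (adj a v))\<^sup>2) \<le> (norm v)\<^sup>2" for v using col by simp
        qed
      qed
      finally show ?thesis by simp
    qed
  qed (use \<open>0 < \<epsilon>\<close> in simp)
  then obtain n u v where uv: "u \<in> convex hull (x ` {..<n})" "v \<in> convex hull (x ` {n..})" "S (v - u) \<le> \<epsilon>\<^sup>2"
    by blast
  have hullY: "convex hull (x ` J) \<subseteq> Y" for J
    by (rule hull_minimal) (auto simp: convex_def x intro: add_mem scaleR_mem)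
  have dY: "v - u \<in> Y" using uv(1,2) hullY by (intro diff_mem) auto
  have "cmod (\<psi> i ((v - u) o\<^sub>L c)) \<le> \<epsilon> \<and> cmod (\<omega> i (c o\<^sub>L (v - u))) \<le> \<epsilon>"
    if i: "i \<in> I" and c: "c \<in> unit_ball" for i c
  proof -
    have "(left_seminorm (\<psi> i) (v - u))\<^sup>2 + (left_seminorm (functional_star (\<omega> i)) (adj (v - u)))\<^sup>2 \<le> S (v - u)"
      unfolding S_def using I i by (intro member_le_sum) auto
    then have "(left_seminorm (\<psi> i) (v - u))\<^sup>2 \<le> \<epsilon>\<^sup>2" "(left_seminorm (functional_star (\<omega> i)) (adj (v - u)))\<^sup>2 \<le> \<epsilon>\<^sup>2"
      using uv(3) zero_le_power2[of "left_seminorm (\<psi> i) (v - u)"]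
        zero_le_power2[of "left_seminorm (functional_star (\<omega> i)) (adj (v - u))"] by linarith+
    then have le: "left_seminorm (\<psi> i) (v - u) \<le> \<epsilon>" "left_seminorm (functional_star (\<omega> i)) (adj (v - u)) \<le> \<epsilon>"
      using \<open>0 < \<epsilon>\<close> by (auto intro: power2_le_imp_le)
    have "cmod (\<psi> i ((v - u) o\<^sub>L c)) \<le> left_seminorm (\<psi> i) (v - u)"
      using c by (intro le_left_seminorm[OF \<psi>(1)[OF i] dY]) auto
    moreover have "cmod (functional_star (\<omega> i) (adj (v - u) o\<^sub>L adj c)) \<le> left_seminorm (functional_star (\<omega> i)) (adj (v - u))"
      using c by (intro le_left_seminorm[OF \<omega>[OF i] adj_mem[OF dY]] adj_mem) (auto simp: norm_adj_eq clin_mem)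
    moreover have "functional_star (\<omega> i) (adj (v - u) o\<^sub>L adj c) = cnj (\<omega> i (c o\<^sub>L (v - u)))"
      unfolding functional_star_def using c dY by (simp add: adj_comp clin_mem adj_mem adj_adj)
    ultimately show ?thesis using le by simp
  qed
  then show ?thesis using uv by blast
qed

text \<open>
  The pairs \<open>(z\<^sub>i, \<phi>\<^sub>i)\<close> are chosen one after the other: \<open>z\<^sub>i\<close> is a difference of successive averages which is small for the previous
  functionals, tested against the first members of a dense sequence of \<open>Y\<close>, and \<open>\<phi>\<^sub>i\<close> is large at it.
\<close>

lemma null_differences:
  assumes D: "countable D" "D \<subseteq> Y" "Y \<subseteq> closure D"
    and x: "\<And>k::nat. x k \<in> Y" "\<And>k. norm (x k) \<le> 1" and "0 \<le> C"
    and norming: "\<And>n u v. u \<in> convex hull (x ` {..<n}) \<Longrightarrow> v \<in> convex hull (x ` {n..}) \<Longrightarrow>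
      \<exists>\<phi>. bounded_functional Y C \<phi> \<and> R \<phi> \<and> \<delta> \<le> Re (\<phi> (v - u))"
  shows "\<exists>z \<phi>. \<forall>i::nat. z i \<in> Y \<and> norm (z i) \<le> 1 \<and> bounded_functional Y C (\<phi> i) \<and> R (\<phi> i) \<and>
    \<delta> / 2 \<le> Re (\<phi> i (z i)) \<and> left_null (\<phi> i) z \<and> right_null (\<phi> i) z"
proof -
  have "D \<noteq> {}" using D(3) zero_mem by auto
  define b where "b = from_nat_into D"
  have bY: "b l \<in> Y" for l unfolding b_def using from_nat_into[OF \<open>D \<noteq> {}\<close>] D(2) by blast
  have hullY: "convex hull (x ` J) \<subseteq> {y \<in> Y. norm y \<le> 1}" for J
  proof (rule hull_minimal)
    have "{y \<in> Y. norm y \<le> 1} = Y \<inter> cball 0 1" by auto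
    moreover have "convex Y" by (auto simp: convex_def intro: add_mem scaleR_mem)
    ultimately show "convex {y \<in> Y. norm y \<le> 1}" by (simp add: convex_Int)
  qed (use x in auto)
  define P where "P f i r \<longleftrightarrow> fst r \<in> Y \<and> norm (fst r) \<le> 1 \<and> bounded_functional Y C (snd r) \<and> R (snd r) \<and>
      \<delta> / 2 \<le> Re (snd r (fst r)) \<and> (\<forall>j<i. \<forall>l\<le>i. \<forall>c\<in>unit_ball.
        cmod (snd (f j) (b l o\<^sub>L (fst r o\<^sub>L c))) \<le> 1 / 2 ^ i \<and> cmod (snd (f j) ((c o\<^sub>L fst r) o\<^sub>L b l)) \<le> 1 / 2 ^ i)"
    for f :: "nat \<Rightarrow> ('h \<Rightarrow>\<^sub>L 'h) \<times> (('h \<Rightarrow>\<^sub>L 'h) \<Rightarrow> complex)" and i r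
  have "\<exists>f. \<forall>i. P f i (f i)"
  proof (rule dependent_wellorder_choice)
    fix f g :: "nat \<Rightarrow> ('h \<Rightarrow>\<^sub>L 'h) \<times> (('h \<Rightarrow>\<^sub>L 'h) \<Rightarrow> complex)" and r and i :: nat assume "\<And>j. j < i \<Longrightarrow> f j = g j"
    then show "P f i r = P g i r" unfolding P_def by simp
  next
    fix i :: nat and f :: "nat \<Rightarrow> ('h \<Rightarrow>\<^sub>L 'h) \<times> (('h \<Rightarrow>\<^sub>L 'h) \<Rightarrow> complex)"
    assume IH: "\<And>j. j < i \<Longrightarrow> P f j (f j)"
    let ?I = "{..<i} \<times> {..i}"
    have bf: "bounded_functional Y C (snd (f j))" if "j < i" for j using IH[OF that] unfolding P_def by blast
    have "\<exists>n. \<exists>u\<in>convex hull (x ` {..<n}). \<exists>v\<in>convex hull (x ` {n..}). \<forall>p\<in>?I. \<forall>c\<in>unit_ball.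
        cmod ((\<lambda>a. snd (f (fst p)) (b (snd p) o\<^sub>L a)) ((v - u) o\<^sub>L c)) \<le> 1 / 2 ^ i \<and>
        cmod ((\<lambda>a. snd (f (fst p)) (a o\<^sub>L b (snd p))) (c o\<^sub>L (v - u))) \<le> 1 / 2 ^ i"
      using bf \<open>0 \<le> C\<close>
      by (intro small_on_finitely_many[OF x, where K = "\<lambda>p. C * norm (b (snd p))"]
            functional_mult_left functional_mult_right bY) auto
    then obtain n u v where uv: "u \<in> convex hull (x ` {..<n})" "v \<in> convex hull (x ` {n..})"
      and small: "\<And>j l c. j < i \<Longrightarrow> l \<le> i \<Longrightarrow> c \<in> unit_ball \<Longrightarrow> cmod (snd (f j) (b l o\<^sub>L ((v - u) o\<^sub>L c))) \<le> 1 / 2 ^ i \<and>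
        cmod (snd (f j) ((c o\<^sub>L (v - u)) o\<^sub>L b l)) \<le> 1 / 2 ^ i" by fastforce
    obtain \<phi> where \<phi>: "bounded_functional Y C \<phi>" "R \<phi>" "\<delta> \<le> Re (\<phi> (v - u))" using norming[OF uv] by blast
    have uvY: "u \<in> Y" "v \<in> Y" "norm u \<le> 1" "norm v \<le> 1" using uv hullY by blast+
    have dY: "v - u \<in> Y" using uvY by (intro diff_mem)
    define z where "z = (1/2) *\<^sub>R (v - u)"
    have zY: "z \<in> Y" unfolding z_def by (intro scaleR_mem dY)
    have "norm z \<le> 1" unfolding z_def using norm_triangle_ineq4[of v u] uvY by simp
    moreover have "\<delta> / 2 \<le> Re (\<phi> z)"
    proof -
      have e: "\<phi> z = of_real (1/2) * \<phi> (v - u)" unfolding z_def by (rule functional_scaleR[OF \<phi>(1) dY])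
      have "Re (of_real (1/2) * r) = Re r / 2" for r by simp
      then show ?thesis unfolding e using \<phi>(3) by simp
    qed
    moreover have "cmod (snd (f j) (b l o\<^sub>L (z o\<^sub>L c))) \<le> 1 / 2 ^ i \<and> cmod (snd (f j) ((c o\<^sub>L z) o\<^sub>L b l)) \<le> 1 / 2 ^ i"
      if j: "j < i" and l: "l \<le> i" and c: "c \<in> unit_ball" for j l c
    proof -
      have e: "b l o\<^sub>L (z o\<^sub>L c) = (1/2) *\<^sub>R (b l o\<^sub>L ((v - u) o\<^sub>L c))" "(c o\<^sub>L z) o\<^sub>L b l = (1/2) *\<^sub>R ((c o\<^sub>L (v - u)) o\<^sub>L b l)"
        unfolding z_def by (rule blinfun_eqI, simp add: blinfun.bilinear_simps)+
      have m: "b l o\<^sub>L ((v - u) o\<^sub>L c) \<in> Y" "(c o\<^sub>L (v - u)) o\<^sub>L b l \<in> Y" using bY dY c by (auto intro!: comp_mem)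
      have h: "cmod (snd (f j) ((1/2) *\<^sub>R a)) \<le> cmod (snd (f j) a)" if "a \<in> Y" for a
        unfolding functional_scaleR[OF bf[OF j] that] by (simp add: norm_mult)
      show ?thesis unfolding e using h[OF m(1)] h[OF m(2)] small[OF j l c] by linarith
    qed
    ultimately show "\<exists>r. P f i r" using zY \<phi> unfolding P_def by (intro exI[of _ "(z, \<phi>)"]) auto
  qed
  then obtain f where f: "\<And>i. P f i (f i)" by blast
  define z where "z i = fst (f i)" for i
  define \<phi> where "\<phi> i = snd (f i)" for i
  have zY: "z i \<in> Y" and nz: "norm (z i) \<le> 1" and bf: "bounded_functional Y C (\<phi> i)" and R: "R (\<phi> i)"
    and lower: "\<delta> / 2 \<le> Re (\<phi> i (z i))" for i
    using f[of i] unfolding P_def z_def \<phi>_def by auto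
  have small: "cmod (\<phi> j (b l o\<^sub>L (z i o\<^sub>L c))) \<le> 1 / 2 ^ i" "cmod (\<phi> j ((c o\<^sub>L z i) o\<^sub>L b l)) \<le> 1 / 2 ^ i"
    if "j < i" "l \<le> i" "c \<in> unit_ball" for i j l c
    using f[of i] that unfolding P_def z_def \<phi>_def by auto
  have null: "\<exists>k0. \<forall>k\<ge>k0. \<forall>c\<in>unit_ball. cmod (\<phi> i (a o\<^sub>L (z k o\<^sub>L c))) \<le> e \<and> cmod (\<phi> i ((c o\<^sub>L z k) o\<^sub>L a)) \<le> e"
    if a: "a \<in> Y" and "0 < e" for i a e
  proof -
    define d where "d = e / (2 * (C + 1))"
    have d: "0 < d" "C * d \<le> e / 2" unfolding d_def using \<open>0 < e\<close> \<open>0 \<le> C\<close> by (auto simp: field_simps)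
    obtain q where q: "q \<in> D" "dist q a < d" using D(3) a d(1) closure_approachable[of a D] by blast
    obtain l where l: "b l = q" unfolding b_def using from_nat_into_surj[OF D(1) q(1)] by blast
    have near: "norm (a - b l) \<le> d" using q(2) unfolding l by (simp add: dist_norm norm_minus_commute)
    obtain N where N: "(1/2) ^ N < e / 2" using real_arch_pow_inv[of "e / 2" "1/2"] \<open>0 < e\<close> by auto
    have "cmod (\<phi> i (a o\<^sub>L (z k o\<^sub>L c))) \<le> e \<and> cmod (\<phi> i ((c o\<^sub>L z k) o\<^sub>L a)) \<le> e"
      if k: "max (Suc i) (max l N) \<le> k" and c: "c \<in> unit_ball" for k c
    proof -
      have pw: "1 / 2 ^ k \<le> e / 2"
      proof -
        have "(1/2 :: real) ^ k \<le> (1/2) ^ N" using k by (intro power_decreasing) auto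
        then show ?thesis using N by (simp add: power_one_over)
      qed
      have zc: "z k o\<^sub>L c \<in> Y" "norm (z k o\<^sub>L c) \<le> 1" "c o\<^sub>L z k \<in> Y" "norm (c o\<^sub>L z k) \<le> 1"
        using c zY nz by (auto intro: comp_mem norm_comp_le_1)
      have ab: "a - b l \<in> Y" using a bY by (intro diff_mem)
      have e1: "a o\<^sub>L (z k o\<^sub>L c) = (b l o\<^sub>L (z k o\<^sub>L c)) + ((a - b l) o\<^sub>L (z k o\<^sub>L c))"
        and e2: "(c o\<^sub>L z k) o\<^sub>L a = ((c o\<^sub>L z k) o\<^sub>L b l) + ((c o\<^sub>L z k) o\<^sub>L (a - b l))"
        by (rule blinfun_eqI, simp add: blinfun.bilinear_simps)+
      have err: "cmod (\<phi> i r) \<le> e / 2" if r: "r \<in> Y" "norm r \<le> d" for r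
      proof -
        have "cmod (\<phi> i r) \<le> C * norm r" by (rule functional_bound[OF bf r(1)])
        also have "\<dots> \<le> C * d" using r(2) \<open>0 \<le> C\<close> by (rule mult_left_mono)
        finally show ?thesis using d(2) by simp
      qed
      have N: "norm ((a - b l) o\<^sub>L (z k o\<^sub>L c)) \<le> d" "norm ((c o\<^sub>L z k) o\<^sub>L (a - b l)) \<le> d"
        using mult_mono[OF near zc(2)] mult_mono[OF zc(4) near] d(1)
        by (auto intro: order_trans[OF norm_blinfun_compose])
      note E = err[OF comp_mem[OF ab zc(1)] N(1)] err[OF comp_mem[OF zc(3) ab] N(2)]
      have s: "cmod (\<phi> i (b l o\<^sub>L (z k o\<^sub>L c))) \<le> e / 2" "cmod (\<phi> i ((c o\<^sub>L z k) o\<^sub>L b l)) \<le> e / 2"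
        using small[of i k l c] k c pw by auto
      have "\<phi> i (a o\<^sub>L (z k o\<^sub>L c)) = \<phi> i (b l o\<^sub>L (z k o\<^sub>L c)) + \<phi> i ((a - b l) o\<^sub>L (z k o\<^sub>L c))"
        "\<phi> i ((c o\<^sub>L z k) o\<^sub>L a) = \<phi> i ((c o\<^sub>L z k) o\<^sub>L b l) + \<phi> i ((c o\<^sub>L z k) o\<^sub>L (a - b l))"
        unfolding e1 e2 using ab zc bY by (auto intro!: functional_add[OF bf] comp_mem)
      then show ?thesis
        using E s norm_triangle_ineq[of "\<phi> i (b l o\<^sub>L (z k o\<^sub>L c))" "\<phi> i ((a - b l) o\<^sub>L (z k o\<^sub>L c))"]
          norm_triangle_ineq[of "\<phi> i ((c o\<^sub>L z k) o\<^sub>L b l)" "\<phi> i ((c o\<^sub>L z k) o\<^sub>L (a - b l))"] by simp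
    qed
    then show ?thesis by blast
  qed
  have "left_null (\<phi> i) z" "right_null (\<phi> i) z" for i
    unfolding left_null_def right_null_def using null[of _ _ i] by meson+
  then show ?thesis using zY nz bf R lower by blast
qed

end

section \<open>Disjointification inside the algebra\<close>

lemma summable_thinning:
  fixes P :: "nat \<Rightarrow> real \<Rightarrow> bool"
  assumes ev: "\<And>e. 0 < e \<Longrightarrow> \<exists>k0. \<forall>k\<ge>k0. P k e" and S: "infinite S" and "0 < \<eta>"
  shows "\<exists>S'\<subseteq>S. infinite S' \<and> (\<exists>w. (\<forall>k\<in>S'. P k (w k)) \<and> (\<forall>F\<subseteq>S'. finite F \<longrightarrow> (\<Sum>k\<in>F. w k) \<le> \<eta>))"
proof -
  have "\<exists>r. \<forall>n. (r n \<in> S \<and> P (r n) (\<eta> / 2 ^ Suc n)) \<and> r n < r (Suc n)"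
  proof (rule dependent_nat_choice[where P = "\<lambda>n m. m \<in> S \<and> P m (\<eta> / 2 ^ Suc n)" and Q = "\<lambda>n k m. k < m"])
    have step: "\<exists>m. (m \<in> S \<and> P m (\<eta> / 2 ^ Suc n)) \<and> k < m" for k n
    proof -
      obtain k0 where k0: "\<forall>k\<ge>k0. P k (\<eta> / 2 ^ Suc n)" using ev[of "\<eta> / 2 ^ Suc n"] \<open>0 < \<eta>\<close> by auto
      obtain m where "m \<in> S" "max k k0 < m" using S unfolding infinite_nat_iff_unbounded by blast
      then show ?thesis using k0 by auto
    qed
    show "\<exists>m. m \<in> S \<and> P m (\<eta> / 2 ^ Suc 0)" using step by blast
    show "\<exists>m. (m \<in> S \<and> P m (\<eta> / 2 ^ Suc (Suc n))) \<and> k < m" for k n by (rule step)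
  qed
  then obtain r where r: "\<And>n. r n \<in> S" "\<And>n. P (r n) (\<eta> / 2 ^ Suc n)" "\<And>n. r n < r (Suc n)" by blast
  have inj: "inj r" using r(3) by (intro strict_mono_imp_inj_on strict_mono_Suc_iff[THEN iffD2]) auto
  define w where "w k = \<eta> / 2 ^ Suc (inv r k)" for k
  have geometric: "(\<lambda>n. \<eta> / 2 ^ Suc n) sums \<eta>"
  proof -
    have "\<eta> / 2 ^ Suc n = \<eta> * (1/2) ^ Suc n" for n by (simp add: power_divide)
    then show ?thesis using sums_mult[OF power_half_series, of \<eta>] by (simp only: mult_1_right)
  qed
  have "(\<Sum>k\<in>F. w k) \<le> \<eta>" if F: "F \<subseteq> range r" "finite F" for F
  proof -
    have "(\<Sum>k\<in>F. w k) = (\<Sum>n\<in>inv r ` F. \<eta> / 2 ^ Suc n)"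
      unfolding w_def using F(1) by (subst sum.reindex) (auto simp: inj_on_inv_into)
    also have "\<dots> \<le> (\<Sum>n. \<eta> / 2 ^ Suc n)"
      by (rule sum_le_suminf[OF sums_summable[OF geometric]]) (use F(2) \<open>0 < \<eta>\<close> in auto)
    also have "\<dots> = \<eta>" using geometric by (rule sums_unique[symmetric])
    finally show ?thesis .
  qed
  moreover have "P k (w k)" if "k \<in> range r" for k using that r(2) inj by (auto simp: w_def)
  moreover have "infinite (range r)" using inj by (rule range_inj_infinite)
  ultimately show ?thesis using r(1) by (intro exI[of _ "range r"]) blast
qed

lemma le_of_sum_squares_le: "a\<^sup>2 + b\<^sup>2 \<le> c\<^sup>2 \<Longrightarrow> 0 \<le> c \<Longrightarrow> a \<le> (c::real)"
  by (rule power2_le_imp_le) (use zero_le_power2[of b] in linarith)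

context cstar_algebra
begin

text \<open>
  Let \<open>G\<^sub>F\<close> be the inverse of \<open>1 + c \<Sum>\<^sub>k\<^sub>\<in>\<^sub>F z\<^sub>k z\<^sub>k\<^sup>*\<close>. It decreases as \<open>F\<close> grows, \<open>G\<^sub>F z\<^sub>k\<close> is small for \<open>k \<in> F\<close>, and for a fixed \<open>i\<close>
  the factor \<open>1 - G\<^sub>F\<close> has little effect on \<open>\<phi>\<^sub>i\<close> if \<open>F\<close> is sparse, since \<open>z\<close> is null for \<open>\<phi>\<^sub>i\<close>.

  Suppose first that for some \<open>b\<close>, however many indices \<open>F\<close> have been taken out, \<open>\<phi>\<^sub>m (b G\<^sub>F z\<^sub>m)\<close> is still large for some later
  index \<open>m\<close>. Adding such indices to \<open>F\<close> one at a time gives successive differences of the \<open>G\<^sub>F\<close> that are positive, have sum at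
  most 1, and still see \<open>z\<^sub>m\<close>: these are the \<open>L\<^sub>t\<close>, up to the factor \<open>b\<close> and a phase.

  Otherwise some \<open>E = G\<^sub>F\<close> can be used for the first term, while \<open>1 - E\<close> loses little on all later terms, and the construction
  is repeated to the right of the factor \<open>1 - E\<close>. As \<open>\<parallel>E x\<parallel>\<^sup>2 + \<parallel>(1 - E) x\<parallel>\<^sup>2 \<le> \<parallel>x\<parallel>\<^sup>2\<close>, the products obtained are row bounded.
\<close>

lemma row_disjointification:
  assumes zY: "\<And>k. z k \<in> Y" and nz: "\<And>k. norm (z k) \<le> 1"
    and bf: "\<And>i. bounded_functional Y C (\<phi> i)" and "0 < C"
    and lower: "\<And>i. \<epsilon> \<le> Re (\<phi> i (z i))" and "0 < \<epsilon>"
    and null: "\<And>i. left_null (\<phi> i) z"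
  shows "\<exists>s L \<delta>. strict_mono (s :: nat \<Rightarrow> nat) \<and> 0 < \<delta> \<and> (\<forall>t. L t \<in> Y) \<and>
    (\<forall>T x. (\<Sum>t<T. (norm (adj (L t) x))\<^sup>2) \<le> (norm x)\<^sup>2) \<and> (\<forall>t. \<delta> \<le> Re (\<phi> (s t) (L t o\<^sub>L z (s t))))"
proof -
  obtain G :: "real \<Rightarrow> nat set \<Rightarrow> 'h \<Rightarrow>\<^sub>L 'h" where *: "\<forall>c F. 0 < c \<longrightarrow> finite F \<longrightarrow>
     G c F \<in> Y \<and> pos_op (G c F) \<and> (\<forall>x. (norm (G c F x))\<^sup>2 \<le> Re (cinner x (G c F x))) \<and>
     (\<forall>k\<in>F. norm (G c F o\<^sub>L z k) \<le> 1 / sqrt c) \<and>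
     id_blinfun - G c F = (\<Sum>k\<in>F. c *\<^sub>R (z k o\<^sub>L (adj (z k) o\<^sub>L G c F))) \<and>
     (\<forall>F' x. finite F' \<longrightarrow> F \<subseteq> F' \<longrightarrow> Re (cinner x (G c F' x)) \<le> Re (cinner x (G c F x)))"
    by (rule exE[OF resolvent_family[of z, OF zY]]) (rule that)
  have G: "G c F \<in> Y" "pos_op (G c F)" "\<And>x. (norm (G c F x))\<^sup>2 \<le> Re (cinner x (G c F x))"
    "\<And>k. k \<in> F \<Longrightarrow> norm (G c F o\<^sub>L z k) \<le> 1 / sqrt c"
    "id_blinfun - G c F = (\<Sum>k\<in>F. c *\<^sub>R (z k o\<^sub>L (adj (z k) o\<^sub>L G c F)))"
    if "0 < c" "finite F" for c F
    using *[rule_format, OF that] by blast+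
  have G6: "Re (cinner x (G c F' x)) \<le> Re (cinner x (G c F x))"
    if "0 < c" "finite F'" "F \<subseteq> F'" for c F F' x
    using *[rule_format, OF that(1) finite_subset[OF that(3,2)]] that(2,3) by blast
  have contr: "(norm (G c F x))\<^sup>2 + (norm (x - G c F x))\<^sup>2 \<le> (norm x)\<^sup>2" if "0 < c" "finite F" for c F x
    by (rule pos_op_contraction_split[OF G(2)[OF that] G(3)[OF that]])
  have leG: "norm (G c F x) \<le> norm x" if "0 < c" "finite F" for c F x
    by (rule le_of_sum_squares_le[OF contr[OF that] norm_ge_zero])
  have leG': "norm (x - G c F x) \<le> norm x" if "0 < c" "finite F" for c F x
    by (rule le_of_sum_squares_le[OF contr[OF that, unfolded add.commute[of "(norm (G c F _))\<^sup>2"]] norm_ge_zero])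
  have normG: "norm (G c F) \<le> 1" if "0 < c" "finite F" for c F
    using leG[OF that] by (intro norm_blinfun_bound) auto
  have normG': "norm (id_blinfun - G c F) \<le> 1" if "0 < c" "finite F" for c F
    using leG'[OF that] by (intro norm_blinfun_bound) (auto simp: blinfun.diff_left)
  have adjG: "adj (G c F) = G c F" if "0 < c" "finite F" for c F
    using G(2)[OF that] by (intro adj_eqI) (auto simp: pos_op_def)
  have adj_le: "norm (adj b x) \<le> norm x" if "b \<in> Y" "norm b \<le> 1" for b x
    using norm_blinfun[of "adj b" x] mult_right_mono[of "norm (adj b)" 1 "norm x"] that
    by (simp add: norm_adj_eq clin_mem)
  \<comment> \<open>the weight for which \<open>G\<^sub>F z\<^sub>k\<close> changes values of the functionals by at most \<open>d / 2\<close>\<close>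
  define cc where "cc d = (2 * C / d)\<^sup>2" for d :: real
  have cc: "0 < cc d" "1 / sqrt (cc d) = d / (2 * C)" if "0 < d" for d
    using that \<open>0 < C\<close> by (auto simp: cc_def)
  show ?thesis
  proof (cases "\<exists>b\<in>unit_ball. \<exists>d>0. \<exists>S. \<forall>F\<subseteq>S. finite F \<longrightarrow>
      (\<exists>m\<in>S. (\<forall>k\<in>F. k < m) \<and> d \<le> cmod (\<phi> m (b o\<^sub>L (G (cc d) F o\<^sub>L z m))))")
    case True
    then obtain b d S where b: "b \<in> Y" "norm b \<le> 1" and "0 < d"
      and ex: "\<And>F. F \<subseteq> S \<Longrightarrow> finite F \<Longrightarrow> \<exists>m\<in>S. (\<forall>k\<in>F. k < m) \<and> d \<le> cmod (\<phi> m (b o\<^sub>L (G (cc d) F o\<^sub>L z m)))"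
      by blast
    let ?c = "cc d"
    note c = cc[OF \<open>0 < d\<close>]
    define A where "A p \<longleftrightarrow> fst p \<subseteq> S \<and> finite (fst p) \<and> snd p \<in> S \<and> (\<forall>k\<in>fst p. k < snd p) \<and>
        d \<le> cmod (\<phi> (snd p) (b o\<^sub>L (G ?c (fst p) o\<^sub>L z (snd p))))" for p
    have "\<exists>f. \<forall>t::nat. A (f t) \<and> fst (f (Suc t)) = insert (snd (f t)) (fst (f t))"
    proof (rule dependent_nat_choice[where P = "\<lambda>_. A" and Q = "\<lambda>_ p q. fst q = insert (snd p) (fst p)"])
      show "\<exists>p. A p" using ex[of "{}"] by (auto simp: A_def)
    next
      fix p and t :: nat
      assume p: "A p"
      let ?F = "insert (snd p) (fst p)"
      obtain m where "m \<in> S" "\<forall>k\<in>?F. k < m" "d \<le> cmod (\<phi> m (b o\<^sub>L (G ?c ?F o\<^sub>L z m)))"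
        using ex[of ?F] p by (auto simp: A_def)
      then show "\<exists>q. A q \<and> fst q = ?F"
        using p by (intro exI[of _ "(?F, m)"]) (auto simp: A_def)
    qed
    then obtain f where Af: "\<And>t. A (f t)" and f4: "\<And>t. fst (f (Suc t)) = insert (snd (f t)) (fst (f t))" by blast
    have f: "\<And>t. finite (fst (f t))" "\<And>t k. k \<in> fst (f t) \<Longrightarrow> k < snd (f t)"
      "\<And>t. d \<le> cmod (\<phi> (snd (f t)) (b o\<^sub>L (G ?c (fst (f t)) o\<^sub>L z (snd (f t)))))"
      "\<And>t. fst (f (Suc t)) = insert (snd (f t)) (fst (f t))" using Af f4 unfolding A_def by blast+
    define F where "F t = fst (f t)" for t
    define s where "s t = snd (f t)" for t
    have F: "finite (F t)" "F (Suc t) = insert (s t) (F t)" for t using f by (auto simp: F_def s_def)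
    have "strict_mono s"
      unfolding strict_mono_Suc_iff using f(2)[of "snd (f t)" "Suc t" for t] f(4) by (auto simp: s_def)
    define g where "g t = G ?c (F t)" for t
    have gY: "g t \<in> Y" for t unfolding g_def by (rule G(1)[OF c(1) F(1)])
    define D where "D t = g t - g (Suc t)" for t
    have DY: "D t \<in> Y" for t unfolding D_def by (intro diff_mem gY)
    have formD: "Re (cinner x (D t x)) = Re (cinner x (g t x)) - Re (cinner x (g (Suc t) x))" for x t
      by (simp add: D_def blinfun.diff_left cinner_simps)
    have g0: "0 \<le> Re (cinner x (g t x))" for x t
      using G(2)[OF c(1) F(1)] by (simp add: g_def pos_op_def)
    have g1: "Re (cinner x (g t x)) \<le> (norm x)\<^sup>2" for x t
    proof -
      have "Re (cinner x (g t x)) \<le> norm x * norm (g t x)"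
        using Cauchy_Schwarz_cinner[of x "g t x"] complex_Re_le_cmod[of "cinner x (g t x)"] by linarith
      also have "\<dots> \<le> norm x * norm x" unfolding g_def by (intro mult_left_mono leG[OF c(1) F(1)]) auto
      finally show ?thesis by (simp add: power2_eq_square)
    qed
    have posD: "pos_op (D t)" for t
      unfolding pos_op_def formD
    proof (intro conjI allI)
      show "clin (D t)" by (rule clin_mem[OF DY])
      show "cinner (D t x) y = cinner x (D t y)" for x y
        using G(2)[OF c(1) F(1)] by (simp add: D_def g_def pos_op_def blinfun.diff_left cinner_simps)
      show "0 \<le> Re (cinner x (g t x)) - Re (cinner x (g (Suc t) x))" for x
        using G6[OF c(1) F(1)[of "Suc t"], of "F t" x] F(2)[of t] by (auto simp: g_def)
    qed
    have sqD: "(norm (D t x))\<^sup>2 \<le> Re (cinner x (D t x))" for t x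
    proof -
      have "(norm (D t x))\<^sup>2 \<le> 1 * Re (cinner x (D t x))"
      proof (rule pos_op_square_le[OF posD])
        show "Re (cinner x (D t x)) \<le> 1 * (norm x)\<^sup>2" for x
          using g0[of x "Suc t"] g1[of x t] by (simp add: formD)
      qed simp
      then show ?thesis by simp
    qed
    have adjD: "adj (D t) = D t" for t using posD[of t] by (intro adj_eqI) (auto simp: pos_op_def)
    define u where "u t = cnj (sgn (\<phi> (s t) (b o\<^sub>L (D t o\<^sub>L z (s t)))))" for t
    have u1: "cmod (u t) \<le> 1" for t by (simp add: u_def norm_sgn)
    define L where "L t = u t *\<^sub>C (b o\<^sub>L D t)" for t
    have LY: "L t \<in> Y" for t unfolding L_def by (intro scaleC_mem comp_mem b DY)
    have "(\<Sum>t<T. (norm (adj (L t) x))\<^sup>2) \<le> (norm x)\<^sup>2" for T x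
    proof -
      let ?y = "adj b x"
      have "(\<Sum>t<T. (norm (adj (L t) x))\<^sup>2) \<le> (\<Sum>t<T. Re (cinner ?y (g t ?y)) - Re (cinner ?y (g (Suc t) ?y)))"
      proof (rule sum_mono)
        fix t
        have "adj (L t) x = cnj (u t) *\<^sub>C D t ?y"
          unfolding L_def by (simp add: adj_scale adj_comp adjD clin_comp clin_mem b DY)
        then have "norm (adj (L t) x) \<le> norm (D t ?y)"
          using u1[of t] by (simp add: norm_scaleC mult_left_le_one_le)
        then have "(norm (adj (L t) x))\<^sup>2 \<le> (norm (D t ?y))\<^sup>2" by (intro power_mono) auto
        from order_trans[OF this sqD] show "(norm (adj (L t) x))\<^sup>2 \<le> Re (cinner ?y (g t ?y)) - Re (cinner ?y (g (Suc t) ?y))"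
          unfolding formD .
      qed
      also have "\<dots> = Re (cinner ?y (g 0 ?y)) - Re (cinner ?y (g T ?y))" by (rule sum_lessThan_telescope')
      also have "\<dots> \<le> (norm ?y)\<^sup>2" using g0[of ?y T] g1[of ?y 0] by linarith
      also have "\<dots> \<le> (norm x)\<^sup>2" using adj_le[OF b] by (intro power_mono) auto
      finally show ?thesis .
    qed
    moreover have "d / 2 \<le> Re (\<phi> (s t) (L t o\<^sub>L z (s t)))" for t
    proof -
      let ?m = "s t"
      have mem: "b o\<^sub>L (g r o\<^sub>L z ?m) \<in> Y" for r by (intro comp_mem b gY zY)
      have "b o\<^sub>L (D t o\<^sub>L z ?m) = (b o\<^sub>L (g t o\<^sub>L z ?m)) - (b o\<^sub>L (g (Suc t) o\<^sub>L z ?m))"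
        unfolding D_def by (rule blinfun_eqI) (simp add: blinfun.bilinear_simps)
      then have split: "\<phi> ?m (b o\<^sub>L (D t o\<^sub>L z ?m)) = \<phi> ?m (b o\<^sub>L (g t o\<^sub>L z ?m)) - \<phi> ?m (b o\<^sub>L (g (Suc t) o\<^sub>L z ?m))"
        using functional_diff[OF bf mem mem] by simp
      have "cmod (\<phi> ?m (b o\<^sub>L (g (Suc t) o\<^sub>L z ?m))) \<le> C * norm (b o\<^sub>L (g (Suc t) o\<^sub>L z ?m))"
        by (rule functional_bound[OF bf mem])
      also have "\<dots> \<le> C * (norm b * norm (g (Suc t) o\<^sub>L z ?m))"
        using \<open>0 < C\<close> by (intro mult_left_mono norm_blinfun_compose) auto
      also have "\<dots> \<le> C * (1 * (d / (2 * C)))"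
      proof (intro mult_left_mono mult_mono)
        show "norm (g (Suc t) o\<^sub>L z ?m) \<le> d / (2 * C)"
          using G(4)[OF c(1) F(1), of ?m "Suc t"] F(2)[of t] c(2) by (simp add: g_def)
      qed (use b \<open>0 < C\<close> in auto)
      also have "\<dots> = d / 2" using \<open>0 < C\<close> by simp
      finally have "d / 2 \<le> cmod (\<phi> ?m (b o\<^sub>L (D t o\<^sub>L z ?m)))"
        using f(3)[of t] norm_triangle_ineq2[of "\<phi> ?m (b o\<^sub>L (g t o\<^sub>L z ?m))" "\<phi> ?m (b o\<^sub>L (g (Suc t) o\<^sub>L z ?m))"]
        unfolding split by (simp add: g_def F_def s_def)
      moreover have "\<phi> ?m (L t o\<^sub>L z ?m) = of_real (cmod (\<phi> ?m (b o\<^sub>L (D t o\<^sub>L z ?m))))"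
      proof -
        have "L t o\<^sub>L z ?m = u t *\<^sub>C (b o\<^sub>L (D t o\<^sub>L z ?m))" unfolding L_def by (rule blinfun_eqI) simp
        then have "\<phi> ?m (L t o\<^sub>L z ?m) = u t * \<phi> ?m (b o\<^sub>L (D t o\<^sub>L z ?m))"
          using functional_scaleC[OF bf] by (simp add: comp_mem b DY zY)
        then show ?thesis unfolding u_def
          by (cases "\<phi> ?m (b o\<^sub>L (D t o\<^sub>L z ?m)) = 0")
            (simp_all add: sgn_eq complex_norm_square[symmetric] power2_eq_square mult.commute)
      qed
      ultimately show ?thesis by simp
    qed
    ultimately show ?thesis using \<open>strict_mono s\<close> LY \<open>0 < d\<close>
      by (intro exI[of _ s] exI[of _ L] exI[of _ "d / 2"]) auto
  next
    case False
    have ex: "\<exists>F\<subseteq>S. finite F \<and> (\<forall>m\<in>S. (\<forall>k\<in>F. k < m) \<longrightarrow> cmod (\<phi> m (b o\<^sub>L (G (cc d) F o\<^sub>L z m))) < d)"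
      if "b \<in> Y" "norm b \<le> 1" "0 < d" for b d S
    proof (rule ccontr)
      assume "\<not> ?thesis"
      then have "\<forall>F\<subseteq>S. finite F \<longrightarrow> (\<exists>m\<in>S. (\<forall>k\<in>F. k < m) \<and> d \<le> cmod (\<phi> m (b o\<^sub>L (G (cc d) F o\<^sub>L z m))))"
        by (metis not_less)
      with False that show False by blast
    qed
    \<comment> \<open>A state consists of the factor \<open>b\<close> accumulated so far and of the indices still in use; the total loss is
      kept below half of \<open>\<epsilon>\<close>.\<close>
    define P where "P t p \<longleftrightarrow> fst p \<in> Y \<and> norm (fst p) \<le> 1 \<and> infinite (snd p) \<and>
        (\<forall>m\<in>snd p. \<epsilon> / 2 + \<epsilon> / 2 ^ Suc t \<le> Re (\<phi> m (fst p o\<^sub>L z m)))"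
      for t and p :: "('h \<Rightarrow>\<^sub>L 'h) \<times> nat set"
    define Q where "Q p q \<longleftrightarrow> (\<exists>i L. i \<in> snd p \<and> snd q \<subseteq> snd p \<inter> {i<..} \<and> L \<in> Y \<and>
        (\<forall>x. (norm (adj L x))\<^sup>2 + (norm (adj (fst q) x))\<^sup>2 \<le> (norm (adj (fst p) x))\<^sup>2) \<and>
        \<epsilon> / 4 \<le> Re (\<phi> i (L o\<^sub>L z i)))"
      for p q :: "('h \<Rightarrow>\<^sub>L 'h) \<times> nat set"
    have "\<exists>f. \<forall>t. P t (f t) \<and> Q (f t) (f (Suc t))"
    proof (rule dependent_nat_choice[where P = P and Q = "\<lambda>_. Q"])
      have "id_blinfun o\<^sub>L a = a" for a :: "'h \<Rightarrow>\<^sub>L 'h" by (rule blinfun_eqI) simp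
      then show "\<exists>p. P 0 p"
        using lower norm_blinfun_bound[of 1 "id_blinfun :: 'h \<Rightarrow>\<^sub>L 'h"]
        by (intro exI[of _ "(id_blinfun, UNIV)"]) (auto simp: P_def id_mem)
    next
      fix p t assume "P t p"
      obtain b S where p: "p = (b, S)" by (cases p)
      have b: "b \<in> Y" "norm b \<le> 1" and S: "infinite S"
        and low: "\<And>m. m \<in> S \<Longrightarrow> \<epsilon> / 2 + \<epsilon> / 2 ^ Suc t \<le> Re (\<phi> m (b o\<^sub>L z m))"
        using \<open>P t p\<close> by (auto simp: P_def p)
      obtain i where i: "i \<in> S" using infinite_imp_nonempty[OF S] by blast
      define d where "d = \<epsilon> / 2 ^ Suc (Suc t)"
      have "0 < d" unfolding d_def using \<open>0 < \<epsilon>\<close> by simp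
      let ?c = "cc d"
      note c = cc[OF \<open>0 < d\<close>]
      have "infinite (S \<inter> {i<..})"
        using S by (simp add: Int_commute infinite_nat_iff_unbounded) (meson less_trans max_less_iff_conj)
      moreover have "0 < \<epsilon> / 4 / ?c" using c \<open>0 < \<epsilon>\<close> by simp
      moreover have "\<exists>k0. \<forall>k\<ge>k0. \<forall>a\<in>unit_ball. cmod (\<phi> i (b o\<^sub>L (z k o\<^sub>L a))) \<le> e" if "0 < e" for e
        using null[of i] b(1) that unfolding left_null_def by blast
      ultimately have "\<exists>S'\<subseteq>S \<inter> {i<..}. infinite S' \<and>
          (\<exists>w. (\<forall>k\<in>S'. \<forall>a\<in>unit_ball. cmod (\<phi> i (b o\<^sub>L (z k o\<^sub>L a))) \<le> w k) \<and>
            (\<forall>F\<subseteq>S'. finite F \<longrightarrow> (\<Sum>k\<in>F. w k) \<le> \<epsilon> / 4 / ?c))"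
        by (intro summable_thinning[where P = "\<lambda>k e. \<forall>a\<in>unit_ball. cmod (\<phi> i (b o\<^sub>L (z k o\<^sub>L a))) \<le> e"])
      then obtain S' w where S': "S' \<subseteq> S \<inter> {i<..}" "infinite S'"
        "\<forall>k\<in>S'. \<forall>a\<in>unit_ball. cmod (\<phi> i (b o\<^sub>L (z k o\<^sub>L a))) \<le> w k"
        "\<forall>F\<subseteq>S'. finite F \<longrightarrow> (\<Sum>k\<in>F. w k) \<le> \<epsilon> / 4 / ?c"
        by (elim exE conjE) (rule that)
      obtain F where F: "F \<subseteq> S'" "finite F"
        "\<forall>m\<in>S'. (\<forall>k\<in>F. k < m) \<longrightarrow> cmod (\<phi> m (b o\<^sub>L (G ?c F o\<^sub>L z m))) < d"
        using ex[OF b \<open>0 < d\<close>, of S'] by (elim exE conjE) (rule that)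
      let ?E = "G ?c F"
      have EY: "?E \<in> Y" by (rule G(1)[OF c(1) F(2)])
      define L where "L = b o\<^sub>L ?E"
      define b' where "b' = b o\<^sub>L (id_blinfun - ?E)"
      define S'' where "S'' = {m \<in> S'. \<forall>k\<in>F. k < m}"
      have mem: "L \<in> Y" "b' \<in> Y" unfolding L_def b'_def by (intro comp_mem diff_mem b EY id_mem)+
      have split: "\<phi> m (b o\<^sub>L z m) = \<phi> m (L o\<^sub>L z m) + \<phi> m (b' o\<^sub>L z m)" for m
      proof -
        have "b o\<^sub>L z m = (L o\<^sub>L z m) + (b' o\<^sub>L z m)"
          unfolding L_def b'_def by (rule blinfun_eqI) (simp add: blinfun.bilinear_simps)
        then show ?thesis using functional_add[OF bf comp_mem[OF mem(1) zY] comp_mem[OF mem(2) zY]] by simp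
      qed
      have "infinite S''"
      proof
        assume "finite S''"
        moreover have "S' - S'' \<subseteq> (\<Union>k\<in>F. {..k})" unfolding S''_def by auto
        ultimately have "finite S'" using F(2) by (metis finite_Diff2 finite_UN finite_atMost finite_subset)
        then show False using S'(2) by blast
      qed
      moreover have "norm b' \<le> 1" unfolding b'_def by (rule norm_comp_le_1[OF b(2) normG'[OF c(1) F(2)]])
      moreover have "\<epsilon> / 2 + \<epsilon> / 2 ^ Suc (Suc t) \<le> Re (\<phi> m (b' o\<^sub>L z m))" if m: "m \<in> S''" for m
      proof -
        have "L o\<^sub>L z m = b o\<^sub>L (?E o\<^sub>L z m)" unfolding L_def by (rule blinfun_eqI) simp
        then have "cmod (\<phi> m (L o\<^sub>L z m)) < d" using F(3) m by (simp add: S''_def)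
        then have "Re (\<phi> m (L o\<^sub>L z m)) \<le> d" using complex_Re_le_cmod[of "\<phi> m (L o\<^sub>L z m)"] by linarith
        moreover have "m \<in> S" using m S'(1) by (auto simp: S''_def)
        ultimately show ?thesis using low[of m] split[of m] unfolding d_def by simp
      qed
      ultimately have "P (Suc t) (b', S'')" using mem by (simp add: P_def)
      moreover have "Q p (b', S'')"
        unfolding Q_def p
      proof (intro exI[of _ i] exI[of _ L] conjI allI)
        show "i \<in> snd (b, S)" using i by simp
        show "snd (b', S'') \<subseteq> snd (b, S) \<inter> {i<..}" using S'(1) by (auto simp: S''_def)
        show "L \<in> Y" by (rule mem)
        have adjE: "adj (id_blinfun - ?E) = id_blinfun - ?E"
          by (simp add: adj_diff[OF clin_id clin_mem[OF EY]] adj_id adjG[OF c(1) F(2)])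
        show "(norm (adj L x))\<^sup>2 + (norm (adj (fst (b', S'')) x))\<^sup>2 \<le> (norm (adj (fst (b, S)) x))\<^sup>2" for x
          using contr[OF c(1) F(2), of "adj b x"]
          by (simp add: L_def b'_def adj_comp clin_mem b EY diff_mem id_mem adjE adjG[OF c(1) F(2)] blinfun.diff_left)
        have "cmod (\<phi> i (b' o\<^sub>L z i)) \<le> \<epsilon> / 4"
        proof -
          let ?a = "\<lambda>k. (adj (z k) o\<^sub>L ?E) o\<^sub>L z i"
          have a: "?a k \<in> unit_ball" for k
            using nz norm_adj_eq[OF clin_mem[OF zY]] normG[OF c(1) F(2)]
            by (auto intro!: comp_mem adj_mem zY EY norm_comp_le_1)
          have "b' o\<^sub>L z i = (\<Sum>k\<in>F. ?c *\<^sub>R (b o\<^sub>L (z k o\<^sub>L ?a k)))"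
            unfolding b'_def G(5)[OF c(1) F(2)]
            by (rule blinfun_eqI) (simp add: blinfun.sum_left blinfun.sum_right blinfun.bilinear_simps)
          moreover have bza: "b o\<^sub>L (z k o\<^sub>L ?a k) \<in> Y" for k by (intro comp_mem b zY adj_mem EY)
          ultimately have "\<phi> i (b' o\<^sub>L z i) = (\<Sum>k\<in>F. ?c * \<phi> i (b o\<^sub>L (z k o\<^sub>L ?a k)))"
            by (simp add: functional_sum[OF bf] scaleR_mem functional_scaleR[OF bf])
          then have "cmod (\<phi> i (b' o\<^sub>L z i)) \<le> (\<Sum>k\<in>F. ?c * w k)"
          proof (simp only:, intro sum_norm_le)
            fix k assume "k \<in> F"
            then have "cmod (\<phi> i (b o\<^sub>L (z k o\<^sub>L ?a k))) \<le> w k" using S'(3) a F(1) by blast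
            then show "cmod (of_real ?c * \<phi> i (b o\<^sub>L (z k o\<^sub>L ?a k))) \<le> ?c * w k"
              using c(1) by (simp add: norm_mult mult_left_mono)
          qed
          also have "\<dots> = ?c * (\<Sum>k\<in>F. w k)" by (simp add: sum_distrib_left)
          also have "\<dots> \<le> ?c * (\<epsilon> / 4 / ?c)" using S'(4) F(1,2) c(1) by (intro mult_left_mono) auto
          finally show ?thesis using c(1) by simp
        qed
        then have "Re (\<phi> i (b' o\<^sub>L z i)) \<le> \<epsilon> / 4" using complex_Re_le_cmod[of "\<phi> i (b' o\<^sub>L z i)"] by linarith
        moreover have "\<epsilon> / 2 \<le> Re (\<phi> i (b o\<^sub>L z i))"
          using low[OF i] \<open>0 < \<epsilon>\<close> by (smt (verit) divide_nonneg_pos zero_less_power)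
        ultimately show "\<epsilon> / 4 \<le> Re (\<phi> i (L o\<^sub>L z i))" using split[of i] by simp
      qed
      ultimately show "\<exists>q. P (Suc t) q \<and> Q p q" by blast
    qed
    then obtain f where f: "\<And>t. P t (f t)" "\<And>t. Q (f t) (f (Suc t))" by blast
    from f(2) have "\<forall>t. \<exists>i L. i \<in> snd (f t) \<and> snd (f (Suc t)) \<subseteq> snd (f t) \<inter> {i<..} \<and> L \<in> Y \<and>
        (\<forall>x. (norm (adj L x))\<^sup>2 + (norm (adj (fst (f (Suc t))) x))\<^sup>2 \<le> (norm (adj (fst (f t)) x))\<^sup>2) \<and>
        \<epsilon> / 4 \<le> Re (\<phi> i (L o\<^sub>L z i))" unfolding Q_def by blast
    then obtain s L where sL: "\<And>t. s t \<in> snd (f t)" "\<And>t. snd (f (Suc t)) \<subseteq> snd (f t) \<inter> {s t<..}" "\<And>t. L t \<in> Y"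
        "\<And>t x. (norm (adj (L t) x))\<^sup>2 + (norm (adj (fst (f (Suc t))) x))\<^sup>2 \<le> (norm (adj (fst (f t)) x))\<^sup>2"
        "\<And>t. \<epsilon> / 4 \<le> Re (\<phi> (s t) (L t o\<^sub>L z (s t)))" by metis
    have "strict_mono s" unfolding strict_mono_Suc_iff using sL(1,2) by blast
    moreover have "(\<Sum>t<T. (norm (adj (L t) x))\<^sup>2) \<le> (norm x)\<^sup>2" for T x
    proof -
      have "(\<Sum>t<T. (norm (adj (L t) x))\<^sup>2) \<le> (\<Sum>t<T. (norm (adj (fst (f t)) x))\<^sup>2 - (norm (adj (fst (f (Suc t))) x))\<^sup>2)"
        using sL(4) by (intro sum_mono) (simp add: le_diff_eq)
      also have "\<dots> = (norm (adj (fst (f 0)) x))\<^sup>2 - (norm (adj (fst (f T)) x))\<^sup>2"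
        by (rule sum_lessThan_telescope')
      also have "\<dots> \<le> (norm (adj (fst (f 0)) x))\<^sup>2" by simp
      also have "\<dots> \<le> (norm x)\<^sup>2" using f(1)[of 0] by (intro power_mono adj_le) (auto simp: P_def)
      finally show ?thesis .
    qed
    ultimately show ?thesis using sL(3,5) \<open>0 < \<epsilon>\<close>
      by (intro exI[of _ s] exI[of _ L] exI[of _ "\<epsilon> / 4"]) auto
  qed
qed

text \<open>
  Disjointify on the left, then on the right by taking adjoints. The products \<open>L\<^sub>t z R\<^sub>t\<close> behave like a block diagonal: all their
  signed sums have norm at most 1, while the functionals remain bounded below on them.
\<close>

lemma orthogonal_sequence:
  assumes zY: "\<And>k. z k \<in> Y" and nz: "\<And>k. norm (z k) \<le> 1"
    and bf: "\<And>i. bounded_functional Y C (\<phi> i)" and "0 < C"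
    and lower: "\<And>i. \<epsilon> \<le> Re (\<phi> i (z i))" and "0 < \<epsilon>"
    and left: "\<And>i. left_null (\<phi> i) z" and right: "\<And>i. right_null (\<phi> i) z"
  shows "\<exists>w s \<delta>. 0 < \<delta> \<and> (\<forall>t. w t \<in> Y) \<and> (\<forall>t::nat. \<delta> \<le> cmod (\<phi> (s t) (w t))) \<and>
    (\<forall>F \<alpha>. finite F \<longrightarrow> (\<forall>t\<in>F. \<bar>\<alpha> t\<bar> \<le> 1) \<longrightarrow> norm (\<Sum>t\<in>F. \<alpha> t *\<^sub>R w t) \<le> (1::real))"
proof -
  obtain s L \<delta>1 where s: "strict_mono (s :: nat \<Rightarrow> nat)" and "0 < \<delta>1" and LY: "\<And>t. L t \<in> Y"
    and L: "\<And>T x. (\<Sum>t<T. (norm (adj (L t) x))\<^sup>2) \<le> (norm x)\<^sup>2"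
    and low1: "\<And>t. \<delta>1 \<le> Re (\<phi> (s t) (L t o\<^sub>L z (s t)))"
    using row_disjointification[OF zY nz bf \<open>0 < C\<close> lower \<open>0 < \<epsilon>\<close> left] by blast
  have nL: "norm (L t) \<le> 1" for t
  proof -
    have "norm (adj (L t) x) \<le> 1 * norm x" for x
    proof (rule power2_le_imp_le)
      have "(norm (adj (L t) x))\<^sup>2 \<le> (\<Sum>t<Suc t. (norm (adj (L t) x))\<^sup>2)"
        by (rule member_le_sum) auto
      also have "\<dots> \<le> (norm x)\<^sup>2" by (rule L)
      finally show "(norm (adj (L t) x))\<^sup>2 \<le> (1 * norm x)\<^sup>2" by simp
    qed simp
    then have "norm (adj (L t)) \<le> 1" by (rule norm_blinfun_bound[rotated]) simp
    then show ?thesis by (simp add: norm_adj_eq clin_mem LY)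
  qed
  define z' where "z' t = adj (L t o\<^sub>L z (s t))" for t
  define \<phi>' where "\<phi>' t = functional_star (\<phi> (s t))" for t
  have z'Y: "z' t \<in> Y" for t unfolding z'_def by (intro adj_mem comp_mem LY zY)
  have nz': "norm (z' t) \<le> 1" for t
    unfolding z'_def using norm_comp_le_1[OF nL nz] by (simp add: norm_adj_eq clin_comp clin_mem LY zY)
  have bf': "bounded_functional Y C (\<phi>' t)" for t unfolding \<phi>'_def by (rule bounded_functional_star[OF bf])
  have low': "\<delta>1 \<le> Re (\<phi>' t (z' t))" for t
    unfolding \<phi>'_def z'_def functional_star_def using low1[of t] by (simp add: adj_adj clin_comp clin_mem LY zY)
  have null': "left_null (\<phi>' i) z'" for i
    unfolding left_null_def
  proof (intro ballI allI impI)
    fix b and e :: real assume b: "b \<in> Y" and "0 < e"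
    obtain k0 where k0: "\<And>k c. k0 \<le> k \<Longrightarrow> c \<in> unit_ball \<Longrightarrow> cmod (\<phi> (s i) ((c o\<^sub>L z k) o\<^sub>L adj b)) \<le> e"
      using right[of "s i"] adj_mem[OF b] \<open>0 < e\<close> unfolding right_null_def by blast
    have "cmod (\<phi>' i (b o\<^sub>L (z' k o\<^sub>L c))) \<le> e" if "k0 \<le> k" and c: "c \<in> unit_ball" for k c
    proof -
      have cY: "c \<in> Y" using c by simp
      have "adj (b o\<^sub>L (z' k o\<^sub>L c)) = ((adj c o\<^sub>L L k) o\<^sub>L z (s k)) o\<^sub>L adj b"
        unfolding z'_def
        by (simp add: adj_comp clin_comp clin_adj clin_mem b cY LY zY adj_adj) (rule blinfun_eqI, simp)
      moreover have "adj c o\<^sub>L L k \<in> unit_ball"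
        using c nL[of k] by (auto intro!: comp_mem adj_mem LY norm_comp_le_1 simp: norm_adj_eq clin_mem)
      moreover have "k0 \<le> s k" using that(1) strict_mono_imp_increasing[OF s, of k] by linarith
      ultimately show ?thesis using k0[of "s k" "adj c o\<^sub>L L k"] by (simp add: \<phi>'_def functional_star_def)
    qed
    then show "\<exists>k0. \<forall>k\<ge>k0. \<forall>c\<in>unit_ball. cmod (\<phi>' i (b o\<^sub>L (z' k o\<^sub>L c))) \<le> e" by blast
  qed
  obtain s' R \<delta> where s': "strict_mono (s' :: nat \<Rightarrow> nat)" and "0 < \<delta>" and RY: "\<And>t. R t \<in> Y"
    and R: "\<And>T x. (\<Sum>t<T. (norm (adj (R t) x))\<^sup>2) \<le> (norm x)\<^sup>2"
    and low2: "\<And>t. \<delta> \<le> Re (\<phi>' (s' t) (R t o\<^sub>L z' (s' t)))"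
    using row_disjointification[OF z'Y nz' bf' \<open>0 < C\<close> low' \<open>0 < \<delta>1\<close> null'] by blast
  define w where "w t = adj (R t o\<^sub>L z' (s' t))" for t
  have wY: "w t \<in> Y" for t unfolding w_def by (intro adj_mem comp_mem RY z'Y)
  have "\<delta> \<le> cmod (\<phi> (s (s' t)) (w t))" for t
    using low2[of t] complex_Re_le_cmod[of "\<phi>' (s' t) (R t o\<^sub>L z' (s' t))"]
    by (simp add: w_def \<phi>'_def functional_star_def)
  moreover have "norm (\<Sum>t\<in>F. \<alpha> t *\<^sub>R w t) \<le> 1" if F: "finite F" and \<alpha>: "\<forall>t\<in>F. \<bar>\<alpha> t\<bar> \<le> 1" for F and \<alpha> :: "nat \<Rightarrow> real"
  proof (rule norm_blinfun_le_cinnerI)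
    fix x y
    obtain T where T: "F \<subseteq> {..<T}" using F finite_nat_bounded by blast
    have wf: "cinner x (w t y) = cinner (adj (L (s' t)) x) (z (s (s' t)) (adj (R t) y))" for t
      unfolding w_def z'_def
      by (simp add: adj_comp adj_adj clin_comp clin_adj clin_mem RY LY zY cinner_adj')
    have Lx: "L2_set (\<lambda>t. norm (adj (L (s' t)) x)) F \<le> norm x"
    proof -
      have "(\<Sum>t\<in>F. (norm (adj (L (s' t)) x))\<^sup>2) = (\<Sum>r\<in>s' ` F. (norm (adj (L r) x))\<^sup>2)"
        using strict_mono_imp_inj_on[OF s'] by (subst sum.reindex) (auto intro: inj_on_subset)
      also obtain T' where "s' ` F \<subseteq> {..<T'}" using F finite_nat_bounded[of "s' ` F"] by blast
      then have "(\<Sum>r\<in>s' ` F. (norm (adj (L r) x))\<^sup>2) \<le> (\<Sum>r<T'. (norm (adj (L r) x))\<^sup>2)"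
        by (intro sum_mono2) auto
      also have "\<dots> \<le> (norm x)\<^sup>2" by (rule L)
      finally show ?thesis unfolding L2_set_def by (intro real_le_lsqrt) auto
    qed
    have Ry: "L2_set (\<lambda>t. norm (adj (R t) y)) F \<le> norm y"
    proof -
      have "(\<Sum>t\<in>F. (norm (adj (R t) y))\<^sup>2) \<le> (\<Sum>t<T. (norm (adj (R t) y))\<^sup>2)" using T by (intro sum_mono2) auto
      also have "\<dots> \<le> (norm y)\<^sup>2" by (rule R)
      finally show ?thesis unfolding L2_set_def by (intro real_le_lsqrt) auto
    qed
    have "cmod (cinner x ((\<Sum>t\<in>F. \<alpha> t *\<^sub>R w t) y)) = cmod (\<Sum>t\<in>F. of_real (\<alpha> t) * cinner x (w t y))"
      by (simp add: blinfun.sum_left cinner_sum_right blinfun.scaleR_left cinner_simps)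
    also have "\<dots> \<le> (\<Sum>t\<in>F. \<bar>norm (adj (L (s' t)) x)\<bar> * \<bar>norm (adj (R t) y)\<bar>)"
    proof (rule sum_norm_le)
      fix t assume "t \<in> F"
      have "norm (z (s (s' t)) (adj (R t) y)) \<le> 1 * norm (adj (R t) y)"
        by (intro order_trans[OF norm_blinfun] mult_right_mono nz) auto
      then have "cmod (cinner x (w t y)) \<le> norm (adj (L (s' t)) x) * norm (adj (R t) y)"
        unfolding wf by (intro order_trans[OF Cauchy_Schwarz_cinner] mult_left_mono) auto
      moreover have "\<bar>\<alpha> t\<bar> * cmod (cinner x (w t y)) \<le> 1 * cmod (cinner x (w t y))"
        using \<alpha> \<open>t \<in> F\<close> by (intro mult_right_mono) auto
      ultimately show "cmod (of_real (\<alpha> t) * cinner x (w t y)) \<le> \<bar>norm (adj (L (s' t)) x)\<bar> * \<bar>norm (adj (R t) y)\<bar>"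
        by (simp add: norm_mult)
    qed
    also have "\<dots> \<le> L2_set (\<lambda>t. norm (adj (L (s' t)) x)) F * L2_set (\<lambda>t. norm (adj (R t) y)) F"
      by (rule L2_set_mult_ineq)
    also have "\<dots> \<le> norm x * norm y" by (intro mult_mono Lx Ry) auto
    finally show "cmod (cinner x ((\<Sum>t\<in>F. \<alpha> t *\<^sub>R w t) y)) \<le> 1 * norm x * norm y" by simp
  qed simp
  ultimately show ?thesis using \<open>0 < \<delta>\<close> wY
    by (intro exI[of _ w] exI[of _ "\<lambda>t. s (s' t)"] exI[of _ \<delta>]) auto
qed

end

section \<open>Almost isometric copies of \<open>c\<^sub>0\<close>\<close>

text \<open>
  James's distortion theorem for \<open>c\<^sub>0\<close>. The least upper bounds of the norms of the combinations of \<open>e\<^sub>n, e\<^sub>n\<^sub>+\<^sub>1, \<dots>\<close> with coefficients in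
  \<open>[-1, 1]\<close> decrease to some \<open>q > 0\<close>. Beyond an \<open>n\<close> where they are below \<open>(1 + \<kappa>) q\<close>, choose successive blocks
  of norm at least \<open>(1 - \<kappa>) q\<close>.
\<close>

lemma c0_distortion:
  fixes e :: "nat \<Rightarrow> 'a::real_normed_vector"
  assumes bound: "\<And>F \<alpha>. finite F \<Longrightarrow> (\<And>t. t \<in> F \<Longrightarrow> \<bar>\<alpha> t\<bar> \<le> 1) \<Longrightarrow> norm (\<Sum>t\<in>F. \<alpha> t *\<^sub>R e t) \<le> C"
    and lower: "\<And>t. \<delta> \<le> norm (e t)" and "0 < \<delta>" and "0 < \<kappa>"
  shows "\<exists>u q. 0 < q \<and> (\<forall>j::nat. \<exists>F \<alpha>. u j = (\<Sum>t\<in>F. \<alpha> t *\<^sub>R e t)) \<and>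
    (\<forall>j. q * (1 - \<kappa>) \<le> norm (u j)) \<and>
    (\<forall>J \<sigma>. finite J \<longrightarrow> (\<forall>j\<in>J. \<bar>\<sigma> j\<bar> \<le> 1) \<longrightarrow> norm (\<Sum>j\<in>J. \<sigma> j *\<^sub>R u j) \<le> q * (1 + \<kappa>))"
proof -
  define A where "A n = {norm (\<Sum>t\<in>F. \<alpha> t *\<^sub>R e t) | F \<alpha>. finite F \<and> F \<subseteq> {n..} \<and> (\<forall>t\<in>F. \<bar>\<alpha> t\<bar> \<le> 1)}" for n
  define p where "p n = Sup (A n)" for n
  have bdd: "bdd_above (A n)" for n unfolding A_def using bound by (auto intro!: bdd_aboveI[of _ C])
  have inA: "norm (\<Sum>t\<in>F. \<alpha> t *\<^sub>R e t) \<in> A n" if "finite F" "F \<subseteq> {n..}" "\<And>t. t \<in> F \<Longrightarrow> \<bar>\<alpha> t\<bar> \<le> 1" for F \<alpha> n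
    unfolding A_def using that by blast
  have le_p: "norm (\<Sum>t\<in>F. \<alpha> t *\<^sub>R e t) \<le> p n" if "finite F" "F \<subseteq> {n..}" "\<And>t. t \<in> F \<Longrightarrow> \<bar>\<alpha> t\<bar> \<le> 1" for F \<alpha> n
    unfolding p_def by (rule cSup_upper[OF inA[OF that] bdd])
  have p_lower: "\<delta> \<le> p n" for n
    using le_p[of "{n}" n "\<lambda>_. 1"] lower[of n] by simp
  define q where "q = Inf (range p)"
  have bddp: "bdd_below (range p)" using p_lower by (auto intro!: bdd_belowI[of _ \<delta>])
  have q_le: "q \<le> p n" for n unfolding q_def by (rule cInf_lower[OF _ bddp]) simp
  have "\<delta> \<le> q" unfolding q_def using p_lower by (intro cInf_greatest) auto
  then have "0 < q" using \<open>0 < \<delta>\<close> by simp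
  have "q < q * (1 + \<kappa>)" using \<open>0 < q\<close> \<open>0 < \<kappa>\<close> by simp
  then obtain n where n: "p n < q * (1 + \<kappa>)" using cInf_lessD[of "range p" "q * (1 + \<kappa>)"] unfolding q_def by auto
  have block: "\<exists>F \<alpha>. finite F \<and> F \<subseteq> {m..} \<and> (\<forall>t\<in>F. \<bar>\<alpha> t\<bar> \<le> 1) \<and> q * (1 - \<kappa>) \<le> norm (\<Sum>t\<in>F. \<alpha> t *\<^sub>R e t)" for m
  proof -
    have "q * (1 - \<kappa>) < q * 1" using \<open>0 < q\<close> \<open>0 < \<kappa>\<close> by (intro mult_strict_left_mono) auto
    then have "q * (1 - \<kappa>) < p m" using q_le[of m] by simp
    moreover have "A m \<noteq> {}" using inA[of "{}" m "\<lambda>_. 0"] by auto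
    ultimately obtain x where "x \<in> A m" "q * (1 - \<kappa>) < x" unfolding p_def using less_cSupD by blast
    then show ?thesis unfolding A_def by (auto intro: less_imp_le)
  qed
  define ok where "ok r \<longleftrightarrow> finite (fst r) \<and> fst r \<subseteq> {n..} \<and> (\<forall>t\<in>fst r. \<bar>snd r t\<bar> \<le> 1) \<and>
      q * (1 - \<kappa>) \<le> norm (\<Sum>t\<in>fst r. snd r t *\<^sub>R e t)" for r :: "nat set \<times> (nat \<Rightarrow> real)"
    define ch where "ch f j r \<longleftrightarrow> ok r \<and> (\<forall>i<j. finite (fst (f i)) \<longrightarrow> (\<forall>s\<in>fst (f i). \<forall>t\<in>fst r. s < t))"
      for f :: "nat \<Rightarrow> nat set \<times> (nat \<Rightarrow> real)" and j :: nat and r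
    have "\<exists>f. \<forall>j. ch f j (f j)"
    proof (rule dependent_wellorder_choice[where P = ch])
      fix j :: nat and f :: "nat \<Rightarrow> nat set \<times> (nat \<Rightarrow> real)"
      define U where "U = (\<Union>i\<in>{i. i < j \<and> finite (fst (f i))}. fst (f i))"
      have "finite U" unfolding U_def by auto
      then obtain b where b: "U \<subseteq> {..<b}" using finite_nat_bounded by blast
      obtain F \<alpha> where F: "finite F" "F \<subseteq> {max n b..}" "\<forall>t\<in>F. \<bar>\<alpha> t\<bar> \<le> 1" "q * (1 - \<kappa>) \<le> norm (\<Sum>t\<in>F. \<alpha> t *\<^sub>R e t)"
        using block[of "max n b"] by blast
      have "s < t" if "i < j" "finite (fst (f i))" "s \<in> fst (f i)" "t \<in> F" for i s t
      proof -
        have "s \<in> U" using that unfolding U_def by blast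
        then show ?thesis using b F(2) that(4) by fastforce
      qed
      moreover have "ok (F, \<alpha>)" unfolding ok_def using F by auto
      ultimately show "\<exists>r. ch f j r" unfolding ch_def by (intro exI[of _ "(F, \<alpha>)"]) auto
    qed (simp add: ch_def)
    then obtain f where f: "\<forall>j. ch f j (f j)" by (elim exE) (rule that)
  have okf: "ok (f j)" for j using f unfolding ch_def by simp
  then have "finite (fst (f i))" for i unfolding ok_def by simp
  then have f: "ok (f j)" "\<And>i s t. i < j \<Longrightarrow> s \<in> fst (f i) \<Longrightarrow> t \<in> fst (f j) \<Longrightarrow> s < t" for j
    using f unfolding ch_def by simp_all
  define F where "F j = fst (f j)" for j
  define \<alpha> where "\<alpha> j = snd (f j)" for j
  have F: "finite (F j)" "F j \<subseteq> {n..}" "\<And>t. t \<in> F j \<Longrightarrow> \<bar>\<alpha> j t\<bar> \<le> 1" "q * (1 - \<kappa>) \<le> norm (\<Sum>t\<in>F j. \<alpha> j t *\<^sub>R e t)" for j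
    using f(1)[of j] unfolding ok_def F_def \<alpha>_def by auto
  have disj: "F i \<inter> F j = {}" if "i \<noteq> j" for i j
    using f(2)[of i j] f(2)[of j i] that unfolding F_def by (cases i j rule: linorder_cases) fastforce+
  define u where "u j = (\<Sum>t\<in>F j. \<alpha> j t *\<^sub>R e t)" for j
  have "norm (\<Sum>j\<in>J. \<sigma> j *\<^sub>R u j) \<le> q * (1 + \<kappa>)" if J: "finite J" and \<sigma>: "\<forall>j\<in>J. \<bar>\<sigma> j\<bar> \<le> 1" for J \<sigma>
  proof -
    define idx where "idx t = (THE j. t \<in> F j)" for t
    have idx: "idx t = j" if "t \<in> F j" for t j
      unfolding idx_def using that disj by (intro the_equality) auto
    define \<beta> where "\<beta> t = \<sigma> (idx t) * \<alpha> (idx t) t" for t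
    have "(\<Sum>j\<in>J. \<sigma> j *\<^sub>R u j) = (\<Sum>j\<in>J. \<Sum>t\<in>F j. \<beta> t *\<^sub>R e t)"
      unfolding u_def scaleR_sum_right by (intro sum.cong refl) (simp add: \<beta>_def idx)
    also have "\<dots> = (\<Sum>t\<in>(\<Union>j\<in>J. F j). \<beta> t *\<^sub>R e t)"
      using J F(1) disj by (intro sum.UNION_disjoint[symmetric]) auto
    also have "norm \<dots> \<le> p n"
    proof (rule le_p)
      show "finite (\<Union>j\<in>J. F j)" "(\<Union>j\<in>J. F j) \<subseteq> {n..}" using J F(1,2) by blast+
      fix t assume "t \<in> (\<Union>j\<in>J. F j)"
      then obtain j where j: "j \<in> J" "t \<in> F j" by blast
      have "\<bar>\<sigma> j\<bar> * \<bar>\<alpha> j t\<bar> \<le> 1 * 1" using \<sigma> j F(3) by (intro mult_mono) auto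
      then show "\<bar>\<beta> t\<bar> \<le> 1" using idx[OF j(2)] by (simp add: \<beta>_def abs_mult)
    qed
    finally show ?thesis using n by simp
  qed
  then show ?thesis using \<open>0 < q\<close> F(4) by (intro exI[of _ u] exI[of _ q]) (auto simp: u_def)
qed

section \<open>The extension constant 2\<close>

text \<open>The identity of \<open>X\<close> extends to \<open>Y\<close>. The maximum is there for negative \<open>lam\<close>, which forces \<open>Q = 0\<close>.\<close>

lemma bounded_projection:
  fixes X Y :: "('k::complex_hilbert_space \<Rightarrow>\<^sub>L 'k) set"
  assumes csep: "CSEP TYPE('k) lam X" and X: "operator_space X" and Y: "operator_space Y" "X \<subseteq> Y"
    and sep: "separable_space (top_of_set Y)"
  shows "\<exists>Q C. clinear_on Y Q \<and> (\<forall>a\<in>Y. Q a \<in> X) \<and> (\<forall>a\<in>X. Q a = a) \<and> 0 \<le> C \<and> (\<forall>a\<in>Y. norm (Q a) \<le> C * norm a) \<and>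
    C \<le> max lam 0"
proof -
  have cs: "csubspace X" "csubspace Y" using X Y(1) by (auto simp: operator_space_def)
  have id: "completely_bounded X X (\<lambda>a. a)" "cb_norm X (\<lambda>a. a) \<le> 1"
    by (rule completely_boundedI[of X "\<lambda>a. a" X 1]; simp add: clinear_on_def)+
  obtain Q where Q: "completely_bounded Y X Q" "\<forall>a\<in>X. Q a = a" "cb_norm Y Q \<le> lam * cb_norm X (\<lambda>a. a)"
    using csep X Y sep id(1) unfolding CSEP_def cb_extension_property_def by blast
  have "lam * cb_norm X (\<lambda>a. a) \<le> max lam 0 * 1"
    using id(2) cb_norm_nonneg[OF id(1)] by (intro mult_mono) auto
  then have "cb_norm Y Q \<le> max lam 0" using Q(3) by simp
  then show ?thesis
    using Q(1,2) cb_norm_nonneg[OF Q(1)] cb_norm_bound_1[OF Q(1) cs(2)]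
    by (intro exI[of _ Q] exI[of _ "cb_norm Y Q"]) (auto simp: completely_bounded_def)
qed

text \<open>
  The operator \<open>y\<close> will be the weak sum of a series in \<open>X\<close>; the algebra provides adjoints and resolvents within the domain of a
  projection onto \<open>X\<close>.
\<close>

lemma separable_extension:
  fixes X :: "('k::complex_hilbert_space \<Rightarrow>\<^sub>L 'k) set"
  assumes X: "operator_space X" and sep: "separable_space (top_of_set X)" and y: "clin y"
  shows "\<exists>Y D. cstar_algebra Y \<and> insert y X \<subseteq> Y \<and> countable D \<and> D \<subseteq> Y \<and> Y \<subseteq> closure D"
proof -
  obtain D where D: "countable D" "D \<subseteq> X" "X \<subseteq> closure D"
    using sep unfolding separable_space_def by (auto simp: closure_of_subtopology inf.absorb2)
  define s where "s = from_nat_into (insert y D)"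
  have rs: "range s = insert y D" unfolding s_def using D(1) by (intro range_from_nat_into) auto
  have cl: "clin (s n)" for n
  proof -
    have "s n \<in> insert y D" using rs by blast
    then show ?thesis using y X D(2) unfolding operator_space_def by blast
  qed
  note C = cstar_algebra_generated[of s, OF cl] generated_cstar_mem[of s, OF cl]
  have sub: "insert y D \<subseteq> generated_cstar s" using C(2) unfolding rs[symmetric] by blast
  have "closed (generated_cstar s)" by (simp add: generated_cstar_def)
  then have "closure D \<subseteq> generated_cstar s" using sub by (intro closure_minimal) auto
  then have "insert y X \<subseteq> generated_cstar s" using D(3) sub by blast
  moreover have "countable (range (opval s))" "range (opval s) \<subseteq> generated_cstar s" "generated_cstar s \<subseteq> closure (range (opval s))"
    unfolding generated_cstar_def by (auto intro: closure_subset[THEN subsetD])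
  ultimately show ?thesis using C(1) by blast
qed

text \<open>
  The series converges weakly, since bounded signed sums make the matrix coefficients absolutely summable. Subtracting \<open>2 \<sigma>\<^sub>j u\<^sub>j\<close> only
  flips one sign, which does not change the bound.
\<close>

lemma signed_series_operator:
  fixes u :: "nat \<Rightarrow> 'k::complex_hilbert_space \<Rightarrow>\<^sub>L 'k"
  assumes clin: "\<And>j. clin (u j)"
    and bound: "\<And>J \<sigma>. finite J \<Longrightarrow> (\<And>j. j \<in> J \<Longrightarrow> \<bar>\<sigma> j\<bar> \<le> 1) \<Longrightarrow> norm (\<Sum>j\<in>J. \<sigma> j *\<^sub>R u j) \<le> B"
    and \<sigma>: "\<And>j. \<bar>\<sigma> j\<bar> = (1::real)"
  shows "\<exists>y. clin y \<and> (\<forall>j. norm (y - (2 * \<sigma> j) *\<^sub>R u j) \<le> B)"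
proof -
  have B: "0 \<le> B" using bound[of "{}"] by simp
  have summ: "summable (\<lambda>j. cmod (cinner x (u j z)))" for x z
  proof (rule summableI_nonneg_bounded)
    fix n
    have part: "(\<Sum>j<n. \<bar>r (cinner x (u j z))\<bar>) \<le> B * norm x * norm z"
      if r: "\<And>a b. r (a + b) = r a + r b" "\<And>t a. r (of_real t * a) = t * r a" "\<And>a. \<bar>r a\<bar> \<le> cmod a"
      for r :: "complex \<Rightarrow> real"
    proof -
      have r0: "r 0 = 0" using r(2)[of 0 0] by simp
      have rsum: "r (\<Sum>j\<in>I. f j) = (\<Sum>j\<in>I. r (f j))" for I :: "nat set" and f
        by (induction I rule: infinite_finite_induct) (auto simp: r r0)
      define s where "s j = sgn (r (cinner x (u j z)))" for j
      have "(\<Sum>j<n. \<bar>r (cinner x (u j z))\<bar>) = r (\<Sum>j<n. of_real (s j) * cinner x (u j z))"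
        unfolding rsum by (intro sum.cong refl) (auto simp: r(2) s_def sgn_real_def)
      also have "(\<Sum>j<n. of_real (s j) * cinner x (u j z)) = cinner x ((\<Sum>j<n. s j *\<^sub>R u j) z)"
        by (simp add: blinfun.sum_left cinner_sum_right blinfun.scaleR_left cinner_simps)
      also have "r \<dots> \<le> cmod \<dots>" using r(3) by (meson abs_le_D1)
      also have "\<dots> \<le> norm x * norm z * norm (\<Sum>j<n. s j *\<^sub>R u j)" by (rule cmod_cinner_blinfun_le)
      also have "\<dots> \<le> norm x * norm z * B"
        by (intro mult_left_mono bound) (auto simp: s_def sgn_real_def)
      finally show ?thesis by (simp add: ac_simps)
    qed
    have "(\<Sum>j<n. cmod (cinner x (u j z))) \<le> (\<Sum>j<n. \<bar>Re (cinner x (u j z))\<bar> + \<bar>Im (cinner x (u j z))\<bar>)"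
      by (intro sum_mono cmod_le)
    also have "\<dots> \<le> B * norm x * norm z + B * norm x * norm z"
      unfolding sum.distrib by (intro add_mono part) (auto simp: abs_Re_le_cmod abs_Im_le_cmod)
    finally show "(\<Sum>j<n. cmod (cinner x (u j z))) \<le> B * norm x * norm z + B * norm x * norm z" .
  qed simp
  have op: "\<exists>y. clin y \<and> norm y \<le> B \<and> (\<forall>x z. cinner x (blinfun_apply y z) = (\<Sum>j. of_real (\<tau> j) * cinner x (u j z)))"
    if \<tau>: "\<And>j. \<bar>\<tau> j\<bar> \<le> 1" for \<tau> :: "nat \<Rightarrow> real"
  proof (rule bounded_form_operator[OF _ _ _ _ _ B])
    have sm: "summable (\<lambda>j. of_real (\<tau> j) * cinner x (u j z))" for x z
    proof (rule summable_comparison_test[OF _ summ])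
      show "\<exists>N. \<forall>n\<ge>N. cmod (of_real (\<tau> n) * cinner x (u n z)) \<le> cmod (cinner x (u n z))"
        using \<tau> by (auto simp: norm_mult intro!: mult_left_le_one_le)
    qed
    show "(\<Sum>j. of_real (\<tau> j) * cinner (x + x') (u j z)) = (\<Sum>j. of_real (\<tau> j) * cinner x (u j z)) + (\<Sum>j. of_real (\<tau> j) * cinner x' (u j z))" for x x' z
      by (simp add: suminf_add sm cinner_simps distrib_left)
    show "(\<Sum>j. of_real (\<tau> j) * cinner (a *\<^sub>C x) (u j z)) = cnj a * (\<Sum>j. of_real (\<tau> j) * cinner x (u j z))" for a x z
      using suminf_mult[OF sm[of x z], of "cnj a"] by (simp add: cinner_simps ac_simps)
    show "(\<Sum>j. of_real (\<tau> j) * cinner x (u j (z + z'))) = (\<Sum>j. of_real (\<tau> j) * cinner x (u j z)) + (\<Sum>j. of_real (\<tau> j) * cinner x (u j z'))" for x z z'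
      by (simp add: suminf_add sm cinner_simps distrib_left blinfun.add_right)
    show "(\<Sum>j. of_real (\<tau> j) * cinner x (u j (a *\<^sub>C z))) = a * (\<Sum>j. of_real (\<tau> j) * cinner x (u j z))" for a x z
      using suminf_mult[OF sm[of x z], of a] by (simp add: cinner_simps clin_scaleC[OF clin] ac_simps)
    show "cmod (\<Sum>j. of_real (\<tau> j) * cinner x (u j z)) \<le> B * norm x * norm z" for x z
    proof (rule LIMSEQ_le_const2[OF tendsto_norm[OF summable_LIMSEQ[OF sm]]], intro exI allI impI)
      fix n
      have "(\<Sum>j<n. of_real (\<tau> j) * cinner x (u j z)) = cinner x ((\<Sum>j<n. \<tau> j *\<^sub>R u j) z)"
        by (simp add: blinfun.sum_left cinner_sum_right blinfun.scaleR_left cinner_simps)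
      also have "cmod \<dots> \<le> norm x * norm z * norm (\<Sum>j<n. \<tau> j *\<^sub>R u j)" by (rule cmod_cinner_blinfun_le)
      also have "\<dots> \<le> norm x * norm z * B" by (intro mult_left_mono bound \<tau>) auto
      finally show "cmod (\<Sum>j<n. of_real (\<tau> j) * cinner x (u j z)) \<le> B * norm x * norm z" by (simp add: ac_simps)
    qed
  qed
  obtain y where y: "clin y" "\<And>x z. cinner x (blinfun_apply y z) = (\<Sum>j. of_real (\<sigma> j) * cinner x (u j z))"
  proof -
    have "\<bar>\<sigma> j\<bar> \<le> 1" for j using \<sigma>[of j] by simp
    from op[of \<sigma>, OF this] show ?thesis by (elim exE conjE) (rule that, assumption, blast)
  qed
  have "norm (y - (2 * \<sigma> i) *\<^sub>R u i) \<le> B" for i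
  proof -
    obtain y' where y': "norm y' \<le> B" "\<And>x z. cinner x (blinfun_apply y' z) = (\<Sum>j. of_real ((\<sigma>(i := - \<sigma> i)) j) * cinner x (u j z))"
    proof -
      have "\<bar>(\<sigma>(i := - \<sigma> i)) j\<bar> \<le> 1" for j using \<sigma>[of i] \<sigma>[of j] by simp
      from op[of "\<sigma>(i := - \<sigma> i)", OF this] show ?thesis by (elim exE conjE) (rule that, assumption, blast)
    qed
    have "y - (2 * \<sigma> i) *\<^sub>R u i = y'"
    proof (intro blinfun_eqI cinner_eqI)
      fix z x
      let ?a = "\<lambda>j. of_real (\<sigma> j) * cinner x (u j z)"
      let ?b = "\<lambda>j. of_real ((\<sigma>(i := - \<sigma> i)) j) * cinner x (u j z)"
      have sa: "summable ?a"
      proof (rule summable_norm_cancel)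
        have "norm (?a j) = cmod (cinner x (u j z))" for j by (simp add: norm_mult \<sigma>)
        then show "summable (\<lambda>j. norm (?a j))" using summ[of x z] by simp
      qed
      have "?b = (\<lambda>j. ?a j - (if j = i then 2 * ?a i else 0))" by auto
      then have "(\<Sum>j. ?b j) = (\<Sum>j. ?a j) - (\<Sum>j. if j = i then 2 * ?a i else 0)"
        using sa by (simp add: suminf_diff)
      also have "(\<Sum>j. if j = i then 2 * ?a i else 0) = 2 * ?a i"
        using suminf_finite[of "{i}" "\<lambda>j. if j = i then 2 * ?a i else 0"] by simp
      finally show "cinner x ((y - (2 * \<sigma> i) *\<^sub>R u i) z) = cinner x (y' z)"
        by (simp add: blinfun.bilinear_simps cinner_simps y(2) y'(2))
    qed
    then show ?thesis using y'(1) by simp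
  qed
  with y(1) show ?thesis by blast
qed

text \<open>
  \<open>w = Q y\<close>, with \<open>y\<close> the sum of the series with signs \<open>\<sigma>\<close>, lies within \<open>\<mu> (1 + \<kappa>) q\<close> of \<open>2 \<sigma>\<^sub>j u\<^sub>j\<close>, which is less than the norm of
  \<open>2 u\<^sub>j\<close>. So a functional norming \<open>u\<^sub>j\<close> reads the sign \<open>\<sigma>\<^sub>j\<close> off \<open>w\<close>, and different choices of signs give
  points of \<open>X\<close> at a distance bounded below. There are uncountably many of them.
\<close>

lemma separable_CSEP_no_c0:
  fixes X :: "('k::complex_hilbert_space \<Rightarrow>\<^sub>L 'k) set" and e :: "nat \<Rightarrow> 'k \<Rightarrow>\<^sub>L 'k"
  assumes X: "operator_space X" and sep: "separable_space (top_of_set X)"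
    and csep: "CSEP TYPE('k) lam X" and "lam < 2"
    and eX: "\<And>t. e t \<in> X"
    and bound: "\<And>F \<alpha>. finite F \<Longrightarrow> (\<And>t. t \<in> F \<Longrightarrow> \<bar>\<alpha> t\<bar> \<le> 1) \<Longrightarrow> norm (\<Sum>t\<in>F. \<alpha> t *\<^sub>R e t) \<le> C"
    and lower: "\<And>t. \<delta> \<le> norm (e t)" and "0 < \<delta>"
  shows False
proof -
  have cs: "csubspace X" using X by (simp add: operator_space_def)
  define \<mu> where "\<mu> = max lam 0"
  have \<mu>: "0 \<le> \<mu>" "\<mu> < 2" using \<open>lam < 2\<close> by (auto simp: \<mu>_def)
  \<comment> \<open>small enough for \<open>2 (1 - 2 \<kappa>) - \<mu> (1 + \<kappa>) \<ge> (2 - \<mu>) / 4\<close>\<close>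
  define \<kappa> where "\<kappa> = (2 - \<mu>) / 8"
  have \<kappa>: "0 < \<kappa>" using \<mu> by (simp add: \<kappa>_def)
  have "\<exists>u q. 0 < q \<and> (\<forall>j::nat. \<exists>F \<alpha>. u j = (\<Sum>t\<in>F. \<alpha> t *\<^sub>R e t)) \<and>
    (\<forall>j. q * (1 - \<kappa>) \<le> norm (u j)) \<and>
    (\<forall>J \<sigma>. finite J \<longrightarrow> (\<forall>j\<in>J. \<bar>\<sigma> j\<bar> \<le> 1) \<longrightarrow> norm (\<Sum>j\<in>J. \<sigma> j *\<^sub>R u j) \<le> q * (1 + \<kappa>))"
    by (rule c0_distortion[where e = e and C = C and \<delta> = \<delta> and \<kappa> = \<kappa>, OF _ lower \<open>0 < \<delta>\<close> \<kappa>])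
      (use bound in blast)
  then obtain u q where "0 < q" and uF: "\<forall>j::nat. \<exists>F \<alpha>. u j = (\<Sum>t\<in>F. \<alpha> t *\<^sub>R e t)"
    and u_lower: "\<forall>j. q * (1 - \<kappa>) \<le> norm (u j)"
    and u_upper: "\<forall>J \<sigma>. finite J \<longrightarrow> (\<forall>j\<in>J. \<bar>\<sigma> j\<bar> \<le> 1) \<longrightarrow> norm (\<Sum>j\<in>J. \<sigma> j *\<^sub>R u j) \<le> q * (1 + \<kappa>)"
    by (elim exE conjE) (rule that)
  have uX: "u j \<in> X" for j
  proof -
    obtain F \<alpha> where "u j = (\<Sum>t\<in>F. \<alpha> t *\<^sub>R e t)" using uF by blast
    then show ?thesis using eX by (simp add: csubspace_sum csubspace_scaleR cs)
  qed
  have uclin: "clin (u j)" for j using uX X by (simp add: operator_space_def)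
  have "\<exists>p r. norm p \<le> 1 \<and> norm r \<le> 1 \<and> q * (1 - 2 * \<kappa>) < Re (cinner p (u j r))" for j
  proof -
    have "q * (1 - 2 * \<kappa>) < q * (1 - \<kappa>)" using \<open>0 < q\<close> \<kappa> by (intro mult_strict_left_mono) auto
    then show ?thesis using u_lower by (intro blinfun_norm_attains) (auto intro: less_le_trans)
  qed
  then obtain p r where p: "\<And>j. norm (p j) \<le> 1" and r: "\<And>j. norm (r j) \<le> 1"
    and pr: "\<And>j. q * (1 - 2 * \<kappa>) < Re (cinner (p j) (u j (r j)))" by metis
  define g where "g j a = Re (cinner (p j) (blinfun_apply a (r j)))" for j and a :: "'k \<Rightarrow>\<^sub>L 'k"
  have g_le: "\<bar>g j a\<bar> \<le> norm a" for j a
  proof -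
    have "\<bar>g j a\<bar> \<le> norm (p j) * norm (r j) * norm a"
      unfolding g_def using abs_Re_le_cmod cmod_cinner_blinfun_le order_trans by blast
    also have "\<dots> \<le> 1 * 1 * norm a" using p r by (intro mult_right_mono mult_mono) auto
    finally show ?thesis by simp
  qed
  have g_diff: "g j (a - b) = g j a - g j b" and g_scale: "g j (t *\<^sub>R a) = t * g j a" for j a b t
    by (simp_all add: g_def blinfun.bilinear_simps cinner_simps)
  define \<gamma> where "\<gamma> = q * ((2 - \<mu>) / 4)"
  have "0 < \<gamma>" unfolding \<gamma>_def using \<open>0 < q\<close> \<mu> by simp
  define \<sigma> where "\<sigma> M j = (if j \<in> M then 1 else - 1 :: real)" for M :: "nat set" and j
  have "\<exists>w\<in>X. \<forall>j. \<gamma> \<le> \<sigma> M j * g j w" for M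
  proof -
    obtain y where y: "clin y" "\<And>j. norm (y - (2 * \<sigma> M j) *\<^sub>R u j) \<le> q * (1 + \<kappa>)"
    proof -
      have "\<exists>y. clin y \<and> (\<forall>j. norm (y - (2 * \<sigma> M j) *\<^sub>R u j) \<le> q * (1 + \<kappa>))"
      proof (rule signed_series_operator[where u = u and \<sigma> = "\<sigma> M", OF uclin])
        show "\<bar>\<sigma> M j\<bar> = 1" for j by (simp add: \<sigma>_def)
      qed (use u_upper in blast)
      then show ?thesis using that by blast
    qed
    obtain Y D where Y: "cstar_algebra Y" "insert y X \<subseteq> Y" "countable D" "D \<subseteq> Y" "Y \<subseteq> closure D"
      using separable_extension[OF X sep y(1)] by blast
    interpret cstar_algebra Y by (rule Y(1))
    obtain Q C where Q: "clinear_on Y Q" "\<forall>a\<in>Y. Q a \<in> X" "\<forall>a\<in>X. Q a = a" "0 \<le> C"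
      "\<forall>a\<in>Y. norm (Q a) \<le> C * norm a" "C \<le> max lam 0"
      using bounded_projection[OF csep X operator_space] Y(2,3,5) separable_space_iff[of Y] by blast
    have Qlin: "Q (a + b) = Q a + Q b" "Q (c *\<^sub>C a) = c *\<^sub>C Q a" if "a \<in> Y" "b \<in> Y" for a b c
      using Q(1) that by (auto simp: clinear_on_def)
    have yY: "y \<in> Y" and uY: "u j \<in> Y" for j using Y(2) uX by auto
    have "\<gamma> \<le> \<sigma> M j * g j (Q y)" for j
    proof -
      let ?a = "y - (2 * \<sigma> M j) *\<^sub>R u j"
      have aY: "?a \<in> Y" by (intro diff_mem yY scaleR_mem uY)
      have "?a = y + of_real (- 2 * \<sigma> M j) *\<^sub>C u j" unfolding scaleC_of_real by simp
      then have "Q ?a = Q y + of_real (- 2 * \<sigma> M j) *\<^sub>C Q (u j)"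
        using Qlin yY uY scaleC_mem by metis
      then have Qa: "Q ?a = Q y - (2 * \<sigma> M j) *\<^sub>R u j" using Q(3) uX unfolding scaleC_of_real by simp
      have "norm (Q ?a) \<le> C * norm ?a" using Q(5) aY by blast
      also have "\<dots> \<le> \<mu> * (q * (1 + \<kappa>))"
        using Q(4,6) y(2)[of j] unfolding \<mu>_def by (intro mult_mono) auto
      finally have "\<bar>g j (Q ?a)\<bar> \<le> \<mu> * (q * (1 + \<kappa>))" using g_le[of j "Q ?a"] by linarith
      moreover have "\<bar>\<sigma> M j\<bar> = 1" by (simp add: \<sigma>_def)
      ultimately have "\<bar>\<sigma> M j * g j (Q ?a)\<bar> \<le> \<mu> * (q * (1 + \<kappa>))" unfolding abs_mult by simp
      moreover have "\<sigma> M j * g j (Q ?a) = \<sigma> M j * g j (Q y) - 2 * g j (u j)"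
        unfolding Qa g_diff g_scale by (simp add: \<sigma>_def)
      moreover have "q * (1 - 2 * \<kappa>) < g j (u j)" using pr[of j] by (simp add: g_def)
      ultimately have "2 * (q * (1 - 2 * \<kappa>)) - \<mu> * (q * (1 + \<kappa>)) \<le> \<sigma> M j * g j (Q y)" by linarith
      moreover have "\<gamma> \<le> 2 * (q * (1 - 2 * \<kappa>)) - \<mu> * (q * (1 + \<kappa>))"
      proof -
        have "(2 - \<mu>) / 4 \<le> 2 * (1 - 2 * \<kappa>) - \<mu> * (1 + \<kappa>)"
        proof -
          have "\<mu> * \<kappa> \<le> 2 * \<kappa>" using \<mu> \<kappa> by (intro mult_right_mono) auto
          then show ?thesis unfolding \<kappa>_def by (simp add: field_simps)
        qed
        then have "q * ((2 - \<mu>) / 4) \<le> q * (2 * (1 - 2 * \<kappa>) - \<mu> * (1 + \<kappa>))"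
          using \<open>0 < q\<close> by (intro mult_left_mono) auto
        then show ?thesis unfolding \<gamma>_def by (simp add: algebra_simps)
      qed
      ultimately show ?thesis by linarith
    qed
    then show ?thesis using Q(2) yY by blast
  qed
  then obtain w where wX: "\<And>M. w M \<in> X" and w: "\<And>M j. \<gamma> \<le> \<sigma> M j * g j (w M)" by metis
  have far: "2 * \<gamma> \<le> norm (w M - w N)" if MN: "M \<noteq> N" for M N
  proof -
    obtain j where "j \<in> M \<longleftrightarrow> j \<notin> N" using MN by blast
    then have "\<sigma> M j = - \<sigma> N j" by (auto simp: \<sigma>_def)
    then have "2 * \<gamma> \<le> \<sigma> M j * g j (w M - w N)" using w[of M j] w[of N j] by (simp add: g_diff algebra_simps)
    also have "\<dots> \<le> \<bar>g j (w M - w N)\<bar>" by (simp add: \<sigma>_def abs_ge_self abs_ge_minus_self)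
    also have "\<dots> \<le> norm (w M - w N)" by (rule g_le)
    finally show ?thesis .
  qed
  obtain D where D: "countable D" "X \<subseteq> closure D" using sep separable_space_iff[of X] by blast
  have "\<exists>d\<in>D. dist d (w M) < \<gamma>" for M
    using D(2) wX[of M] \<open>0 < \<gamma>\<close> closure_approachable[of "w M" D] by blast
  then obtain d where d: "\<And>M. d M \<in> D" "\<And>M. dist (d M) (w M) < \<gamma>" by metis
  have "inj d"
  proof (rule injI, rule ccontr)
    fix M N assume "d M = d N" "M \<noteq> N"
    then have "dist (w M) (w N) < 2 * \<gamma>" using d(2)[of M] d(2)[of N] dist_triangle2[of "w M" "w N" "d M"]
      by (simp add: dist_commute)
    then show False using far[OF \<open>M \<noteq> N\<close>] by (simp add: dist_norm)
  qed
  then have "inj (\<lambda>M. to_nat_on D (d M))"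
    using inj_on_to_nat_on[OF D(1)] d(1) by (auto simp: inj_on_def)
  then have "range (inv (\<lambda>M. to_nat_on D (d M))) = Pow UNIV"
    using inj_imp_surj_inv by auto
  then show False using Cantors_theorem by metis
qed

text \<open>
  A nonreflexive \<open>X\<close> carries a separated sequence. The projection \<open>Q\<close> of a C*-algebra onto \<open>X\<close> fixes the differences of successive
  averages, so vector functionals composed with \<open>Q\<close> norm them, and the image under \<open>Q\<close> of the block diagonal sequence obtained
  from these is a copy of the basis of \<open>c\<^sub>0\<close> in \<open>X\<close>.
\<close>

lemma separable_CSEP_reflexive:
  fixes X :: "('k::complex_hilbert_space \<Rightarrow>\<^sub>L 'k) set"
  assumes X: "operator_space X" and sep: "separable_space (top_of_set X)"
    and csep: "CSEP TYPE('k) lam X" and "lam < 2"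
  shows "reflexive X"
proof (rule ccontr)
  assume nr: "\<not> reflexive X"
  have cs: "csubspace X" "closed X" using X by (auto simp: operator_space_def)
  obtain x \<theta> where "0 < \<theta>" and xX: "\<And>k::nat. x k \<in> X" "\<And>k. norm (x k) \<le> 1"
    and apart: "\<And>n u v. u \<in> convex hull (x ` {..<n}) \<Longrightarrow> v \<in> convex hull (x ` {n..}) \<Longrightarrow> \<theta> \<le> norm (v - u)"
    using nonreflexive_separated_sequence[OF cs nr] by blast
  obtain Y D where Y: "cstar_algebra Y" "insert 0 X \<subseteq> Y" "countable D" "D \<subseteq> Y" "Y \<subseteq> closure D"
    using separable_extension[OF X sep clin_zero] by blast
  interpret cstar_algebra Y by (rule Y(1))
  obtain Q C where Q: "clinear_on Y Q" "\<forall>a\<in>Y. Q a \<in> X" "\<forall>a\<in>X. Q a = a" "0 \<le> C"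
    "\<forall>a\<in>Y. norm (Q a) \<le> C * norm a"
    using bounded_projection[OF csep X operator_space] Y(2,3,5) separable_space_iff[of Y] by blast
  have Qadd: "Q (a + b) = Q a + Q b" if "a \<in> Y" "b \<in> Y" for a b using Q(1) that by (auto simp: clinear_on_def)
  have Qscale: "Q (c *\<^sub>C a) = c *\<^sub>C Q a" if "a \<in> Y" for a c using Q(1) that by (auto simp: clinear_on_def)
  define R where "R \<phi> \<longleftrightarrow> (\<forall>a\<in>Y. cmod (\<phi> a) \<le> norm (Q a))" for \<phi> :: "('k \<Rightarrow>\<^sub>L 'k) \<Rightarrow> complex"
  have norming: "\<exists>\<phi>. bounded_functional Y (C + 1) \<phi> \<and> R \<phi> \<and> \<theta> / 2 \<le> Re (\<phi> (v - u))"
    if uv: "u \<in> convex hull (x ` {..<n})" "v \<in> convex hull (x ` {n..})" for n u v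
  proof -
    have hullX: "convex hull (x ` I) \<subseteq> X" for I
      by (rule hull_minimal) (auto simp: convex_def xX csubspace_add csubspace_scaleR cs)
    have "v - u \<in> X" using uv hullX csubspace_diff[OF cs(1)] by blast
    have "\<theta> / 2 < norm (v - u)" using apart[OF uv] \<open>0 < \<theta>\<close> by linarith
    then obtain p r where pr: "norm p \<le> 1" "norm r \<le> 1" "\<theta> / 2 < Re (cinner p ((v - u) r))"
      using blinfun_norm_attains by blast
    define \<phi> where "\<phi> a = cinner p (Q a r)" for a
    have le: "cmod (\<phi> a) \<le> norm (Q a)" for a
    proof -
      have "cmod (\<phi> a) \<le> norm p * norm r * norm (Q a)" unfolding \<phi>_def by (rule cmod_cinner_blinfun_le)
      also have "\<dots> \<le> 1 * 1 * norm (Q a)" using pr by (intro mult_right_mono mult_mono) auto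
      finally show ?thesis by simp
    qed
    have "bounded_functional Y (C + 1) \<phi>"
      unfolding bounded_functional_def
    proof (intro conjI ballI allI)
      show "\<phi> (a + b) = \<phi> a + \<phi> b" if "a \<in> Y" "b \<in> Y" for a b
        using that by (simp add: \<phi>_def Qadd blinfun.add_left cinner_simps)
      show "\<phi> (c *\<^sub>C a) = c * \<phi> a" if "a \<in> Y" for a c
        using that by (simp add: \<phi>_def Qscale cinner_simps)
      show "cmod (\<phi> a) \<le> (C + 1) * norm a" if a: "a \<in> Y" for a
      proof -
        have "cmod (\<phi> a) \<le> C * norm a" using le[of a] Q(5) a order_trans by blast
        also have "\<dots> \<le> (C + 1) * norm a" by (simp add: algebra_simps)
        finally show ?thesis .
      qed
    qed
    moreover have "R \<phi>" unfolding R_def using le by blast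
    moreover have "\<theta> / 2 \<le> Re (\<phi> (v - u))" using pr(3) Q(3) \<open>v - u \<in> X\<close> by (simp add: \<phi>_def)
    ultimately show ?thesis by blast
  qed
  have xY: "x k \<in> Y" for k using xX Y(2) by blast
  \<comment> \<open>\<open>C\<close> may be 0, but the disjointification divides by the bound of the functionals\<close>
  have C1: "0 \<le> C + 1" "0 < C + 1" using Q(4) by auto
  have "\<exists>z \<phi>. \<forall>i::nat. z i \<in> Y \<and> norm (z i) \<le> 1 \<and> bounded_functional Y (C + 1) (\<phi> i) \<and> R (\<phi> i) \<and>
      \<theta> / 2 / 2 \<le> Re (\<phi> i (z i)) \<and> left_null (\<phi> i) z \<and> right_null (\<phi> i) z"
    by (rule null_differences[where R = R and x = x, OF Y(3,4,5) xY xX(2) C1(1)]) (rule norming)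
  then obtain z \<phi> where z\<phi>: "\<forall>i::nat. z i \<in> Y \<and> norm (z i) \<le> 1 \<and> bounded_functional Y (C + 1) (\<phi> i) \<and> R (\<phi> i) \<and>
      \<theta> / 2 / 2 \<le> Re (\<phi> i (z i)) \<and> left_null (\<phi> i) z \<and> right_null (\<phi> i) z"
    by (elim exE) (rule that)
  have "\<exists>w s \<delta>. 0 < \<delta> \<and> (\<forall>t. w t \<in> Y) \<and> (\<forall>t::nat. \<delta> \<le> cmod (\<phi> (s t) (w t))) \<and>
    (\<forall>F \<alpha>. finite F \<longrightarrow> (\<forall>t\<in>F. \<bar>\<alpha> t\<bar> \<le> 1) \<longrightarrow> norm (\<Sum>t\<in>F. \<alpha> t *\<^sub>R w t) \<le> (1::real))"
    using z\<phi> C1(2) \<open>0 < \<theta>\<close> by (intro orthogonal_sequence[where z = z and \<epsilon> = "\<theta> / 2 / 2"]) auto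
  then obtain w s \<delta> where "0 < \<delta>" and wY: "\<forall>t. w t \<in> Y" and big: "\<forall>t::nat. \<delta> \<le> cmod (\<phi> (s t) (w t))"
    and wb: "\<forall>F \<alpha>. finite F \<longrightarrow> (\<forall>t\<in>F. \<bar>\<alpha> t\<bar> \<le> 1) \<longrightarrow> norm (\<Sum>t\<in>F. \<alpha> t *\<^sub>R w t) \<le> (1::real)"
    by (elim exE conjE) (rule that)
  show False
  proof (rule separable_CSEP_no_c0[OF X sep csep \<open>lam < 2\<close> _ _ _ \<open>0 < \<delta>\<close>])
    show "Q (w t) \<in> X" for t using Q(2) wY by blast
    show "\<delta> \<le> norm (Q (w t))" for t
      using z\<phi> wY big unfolding R_def by (meson order_trans)
    show "norm (\<Sum>t\<in>F. \<alpha> t *\<^sub>R Q (w t)) \<le> C" if F: "finite F" "\<And>t. t \<in> F \<Longrightarrow> \<bar>\<alpha> t\<bar> \<le> 1" for F and \<alpha> :: "nat \<Rightarrow> real"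
    proof -
      have "Q 0 = 0" using Qscale[OF zero_mem, of 0] by simp
      have "(\<Sum>t\<in>F. \<alpha> t *\<^sub>R Q (w t)) = Q (\<Sum>t\<in>F. \<alpha> t *\<^sub>R w t)"
        using F(1)
      proof (induction F rule: finite_induct)
        case (insert t F)
        have "Q (\<alpha> t *\<^sub>R w t) = \<alpha> t *\<^sub>R Q (w t)" using Qscale wY by (metis scaleC_of_real)
        then show ?case using insert wY by (simp add: Qadd sum_mem scaleR_mem)
      qed (simp add: \<open>Q 0 = 0\<close>)
      also have "norm \<dots> \<le> C * norm (\<Sum>t\<in>F. \<alpha> t *\<^sub>R w t)"
        using Q(5) wY by (simp add: sum_mem scaleR_mem)
      also have "\<dots> \<le> C * 1" using wb F Q(4) by (intro mult_left_mono) auto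
      finally show ?thesis by simp
    qed
  qed
qed

section \<open>Injectivity of reflexive spaces\<close>

text \<open>
  All bounded functions converge along a filter finer than a given one: take a cluster point, in the compact product of
  discs, of the evaluation map.
\<close>

lemma filter_of_convergence:
  fixes \<F> :: "'i filter"
  assumes "\<F> \<noteq> bot"
  shows "\<exists>U\<le>\<F>. U \<noteq> bot \<and> (\<forall>h :: 'i \<Rightarrow> complex. (\<exists>B. \<forall>i. cmod (h i) \<le> B) \<longrightarrow> (\<exists>l. (h \<longlongrightarrow> l) U))"
proof -
  define b where "b h = (SOME B. \<forall>i. cmod (h i) \<le> B)" for h :: "'i \<Rightarrow> complex"
  define bd where "bd h \<longleftrightarrow> (\<exists>B. \<forall>i. cmod (h i) \<le> B)" for h :: "'i \<Rightarrow> complex"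
  \<comment> \<open>unbounded functions are replaced by 0, so that every coordinate stays in a disc\<close>
  define ev where "ev i = (\<lambda>h :: 'i \<Rightarrow> complex. if bd h then h i else 0)" for i
  define K where "K = (\<Pi>\<^sub>E h\<in>(UNIV :: ('i \<Rightarrow> complex) set). cball (0::complex) (if bd h then b h else 0))"
  have bb: "cmod (h i) \<le> b h" if "bd h" for h i
    using someI_ex[OF that[unfolded bd_def]] by (simp add: b_def)
  have "compactin (product_topology (\<lambda>_. euclidean) UNIV) K"
    unfolding K_def by (subst compactin_PiE) auto
  then have "compact K" by (simp add: euclidean_product_topology)
  moreover have "ev i \<in> K" for i unfolding K_def ev_def using bb by auto
  then have "filtermap ev \<F> \<le> principal K" by (simp add: le_principal eventually_filtermap)
  moreover have "filtermap ev \<F> \<noteq> bot" using assms by (simp add: filtermap_bot_iff)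
  ultimately obtain l where "l \<in> K" and l: "inf (nhds l) (filtermap ev \<F>) \<noteq> bot"
    unfolding compact_filter le_principal by blast
  define U where "U = inf \<F> (filtercomap ev (nhds l))"
  have "U \<noteq> bot"
  proof
    assume "U = bot"
    then have "eventually (\<lambda>_. False) (inf \<F> (filtercomap ev (nhds l)))" by (simp add: U_def)
    then obtain P P' where P: "eventually P \<F>" "eventually P' (filtercomap ev (nhds l))" "\<And>i. P i \<Longrightarrow> P' i \<Longrightarrow> False"
      unfolding eventually_inf by blast
    obtain P'' where P'': "eventually P'' (nhds l)" "\<And>i. P'' (ev i) \<Longrightarrow> P' i"
      using P(2) unfolding eventually_filtercomap by blast
    have "eventually (\<lambda>f. \<not> P'' f) (filtermap ev \<F>)"
      unfolding eventually_filtermap by (rule eventually_mono[OF P(1)]) (use P(3) P''(2) in blast)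
    then have "eventually (\<lambda>_. False) (inf (nhds l) (filtermap ev \<F>))"
      unfolding eventually_inf using P''(1) by blast
    then show False using l by (simp add: trivial_limit_def)
  qed
  moreover have "U \<le> \<F>" by (simp add: U_def)
  moreover have "\<exists>a. (h \<longlongrightarrow> a) U" if "\<exists>B. \<forall>i. cmod (h i) \<le> B" for h
  proof -
    have "filterlim ev (nhds l) U"
      unfolding U_def filterlim_def filtermap_le_iff_le_filtercomap by simp
    from continuous_on_tendsto_compose[OF continuous_on_product_coordinates[of h] this]
    have "((\<lambda>i. ev i h) \<longlongrightarrow> l h) U" by simp
    moreover have "(\<lambda>i. ev i h) = h" using that by (auto simp: ev_def bd_def)
    ultimately show ?thesis by auto
  qed
  ultimately show ?thesis by blast
qed

text \<open>
  Extensions to the separable pieces of \<open>Y\<close> converge weakly along a suitable filter, the limit being in \<open>X\<close> because \<open>X\<close> is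
  reflexive. Matrix norms are suprema of absolute values of weakly continuous functions, so the bound passes to the limit.
\<close>

lemma reflexive_CSEP_injective:
  fixes X :: "('k::complex_hilbert_space \<Rightarrow>\<^sub>L 'k) set"
  assumes X: "operator_space X" and refl: "reflexive X" and csep: "CSEP TYPE('h::complex_hilbert_space) lam X"
    and "0 \<le> lam"
  shows "injective TYPE('h) lam X"
  unfolding injective_def cb_extension_property_def
proof (intro allI impI, elim conjE)
  fix X1 Y :: "('h \<Rightarrow>\<^sub>L 'h) set" and T
  assume Y: "operator_space Y" and X1: "operator_space X1" "X1 \<subseteq> Y" and T: "completely_bounded X1 X T"
  have csX: "csubspace X" and csY: "csubspace Y" and cs1: "csubspace X1"
    using X Y X1 by (auto simp: operator_space_def)
  define M where "M = lam * cb_norm X1 T"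
  have "0 \<le> M" unfolding M_def using \<open>0 \<le> lam\<close> cb_norm_nonneg[OF T] by simp
  \<comment> \<open>\<open>S\<close> extends \<open>T\<close> with the right bound to some space containing \<open>F\<close>\<close>
  define good where "good F S \<longleftrightarrow> (\<exists>Z. csubspace Z \<and> F \<subseteq> Z \<and> clinear_on Z S \<and> (\<forall>a\<in>Z. S a \<in> X) \<and>
      (\<forall>a\<in>X1 \<inter> Z. S a = T a) \<and>
      (\<forall>n A. (\<forall>i<n. \<forall>j<n. A i j \<in> Z) \<longrightarrow> matrix_norm n (\<lambda>i j. S (A i j)) \<le> M * matrix_norm n A))"
    for F S
  have "\<exists>S. good F S" if F: "finite F" "F \<subseteq> Y" for F
  proof -
    define s where "s = from_nat_into (insert 0 F)"
    have rs: "range s = insert 0 F" unfolding s_def using F(1) by (intro range_from_nat_into) (auto intro: countable_finite)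
    have sY: "s n \<in> Y" for n
    proof -
      have "s n \<in> insert 0 F" unfolding rs[symmetric] by (rule rangeI)
      then show ?thesis using F(2) csubspace_0[OF csY] by auto
    qed
    then have cl: "clin (s n)" for n using Y by (simp add: operator_space_def)
    interpret cstar_algebra "generated_cstar s" by (rule cstar_algebra_generated[of s, OF cl])
    let ?Z = "Y \<inter> generated_cstar s"
    let ?X = "X1 \<inter> generated_cstar s"
    have int: "operator_space (V \<inter> generated_cstar s)" if "operator_space V" for V
      using that operator_space unfolding operator_space_def by (auto simp: csubspace_def)
    obtain D where "countable D" "generated_cstar s \<subseteq> closure D" using generated_cstar_separable[of s, OF cl] by blast
    then have "separable_space (top_of_set ?Z)" unfolding separable_space_iff by blast
    moreover have TX: "completely_bounded ?X X T" "cb_norm ?X T \<le> cb_norm X1 T"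
      using T cb_norm_nonneg[OF T]
      by (intro completely_boundedI[of ?X T X "cb_norm X1 T"] cb_norm_bound[OF T cs1]; auto simp: completely_bounded_def clinear_on_def)+
    ultimately obtain S where S: "completely_bounded ?Z X S" "\<forall>a\<in>?X. S a = T a" "cb_norm ?Z S \<le> lam * cb_norm ?X T"
      using csep int[OF Y] int[OF X1(1)] X1(2) unfolding CSEP_def cb_extension_property_def by blast
    have csZ: "csubspace ?Z" using int[OF Y] by (simp add: operator_space_def)
    have "cb_norm ?Z S \<le> M" unfolding M_def using S(3) mult_left_mono[OF TX(2) \<open>0 \<le> lam\<close>] by linarith
    have "good F S"
      unfolding good_def
    proof (intro exI[of _ ?Z] conjI allI impI)
      show "csubspace ?Z" by (rule csZ)
      show "F \<subseteq> ?Z" proof -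
        have "range s \<subseteq> generated_cstar s" using generated_cstar_mem[of s, OF cl] by auto
        then show ?thesis using F(2) unfolding rs by simp
      qed
      show "clinear_on ?Z S" "\<forall>a\<in>?Z. S a \<in> X" using S(1) by (auto simp: completely_bounded_def)
      show "\<forall>a\<in>X1 \<inter> ?Z. S a = T a" using S(2) by auto
      fix n :: nat and A :: "nat \<Rightarrow> nat \<Rightarrow> 'h \<Rightarrow>\<^sub>L 'h"
      assume "\<forall>i<n. \<forall>j<n. A i j \<in> ?Z"
      then have "matrix_norm n (\<lambda>i j. S (A i j)) \<le> cb_norm ?Z S * matrix_norm n A"
        by (intro cb_norm_bound[OF S(1) csZ]) auto
      also have "\<dots> \<le> M * matrix_norm n A" using \<open>cb_norm ?Z S \<le> M\<close> by (intro mult_right_mono matrix_norm_nonneg)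
      finally show "matrix_norm n (\<lambda>i j. S (A i j)) \<le> M * matrix_norm n A" .
    qed
    then show ?thesis by blast
  qed
  then obtain S where S: "\<And>F. finite F \<Longrightarrow> F \<subseteq> Y \<Longrightarrow> good F (S F)" by metis
  let ?N = "finite_subsets_at_top Y"
  obtain U where U: "U \<le> ?N" "U \<noteq> bot"
    and conv: "\<And>h :: ('h \<Rightarrow>\<^sub>L 'h) set \<Rightarrow> complex. \<exists>B. \<forall>i. cmod (h i) \<le> B \<Longrightarrow> \<exists>l. (h \<longlongrightarrow> l) U"
    using filter_of_convergence[OF finite_subsets_at_top_neq_bot[of Y]] by blast
  have ev: "eventually (\<lambda>F. finite F \<and> F \<subseteq> Y \<and> E \<subseteq> F) U" if E: "finite E" "E \<subseteq> Y" for E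
  proof (rule filter_leD[OF U(1)])
    show "eventually (\<lambda>F. finite F \<and> F \<subseteq> Y \<and> E \<subseteq> F) ?N"
      unfolding eventually_finite_subsets_at_top using E by blast
  qed
  have S_add: "S F (a + b) = S F a + S F b" and S_scale: "S F (c *\<^sub>C a) = c *\<^sub>C S F a"
    and S_ext: "a \<in> X1 \<Longrightarrow> S F a = T a" if F: "finite F" "F \<subseteq> Y" "a \<in> F" "b \<in> F" for F a b c
  proof -
    obtain Z where "F \<subseteq> Z" and lin: "clinear_on Z (S F)" and ext: "\<forall>a\<in>X1 \<inter> Z. S F a = T a"
      using S[OF F(1,2), unfolded good_def] by (elim exE conjE) (rule that)
    then have ab: "a \<in> Z" "b \<in> Z" using F(3,4) by auto
    show "S F (a + b) = S F a + S F b" "S F (c *\<^sub>C a) = c *\<^sub>C S F a"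
      using lin ab by (simp_all add: clinear_on_def)
    show "S F a = T a" if "a \<in> X1" using ext ab(1) that by blast
  qed
  have S_mn: "matrix_norm n (\<lambda>i j. S F (A i j)) \<le> M * matrix_norm n A"
    if F: "finite F" "F \<subseteq> Y" and A: "\<And>i j. i < n \<Longrightarrow> j < n \<Longrightarrow> A i j \<in> F" for F n A
  proof -
    obtain Z where "F \<subseteq> Z"
      and mn: "\<forall>n A. (\<forall>i<n. \<forall>j<n. A i j \<in> Z) \<longrightarrow> matrix_norm n (\<lambda>i j. S F (A i j)) \<le> M * matrix_norm n A"
      using S[OF F, unfolded good_def] by (elim exE conjE) (rule that)
    then have "\<forall>i<n. \<forall>j<n. A i j \<in> Z" using A by blast
    then show ?thesis using mn by simp
  qed
  have SX: "S F y \<in> X" "norm (S F y) \<le> M * norm y" if F: "finite F" "F \<subseteq> Y" "y \<in> F" for F y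
  proof -
    obtain Z where "F \<subseteq> Z" "\<forall>a\<in>Z. S F a \<in> X"
      using S[OF F(1,2), unfolded good_def] by (elim exE conjE) (rule that)
    then show "S F y \<in> X" using F(3) by blast
    show "norm (S F y) \<le> M * norm y"
      using S_mn[OF F(1,2), of "Suc 0" "\<lambda>_ _. y"] F(3) by (simp add: matrix_norm_1)
  qed
  define h where "h y f F = (if finite F \<and> F \<subseteq> Y \<and> y \<in> F then f (S F y) else 0)"
    for y and f :: "('k \<Rightarrow>\<^sub>L 'k) \<Rightarrow> complex" and F
  have h_le: "cmod (h y f F) \<le> (M * norm y) * dual_norm X f" if f: "f \<in> dual X" for y f F
  proof (cases "finite F \<and> F \<subseteq> Y \<and> y \<in> F")
    case True
    then have "cmod (f (S F y)) \<le> dual_norm X f * norm (S F y)" using SX by (intro dual_bound csX f) auto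
    also have "\<dots> \<le> dual_norm X f * (M * norm y)" using SX True by (intro mult_left_mono dual_norm_nonneg csX f) auto
    finally show ?thesis using True by (simp add: h_def mult.commute)
  qed (use \<open>0 \<le> M\<close> dual_norm_nonneg[OF csX f] in \<open>auto simp: h_def\<close>)
  define \<Phi> where "\<Phi> y f = Lim U (h y f)" for y f
  have lim: "(h y f \<longlongrightarrow> \<Phi> y f) U" if f: "f \<in> dual X" for y f
  proof -
    obtain l where l: "(h y f \<longlongrightarrow> l) U" using conv[of "h y f"] h_le[OF f, of y] by blast
    then show ?thesis unfolding \<Phi>_def using tendsto_Lim[OF U(2) l] by simp
  qed
  have "\<Phi> y \<in> bidual X" for y
    unfolding bidual_def mem_Collect_eq
  proof (intro conjI ballI allI exI[of _ "M * norm y"])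
    fix f assume f: "f \<in> dual X"
    show "cmod (\<Phi> y f) \<le> M * norm y * dual_norm X f"
      by (rule tendsto_upperbound[OF tendsto_norm[OF lim[OF f]]]) (use h_le[OF f] U(2) in auto)
    have cf: "(\<lambda>x. c * f x) \<in> dual X" for c
    proof -
      obtain \<Psi> where "\<Psi> \<in> bidual X" by (auto simp: bidual_def intro!: that[of "\<lambda>_. 0"] exI[of _ 0])
      from dual_sum[OF csX, of "{f}" \<Psi> "\<lambda>_. c"] f this show ?thesis by simp
    qed
    show "\<Phi> y (\<lambda>x. c * f x) = c * \<Phi> y f" for c
    proof (rule tendsto_unique[OF U(2) lim[OF cf]])
      have "h y (\<lambda>x. c * f x) = (\<lambda>F. c * h y f F)" by (auto simp: h_def)
      then show "(h y (\<lambda>x. c * f x) \<longlongrightarrow> c * \<Phi> y f) U" by (simp add: tendsto_mult_left lim[OF f])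
    qed
    fix g assume g: "g \<in> dual X"
    have fg: "(\<lambda>x. f x + g x) \<in> dual X"
    proof -
      obtain K L where "\<forall>x\<in>X. cmod (f x) \<le> K * norm x" "\<forall>x\<in>X. cmod (g x) \<le> L * norm x"
        using f g unfolding dual_def by blast
      then have "\<forall>x\<in>X. cmod (f x + g x) \<le> (K + L) * norm x"
        by (auto intro!: order_trans[OF norm_triangle_ineq] add_mono simp: distrib_right)
      then show ?thesis using f g unfolding dual_def by (auto simp: distrib_left)
    qed
    show "\<Phi> y (\<lambda>x. f x + g x) = \<Phi> y f + \<Phi> y g"
    proof (rule tendsto_unique[OF U(2) lim[OF fg]])
      have "h y (\<lambda>x. f x + g x) = (\<lambda>F. h y f F + h y g F)" by (auto simp: h_def)
      then show "(h y (\<lambda>x. f x + g x) \<longlongrightarrow> \<Phi> y f + \<Phi> y g) U" by (simp add: tendsto_add lim[OF f] lim[OF g])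
    qed
  qed
  then have "\<forall>y. \<exists>x. x \<in> X \<and> (\<forall>f\<in>dual X. \<Phi> y f = f x)" using refl unfolding reflexive_def by blast
  then obtain T' where T'X: "\<And>y. T' y \<in> X" and T': "\<And>y f. f \<in> dual X \<Longrightarrow> \<Phi> y f = f (T' y)" by metis
  have weak: "((\<lambda>F. cinner p (S F y q)) \<longlongrightarrow> cinner p (T' y q)) U" if y: "y \<in> Y" for y p q
  proof -
    let ?f = "vector_functional X p q"
    have "(h y ?f \<longlongrightarrow> ?f (T' y)) U"
      using lim[OF vector_functional_dual[OF csX]] T'[OF vector_functional_dual[OF csX]] by metis
    moreover have "eventually (\<lambda>F. h y ?f F = cinner p (S F y q)) U"
      by (rule eventually_mono[OF ev[of "{y}"]]) (use y SX in \<open>auto simp: h_def vector_functional_def\<close>)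
    ultimately have "((\<lambda>F. cinner p (S F y q)) \<longlongrightarrow> ?f (T' y)) U" by (rule Lim_transform_eventually)
    then show ?thesis using T'X by (simp add: vector_functional_def)
  qed
  have eqI: "A = B" if "\<And>p q. cinner p (blinfun_apply A q) = cinner p (blinfun_apply B q)" for A B :: "'k \<Rightarrow>\<^sub>L 'k"
    by (intro blinfun_eqI cinner_eqI that)
  have add: "T' (a + b) = T' a + T' b" if ab: "a \<in> Y" "b \<in> Y" for a b
  proof (rule eqI)
    fix p q
    have "eventually (\<lambda>F. cinner p (S F a q) + cinner p (S F b q) = cinner p (S F (a + b) q)) U"
    proof (rule eventually_mono[OF ev[of "{a, b, a + b}"]])
      fix F assume F: "finite F \<and> F \<subseteq> Y \<and> {a, b, a + b} \<subseteq> F"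
      then have "S F (a + b) = S F a + S F b" by (intro S_add) auto
      then show "cinner p (S F a q) + cinner p (S F b q) = cinner p (S F (a + b) q)"
        by (simp add: blinfun.add_left cinner_simps)
    qed (use ab csubspace_add[OF csY] in auto)
    from Lim_transform_eventually[OF tendsto_add[OF weak[OF ab(1)] weak[OF ab(2)]] this]
    have "cinner p (T' (a + b) q) = cinner p (T' a q) + cinner p (T' b q)"
      by (rule tendsto_unique[OF U(2) weak[OF csubspace_add[OF csY ab]]])
    then show "cinner p (T' (a + b) q) = cinner p ((T' a + T' b) q)" by (simp add: blinfun.add_left cinner_simps)
  qed
  have scale: "T' (c *\<^sub>C a) = c *\<^sub>C T' a" if a: "a \<in> Y" for a c
  proof (rule eqI)
    fix p q
    have "eventually (\<lambda>F. c * cinner p (S F a q) = cinner p (S F (c *\<^sub>C a) q)) U"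
    proof (rule eventually_mono[OF ev[of "{a, c *\<^sub>C a}"]])
      fix F assume F: "finite F \<and> F \<subseteq> Y \<and> {a, c *\<^sub>C a} \<subseteq> F"
      then have "S F (c *\<^sub>C a) = c *\<^sub>C S F a" by (intro S_scale) auto
      then show "c * cinner p (S F a q) = cinner p (S F (c *\<^sub>C a) q)" by (simp add: cinner_simps)
    qed (use a csubspace_scaleC[OF csY] in auto)
    from Lim_transform_eventually[OF tendsto_mult_left[OF weak[OF a]] this]
    have "cinner p (T' (c *\<^sub>C a) q) = c * cinner p (T' a q)"
      by (rule tendsto_unique[OF U(2) weak[OF csubspace_scaleC[OF csY a]]])
    then show "cinner p (T' (c *\<^sub>C a) q) = cinner p ((c *\<^sub>C T' a) q)" by (simp add: cinner_simps)
  qed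
  have ext: "T' a = T a" if a: "a \<in> X1" for a
  proof (rule eqI)
    fix p q
    have aY: "a \<in> Y" using a X1(2) by blast
    have "eventually (\<lambda>F. cinner p (T a q) = cinner p (S F a q)) U"
    proof (rule eventually_mono[OF ev[of "{a}"]])
      fix F assume F: "finite F \<and> F \<subseteq> Y \<and> {a} \<subseteq> F"
      then have "S F a = T a" using a by (intro S_ext) auto
      then show "cinner p (T a q) = cinner p (S F a q)" by simp
    qed (use aY in auto)
    from Lim_transform_eventually[OF tendsto_const this]
    show "cinner p (T' a q) = cinner p (T a q)" by (rule tendsto_unique[OF U(2) weak[OF aY]])
  qed
  have mn: "matrix_norm n (\<lambda>i j. T' (A i j)) \<le> M * matrix_norm n A" if A: "\<And>i j. i < n \<Longrightarrow> j < n \<Longrightarrow> A i j \<in> Y" for n A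
  proof (rule matrix_norm_leI)
    show "0 \<le> M * matrix_norm n A" using \<open>0 \<le> M\<close> matrix_norm_nonneg by (rule mult_nonneg_nonneg)
    fix x y :: "nat \<Rightarrow> 'k"
    let ?E = "(\<lambda>(i, j). A i j) ` ({..<n} \<times> {..<n})"
    have limf: "((\<lambda>F. matrix_form n (\<lambda>i j. S F (A i j)) x y) \<longlongrightarrow> matrix_form n (\<lambda>i j. T' (A i j)) x y) U"
      by (intro tendsto_sum weak A) auto
    show "cmod (matrix_form n (\<lambda>i j. T' (A i j)) x y) \<le>
        M * matrix_norm n A * L2_set (\<lambda>j. norm (x j)) {..<n} * L2_set (\<lambda>j. norm (y j)) {..<n}"
    proof (rule tendsto_upperbound[OF tendsto_norm[OF limf] _ U(2)], rule eventually_mono[OF ev[of ?E]])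
      fix F assume F: "finite F \<and> F \<subseteq> Y \<and> ?E \<subseteq> F"
      have "A i j \<in> F" if "i < n" "j < n" for i j
      proof -
        have "A i j \<in> ?E" using that by (intro image_eqI[of _ _ "(i, j)"]) auto
        then show ?thesis using F by blast
      qed
      then have "matrix_norm n (\<lambda>i j. S F (A i j)) \<le> M * matrix_norm n A" using F by (intro S_mn) auto
      then have "matrix_norm n (\<lambda>i j. S F (A i j)) * L2_set (\<lambda>j. norm (x j)) {..<n} * L2_set (\<lambda>j. norm (y j)) {..<n}
          \<le> M * matrix_norm n A * L2_set (\<lambda>j. norm (x j)) {..<n} * L2_set (\<lambda>j. norm (y j)) {..<n}"
        by (intro mult_right_mono L2_set_nonneg)
      then show "cmod (matrix_form n (\<lambda>i j. S F (A i j)) x y) \<le>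
          M * matrix_norm n A * L2_set (\<lambda>j. norm (x j)) {..<n} * L2_set (\<lambda>j. norm (y j)) {..<n}"
        using matrix_form_le order_trans by blast
    qed (use A in auto)
  qed
  have "completely_bounded Y X T'" "cb_norm Y T' \<le> M"
    using completely_boundedI[of Y T' X M] add scale T'X \<open>0 \<le> M\<close> mn by (auto simp: clinear_on_def)
  then show "\<exists>T'. completely_bounded Y X T' \<and> (\<forall>A\<in>X1. T' A = T A) \<and> cb_norm Y T' \<le> lam * cb_norm X1 T"
    using ext by (intro exI[of _ T']) (auto simp: M_def)
qed

text \<open>
  This covers \<open>lam < 0\<close>, for which the extension property holds for the zero space only.
\<close>

lemma injective_zero_space:
  fixes X :: "('k::complex_hilbert_space \<Rightarrow>\<^sub>L 'k) set"
  assumes "X = {0}"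
  shows "injective TYPE('h::complex_hilbert_space) lam X"
  unfolding injective_def cb_extension_property_def
proof (intro allI impI, elim conjE)
  fix X1 Y :: "('h \<Rightarrow>\<^sub>L 'h) set" and T
  assume T: "completely_bounded X1 X T"
  have z: "matrix_norm n (\<lambda>i j. 0 :: 'k \<Rightarrow>\<^sub>L 'k) \<le> 0" for n
    using matrix_norm_le_sum[of n "\<lambda>i j. 0"] by simp
  have T0: "\<forall>a\<in>X1. T a = 0" using T assms by (auto simp: completely_bounded_def)
  have "cb_norm X1 T \<le> 0"
  proof (rule completely_boundedI(2)[where Z = X])
    show "clinear_on X1 T" using T by (simp add: completely_bounded_def)
    fix n and A :: "nat \<Rightarrow> nat \<Rightarrow> 'h \<Rightarrow>\<^sub>L 'h" assume A: "\<And>i j. i < n \<Longrightarrow> j < n \<Longrightarrow> A i j \<in> X1"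
    have "matrix_norm n (\<lambda>i j. T (A i j)) = matrix_norm n (\<lambda>i j. 0 :: 'k \<Rightarrow>\<^sub>L 'k)"
      by (rule matrix_norm_cong) (use T0 A in blast)
    then show "matrix_norm n (\<lambda>i j. T (A i j)) \<le> 0 * matrix_norm n A" using z by simp
  qed (use T in \<open>auto simp: completely_bounded_def\<close>)
  then have "cb_norm X1 T = 0" using cb_norm_nonneg[OF T] by simp
  moreover have "completely_bounded Y X (\<lambda>_. 0)" "cb_norm Y (\<lambda>_. 0 :: 'k \<Rightarrow>\<^sub>L 'k) \<le> 0"
    by (rule completely_boundedI[where Z = X and K = 0]; simp add: clinear_on_def assms z)+
  ultimately show "\<exists>T'. completely_bounded Y X T' \<and> (\<forall>A\<in>X1. T' A = T A) \<and> cb_norm Y T' \<le> lam * cb_norm X1 T"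
    using T0 by (intro exI[of _ "\<lambda>_. 0"]) auto
qed

theorem proposition2p22:
  fixes X :: "('k::complex_hilbert_space \<Rightarrow>\<^sub>L 'k) set" and lam :: real
  assumes "operator_space X" and "separable_space (top_of_set X)"
    and "CSEP TYPE(ell2) lam X" and "lam < 2"
  shows "reflexive X \<and> injective TYPE('h::complex_hilbert_space) lam X"
proof
  have csep: "CSEP TYPE('k) lam X" by (rule CSEP_transfer[OF assms(3)])
  show refl: "reflexive X" by (rule separable_CSEP_reflexive[OF assms(1,2) csep assms(4)])
  show "injective TYPE('h) lam X"
  proof (cases "0 \<le> lam")
    case True
    then show ?thesis by (rule reflexive_CSEP_injective[OF assms(1) refl CSEP_transfer[OF assms(3)]])
  next
    case False
    obtain Q C where Q: "\<forall>a\<in>X. Q a = a" "\<forall>a\<in>X. norm (Q a) \<le> C * norm a" "C \<le> max lam 0"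
      using bounded_projection[OF csep assms(1,1) subset_refl assms(2)] by blast
    have "a = 0" if "a \<in> X" for a
    proof -
      have "norm a \<le> C * norm a" using Q(1,2) that by force
      also have "\<dots> \<le> 0 * norm a" using Q(3) False by (intro mult_right_mono) auto
      finally show ?thesis by simp
    qed
    moreover have "0 \<in> X" using assms(1) by (simp add: operator_space_def csubspace_def)
    ultimately show ?thesis by (intro injective_zero_space) blast
  qed
qed

end
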